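(* Let the data, the sequence $p_j\downarrow1$, the solutions $u_{p_j}(x)=v_{p_j}(|x|)$ and the limit objects $u,v,w,\mathtt G,\mathtt K,\mathbf z,\mathscr C_1,\mathscr C_<$ be as described in the context. Then $$-\Delta_1u=\mathtt K(|x|)\quad\text{in }\mathbb R^n$$ in the sense defined in the context. (i) If, for every $(r,t)\in[0,\infty)\times[0,\xi_1]$, the map $\rho\mapsto F_1(r,t,\rho)$ is affine on $[0,\xi_2]$, then $$\mathtt K(|x|)=w(x)^{-\mathbf c}F_1(|x|,u(x),|\nabla u(x)|)\quad\text{for a.e. }x\in\mathbb R^n.$$ (ii) One has $|v'(r)|=0$ for a.e. $r\in\mathscr C_<$, and $$\mathtt K(|x|)=w(x)^{-\mathbf c}F_1(|x|,u(x),|\nabla u(x)|)\quad\text{for a.e. }x\in\mathbb R^n\text{ with }|x|\in\mathscr C_<.$$ Suppose that $E\subset\mathscr C_1$ is measurable with $|E|>0$, and assume that $$a(r):=\lim_{j\to\infty}\frac{\mathtt G_{p_j}(r)-1}{p_j-1}\in\mathbb R\quad\text{(exists and is finite) for a.e. }r\in E.$$ Then $$|v'(r)|=e^{a(r)}\quad\text{for a.e. }r\in E,$$ and $$\mathtt K(|x|)=w(x)^{-\mathbf c}F_1(|x|,u(x),|\nabla u(x)|)=\frac{n-1}{|x|}\quad\text{for a.e. }x\in\mathbb R^n\text{ with }|x|\in E.$$ Hence $$\mathtt K(|x|)=w(x)^{-\mathbf c}F_1(|x|,u(x),|\nabla u(x)|)\quad\text{for a.e. }x\in\mathbb R^n\text{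 with }|x|\in\mathscr C_<\cup E.$$
   Context: **Data and admissibility.** Let $n\ge2$ be an integer, $0<\alpha\le1$, and let $\ell,\xi_1,\xi_2>0$ be constants independent of $p$. For $1<p<\min\{2,\sqrt n\}$ put $\varphi_p(r):=\max\{\ell,r\}^{-\frac{n-p}{p-1}}$, $r\ge0$. For such $p$ let $\beta_p\in\mathbb R$ and functions $F_p:[0,\infty)^3\to\mathbb R$, $\phi_p:[0,\infty)^2\to\mathbb R$ be given (the function $\phi_p$ is not to be confused with $\varphi_p$). The data $(F_p,\phi_p,\beta_p)$ are *admissible at $p$* if all of the following hold: (0) $0\le\beta_p<p-1$ and $\ell^{-(n-p)/(p-1)}\le\xi_1^2$. (1) $F_p\in C^{0,\alpha}_{\mathrm{loc}}([0,\infty)^3)$, $\phi_p\in C^0([0,\infty)^2)$, and $0\le\phi_p(r,u)\le F_p(r,u,\rho)$ for all $r\ge0$, $0<u\le\xi_1$, $0\le\rho\le\xi_2$. (2) For every $r\ge0$, $u\mapsto\phi_p(r,u)$ is nondecreasing on $[0,\xi_1]$, and $(u,\rho)\mapsto F_p(r,u,\rho)$ is nondecreasing in each variable on $[0,\xi_1]\times[0,\xi_2]$. (3) $\xi_1^{p-1-\beta_p}\left(\frac{p-1}{n-p}\right)^{p-1}\int_0^\ell t^{n-1}\phi_p(t,\xi_1^{-1}\varphi_p(t))\,dt\ge1$. (4) $\int_0^\infty\left[s^{1-n}\int_0^s t^{n-1}F_p(t,\xi_1,\xi_2)\varphi_p(t)^{-\beta_p}\,dt\right]^{1/(p-1)}ds\le\xi_1^{1-\beta_p/(p-1)}$.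 (5) For every $s>0$, $s^{1-n}\int_0^s t^{n-1}F_p(t,\xi_1,\xi_2)\varphi_p(t)^{-\beta_p}\,dt\le\xi_2^{p-1}\xi_1^{-\beta_p}$. (6) There is a constant $C>0$, independent of $r$, with $F_p(r,\xi_1,\xi_2)\varphi_p(r)^{-\beta_p}<C$ for all $r\ge0$. (7) $\int_0^\infty t^{n-1}F_p(t,\xi_1,\xi_2)\varphi_p(t)^{-\beta_p}\,dt<\infty$. **The solutions.** $v_p\in C^1([0,\infty))$ denotes a function with $\xi_1^{-1}\varphi_p(r)\le v_p(r)\le\xi_1$ and $|v_p'(r)|\le\xi_2$ for $r\ge0$, with $\int_0^\infty\left[s^{1-n}\int_0^s t^{n-1}v_p(t)\,dt\right]^{1/(p-1)}ds<\infty$, and $$v_p(r)=\int_r^\infty\left[s^{1-n}\int_0^s t^{n-1}F_p(t,v_p(t),|v_p'(t)|)v_p(t)^{-\beta_p}\,dt\right]^{1/(p-1)}ds,\quad r\ge0$$ (such $v_p$ exists when the data are admissible at $p$). Put $u_p(x):=v_p(|x|)$, $$\mathtt K_p(r):=F_p(r,v_p(r),|v_p'(r)|)v_p(r)^{-\beta_p},\quad \mathtt G_p(r):=r^{1-n}\int_0^r s^{n-1}\mathtt K_p(s)\,ds\ (r>0),\quad \mathtt G_p(0):=0.$$ **Standing hypotheses.** $(p_j)\subset(1,\min\{2,\sqrt n\})$, $p_j\downarrow1$; the data are admissible at each $p_j$ (with $\ell,\xi_1,\xi_2$ independent of $j$); $F_p\to F_1$ locally uniformly in $[0,\infty)^3$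 as $p\downarrow1$ with $F_1\in C^{0,\alpha}_{\mathrm{loc}}([0,\infty)^3)$; and $\beta_p/(p-1)\to\mathbf c\in[0,1]$ as $p\downarrow1$. **Limit objects.** The sequence (after extraction, not relabeled) and the objects below satisfy: - $u_{p_j}\to u$ in $C_{\mathrm{loc}}(\mathbb R^n)$, $\nabla u_{p_j}\stackrel{*}{\rightharpoonup}\nabla u$ in $L^\infty_{\mathrm{loc}}(\mathbb R^n;\mathbb R^n)$, $u(x)=v(|x|)$, $u\in W^{1,\infty}(\mathbb R^n)$, $0\le u\le\xi_1$, $\|\nabla u\|_{L^\infty}\le\xi_2$; - $w:\mathbb R^n\to(0,1]$ is radial, $u_{p_j}^{p_j-1}\to w$ a.e. and in $L^q_{\mathrm{loc}}(\mathbb R^n)$ for all $1\le q<\infty$, $(\max\{\ell,|x|\})^{-(n-1)}\le w(x)\le1$ a.e., $w=1$ a.e. on $\{u>0\}$; - $\mathtt G\in W^{1,\infty}_{\mathrm{loc}}([0,\infty))$, $\mathtt G_{p_j}\to\mathtt G$ in $C_{\mathrm{loc}}([0,\infty))$, $0\le\mathtt G\le1$, $\mathtt G(0)=0$; - $\mathbf z\in W^{1,\infty}_{\mathrm{loc}}(\mathbb R^n;\mathbb R^n)$, $\mathbf z(x)=-\mathtt G(|x|)x/|x|$ for $x\neq0$, $|\mathbf z|\le1$; - $\mathtt K\in L^\infty_{\mathrm{loc}}([0,\infty))$, $-\operatorname{div}\mathbf z=\mathtt K(|x|)$, $\mathtt K(r)=\mathtt G'(r)+\frac{n-1}r\mathtt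 G(r)$ for a.e. $r>0$; - $(\mathbf z,Du)=|Du|$, $\mathbf z\cdot\nabla u=|\nabla u|$ a.e., $(1-\mathtt G(r))|v'(r)|=0$ for a.e. $r>0$; - $\mathscr C_1:=\{r>0\mid\mathtt G(r)=1\}$, $\mathscr C_<:=\{r>0\mid\mathtt G(r)<1\}$; $\mathtt K(|x|)=w(x)^{-\mathbf c}F_1(|x|,u(x),0)$ for a.e. $x$ with $|x|\in\mathscr C_<$, and, if $|\mathscr C_1|>0$, $\mathtt K(|x|)=\frac{n-1}{|x|}$ for a.e. $x$ with $|x|\in\mathscr C_1$; - there are $r_0>0$, $\delta\in(0,1)$ with $\sup_{|x|\le r_0}|\nabla u_{p_j}(x)|\le\delta^{1/(p_j-1)}$ for all large $j$, $\mathtt G\le\delta$ on $[0,r_0]$ and $\nabla u=0$ a.e. in $B_{r_0}$. **Conventions.** $|E|$ is Lebesgue measure. $f_j\stackrel{*}{\rightharpoonup}f$ in $L^\infty_{\mathrm{loc}}(\Omega;\mathbb R^m)$ means $\int_U f_j\cdot\psi\,dx\to\int_U f\cdot\psi\,dx$ for every open $U\Subset\Omega$ and every $\psi\in L^1(U;\mathbb R^m)$. $W^{1,\infty}_{\mathrm{loc}}([0,\infty))$, $L^\infty_{\mathrm{loc}}([0,\infty))$ mean membership in the corresponding space on $(0,R)$ for every $R>0$. **Anzellotti pairing and the 1-Laplacian.** $|Du|$ is the total variation measure of the distributional derivative $Du$. For $\mathbf z\in L^\infty_{\mathrm{loc}}(\mathbb R^n;\mathbb R^n)$ with $\operatorname{div}\mathbf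 z\in L^\infty_{\mathrm{loc}}(\mathbb R^n)$ and $u\in BV_{\mathrm{loc}}(\mathbb R^n)\cap L^\infty_{\mathrm{loc}}(\mathbb R^n)$, $(\mathbf z,Du)$ is the Radon measure given by $\langle(\mathbf z,Du),\zeta\rangle=-\int u\,\zeta\operatorname{div}\mathbf z\,dx-\int u\,\mathbf z\cdot\nabla\zeta\,dx$ for $\zeta\in C_c^\infty(\mathbb R^n)$. For such $u$ and $f\in L^\infty_{\mathrm{loc}}(\mathbb R^n)$, $-\Delta_1u=f$ means: there is $\mathbf z\in L^\infty_{\mathrm{loc}}(\mathbb R^n;\mathbb R^n)$ with $\operatorname{div}\mathbf z\in L^\infty_{\mathrm{loc}}(\mathbb R^n)$, $-\operatorname{div}\mathbf z=f$ in the sense of distributions, $|\mathbf z|\le1$ a.e., and $(\mathbf z,Du)=|Du|$ as Radon measures. *)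

theory Defs
  imports "HOL-Analysis.Analysis"
begin

section \<open>Function spaces, weak derivatives\<close>

definition grad :: "('a::euclidean_space \<Rightarrow> real) \<Rightarrow> 'a \<Rightarrow> 'a" where
  "grad f x = (SOME D. GDERIV f x :> D)"

primrec Ck :: "nat \<Rightarrow> ('a::euclidean_space \<Rightarrow> real) \<Rightarrow> bool" where
  "Ck 0 f \<longleftrightarrow> continuous_on UNIV f"
| "Ck (Suc k) f \<longleftrightarrow> (\<forall>x. f differentiable (at x)) \<and> (\<forall>b\<in>Basis. Ck k (\<lambda>x. grad f x \<bullet> b))"

text \<open>\<open>C\<^sub>c\<^sup>\<infinity>(\<Omega>)\<close>; its members are regarded as extended by zero to the whole space.\<close>

definition test_function :: "'a::euclidean_space set \<Rightarrow> ('a \<Rightarrow> real) \<Rightarrow> bool" where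
  "test_function \<Omega> \<zeta> \<longleftrightarrow> (\<forall>k. Ck k \<zeta>) \<and>
     compact (closure {x. \<zeta> x \<noteq> 0}) \<and> closure {x. \<zeta> x \<noteq> 0} \<subseteq> \<Omega>"

definition L1_loc :: "'a::euclidean_space set \<Rightarrow> ('a \<Rightarrow> 'b::euclidean_space) \<Rightarrow> bool" where
  "L1_loc \<Omega> f \<longleftrightarrow> (\<forall>S. compact S \<and> S \<subseteq> \<Omega> \<longrightarrow> f absolutely_integrable_on S)"

definition Linf_on :: "'a::euclidean_space set \<Rightarrow> ('a \<Rightarrow> 'b::euclidean_space) \<Rightarrow> bool" where
  "Linf_on \<Omega> f \<longleftrightarrow> f \<in> borel_measurable (lebesgue_on \<Omega>) \<and>
     (\<exists>C. AE x in lebesgue_on \<Omega>. norm (f x) \<le> C)"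

definition Linf_loc :: "('a::euclidean_space \<Rightarrow> 'b::euclidean_space) \<Rightarrow> bool" where
  "Linf_loc f \<longleftrightarrow> (\<forall>S. compact S \<longrightarrow> Linf_on S f)"

definition weak_grad_on :: "'a::euclidean_space set \<Rightarrow> ('a \<Rightarrow> real) \<Rightarrow> ('a \<Rightarrow> 'a) \<Rightarrow> bool" where
  "weak_grad_on \<Omega> f g \<longleftrightarrow> L1_loc \<Omega> f \<and> L1_loc \<Omega> g \<and>
     (\<forall>\<zeta>. test_function \<Omega> \<zeta> \<longrightarrow>
        (LINT x:\<Omega>|lebesgue. f x *\<^sub>R grad \<zeta> x) = - (LINT x:\<Omega>|lebesgue. \<zeta> x *\<^sub>R g x))"

text \<open>\<open>f \<in> W\<^sup>1\<^sup>,\<^sup>\<infinity>(\<Omega>)\<close> with weak gradient \<open>g\<close>.  For \<open>\<Omega> \<subseteq> \<real>\<close>, \<open>g\<close> is the weak derivative.\<close>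

definition W1inf_on :: "'a::euclidean_space set \<Rightarrow> ('a \<Rightarrow> real) \<Rightarrow> ('a \<Rightarrow> 'a) \<Rightarrow> bool" where
  "W1inf_on \<Omega> f g \<longleftrightarrow> Linf_on \<Omega> f \<and> Linf_on \<Omega> g \<and> weak_grad_on \<Omega> f g"

definition W1inf_loc_vec :: "('a::euclidean_space \<Rightarrow> 'a) \<Rightarrow> bool" where
  "W1inf_loc_vec z \<longleftrightarrow>
     (\<forall>U. open U \<and> bounded U \<longrightarrow> (\<forall>b\<in>Basis. \<exists>g. W1inf_on U (\<lambda>x. z x \<bullet> b) g))"

text \<open>\<open>div z = d\<close> in the sense of distributions on the whole space.\<close>

definition weak_div :: "('a::euclidean_space \<Rightarrow> 'a) \<Rightarrow> ('a \<Rightarrow> real) \<Rightarrow> bool" where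
  "weak_div z d \<longleftrightarrow> L1_loc UNIV z \<and> L1_loc UNIV d \<and>
     (\<forall>\<zeta>. test_function UNIV \<zeta> \<longrightarrow>
        (LINT x|lebesgue. z x \<bullet> grad \<zeta> x) = - (LINT x|lebesgue. d x * \<zeta> x))"

definition weak_star_Linf_loc ::
    "(nat \<Rightarrow> 'a::euclidean_space \<Rightarrow> 'b::euclidean_space) \<Rightarrow> ('a \<Rightarrow> 'b) \<Rightarrow> bool" where
  "weak_star_Linf_loc f g \<longleftrightarrow>
     (\<forall>U \<psi>. open U \<and> bounded U \<and> set_integrable lebesgue U \<psi> \<longrightarrow>
        (\<lambda>j. LINT x:U|lebesgue. f j x \<bullet> \<psi> x) \<longlonglongrightarrow> (LINT x:U|lebesgue. g x \<bullet> \<psi> x))"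

definition tendsto_Lq_loc ::
    "real \<Rightarrow> (nat \<Rightarrow> 'a::euclidean_space \<Rightarrow> real) \<Rightarrow> ('a \<Rightarrow> real) \<Rightarrow> bool" where
  "tendsto_Lq_loc q f g \<longleftrightarrow>
     (\<forall>j. f j \<in> borel_measurable lebesgue) \<and> g \<in> borel_measurable lebesgue \<and>
     (\<forall>S. compact S \<longrightarrow>
        (\<lambda>j. \<integral>\<^sup>+x\<in>S. ennreal (\<bar>f j x - g x\<bar> powr q) \<partial>lebesgue) \<longlonglongrightarrow> 0)"

definition locally_uniform_on ::
    "'a::topological_space set \<Rightarrow> ('i \<Rightarrow> 'a \<Rightarrow> real) \<Rightarrow> ('a \<Rightarrow> real) \<Rightarrow> 'i filter \<Rightarrow> bool" where
  "locally_uniform_on S f g \<F> \<longleftrightarrow>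
     (\<forall>T. compact T \<and> T \<subseteq> S \<longrightarrow> uniform_limit T f g \<F>)"

definition hoelder_loc_on :: "real \<Rightarrow> 'a::metric_space set \<Rightarrow> ('a \<Rightarrow> real) \<Rightarrow> bool" where
  "hoelder_loc_on \<alpha> S f \<longleftrightarrow> (\<forall>T. compact T \<and> T \<subseteq> S \<longrightarrow>
     (\<exists>C. \<forall>x\<in>T. \<forall>y\<in>T. \<bar>f x - f y\<bar> \<le> C * dist x y powr \<alpha>))"


section \<open>Total variation, Anzellotti pairing and the 1-Laplacian\<close>

definition divg :: "('a::euclidean_space \<Rightarrow> 'a) \<Rightarrow> 'a \<Rightarrow> real" where
  "divg \<psi> x = (\<Sum>b\<in>Basis. grad (\<lambda>y. \<psi> y \<bullet> b) x \<bullet> b)"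

text \<open>Total variation on an open set \<open>U\<close> of the distributional derivative
  \<open>\<langle>Du, \<psi>\<rangle> = - \<integral> u div \<psi>\<close>.  The field \<open>\<psi> = 0\<close> is admitted, so that truncating
  negative values by \<^const>\<open>ennreal\<close> does not change the supremum.\<close>

definition variation :: "('a::euclidean_space \<Rightarrow> real) \<Rightarrow> 'a set \<Rightarrow> ennreal" where
  "variation u U =
     (SUP \<psi>\<in>{\<psi>. (\<forall>b\<in>Basis. test_function U (\<lambda>x. \<psi> x \<bullet> b)) \<and> (\<forall>x. norm (\<psi> x) \<le> 1)}.
        ennreal (- (LINT x|lebesgue. u x * divg \<psi> x)))"

definition BV_loc :: "('a::euclidean_space \<Rightarrow> real) \<Rightarrow> bool" where
  "BV_loc u \<longleftrightarrow> L1_loc UNIV u \<and> (\<forall>U. open U \<and> bounded U \<longrightarrow> variation u U < \<infinity>)"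

text \<open>The Borel measure \<open>|Du|\<close>, extended from open sets by outer regularity.  For
  \<open>u \<in> BV\<^sub>l\<^sub>o\<^sub>c\<close> the set function is countably additive on Borel sets, so that
  \<^const>\<open>measure_of\<close> does return it.\<close>

definition TV_measure :: "('a::euclidean_space \<Rightarrow> real) \<Rightarrow> 'a measure" where
  "TV_measure u =
     measure_of UNIV (sets borel) (\<lambda>A. INF U\<in>{U. open U \<and> A \<subseteq> U}. variation u U)"

text \<open>\<open>\<langle>(z, Du), \<zeta>\<rangle>\<close>, where \<open>d\<close> stands for \<open>div z\<close>.\<close>

definition pairing ::
    "('a::euclidean_space \<Rightarrow> 'a) \<Rightarrow> ('a \<Rightarrow> real) \<Rightarrow> ('a \<Rightarrow> real) \<Rightarrow> ('a \<Rightarrow> real) \<Rightarrow> real" where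
  "pairing z d u \<zeta> =
     - (LINT x|lebesgue. u x * \<zeta> x * d x) - (LINT x|lebesgue. u x * (z x \<bullet> grad \<zeta> x))"

text \<open>The Radon measure \<open>(z, Du)\<close> is the positive measure \<open>\<mu>\<close>.\<close>

definition pairing_measure ::
    "('a::euclidean_space \<Rightarrow> 'a) \<Rightarrow> ('a \<Rightarrow> real) \<Rightarrow> ('a \<Rightarrow> real) \<Rightarrow> 'a measure \<Rightarrow> bool" where
  "pairing_measure z d u \<mu> \<longleftrightarrow>
     sets \<mu> = sets borel \<and> (\<forall>S. compact S \<longrightarrow> emeasure \<mu> S < \<infinity>) \<and>
     (\<forall>\<zeta>. test_function UNIV \<zeta> \<longrightarrow> pairing z d u \<zeta> = (LINT x|\<mu>. \<zeta> x))"

text \<open>\<open>- \<Delta>\<^sub>1 u = f\<close>\<close>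

definition one_laplace_eq :: "('a::euclidean_space \<Rightarrow> real) \<Rightarrow> ('a \<Rightarrow> real) \<Rightarrow> bool" where
  "one_laplace_eq u f \<longleftrightarrow> BV_loc u \<and> Linf_loc u \<and> Linf_loc f \<and>
     (\<exists>z. Linf_loc z \<and> weak_div z (\<lambda>x. - f x) \<and> (AE x in lebesgue. norm (z x) \<le> 1) \<and>
          pairing_measure z (\<lambda>x. - f x) u (TV_measure u))"


section \<open>Data and radial solutions\<close>

definition barrier :: "nat \<Rightarrow> real \<Rightarrow> real \<Rightarrow> real \<Rightarrow> real" where
  "barrier n l p r = max l r powr (- ((real n - p) / (p - 1)))"

text \<open>\<open>s\<^sup>1\<^sup>-\<^sup>n \<integral>\<^sub>0\<^sup>s t\<^sup>n\<^sup>-\<^sup>1 f(t) dt\<close>.  For \<open>n \<ge> 2\<close> the value at \<open>s = 0\<close> is \<open>0\<close>,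
  since division by zero yields zero.\<close>

definition radial_flux :: "nat \<Rightarrow> (real \<Rightarrow> real) \<Rightarrow> real \<Rightarrow> real" where
  "radial_flux n f s = (LINT t:{0..s}|lebesgue. t ^ (n - 1) * f t) / s ^ (n - 1)"

definition admissible ::
    "nat \<Rightarrow> real \<Rightarrow> real \<Rightarrow> real \<Rightarrow> real \<Rightarrow> real \<Rightarrow>
     (real \<times> real \<times> real \<Rightarrow> real) \<Rightarrow> (real \<times> real \<Rightarrow> real) \<Rightarrow> real \<Rightarrow> bool" where
  "admissible n \<alpha> l \<xi>1 \<xi>2 p F \<phi> \<beta> \<longleftrightarrow>
     \<comment> \<open>(0)\<close>
     (0 \<le> \<beta> \<and> \<beta> < p - 1 \<and> l powr (- ((real n - p) / (p - 1))) \<le> \<xi>1\<^sup>2) \<and>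
     \<comment> \<open>(1)\<close>
     (hoelder_loc_on \<alpha> ({0..} \<times> {0..} \<times> {0..}) F \<and> continuous_on ({0..} \<times> {0..}) \<phi> \<and>
      (\<forall>r u \<rho>. 0 \<le> r \<and> 0 < u \<and> u \<le> \<xi>1 \<and> 0 \<le> \<rho> \<and> \<rho> \<le> \<xi>2 \<longrightarrow>
         0 \<le> \<phi> (r, u) \<and> \<phi> (r, u) \<le> F (r, u, \<rho>))) \<and>
     \<comment> \<open>(2)\<close>
     (\<forall>r\<ge>0. mono_on {0..\<xi>1} (\<lambda>u. \<phi> (r, u)) \<and>
        (\<forall>\<rho>\<in>{0..\<xi>2}. mono_on {0..\<xi>1} (\<lambda>u. F (r, u, \<rho>))) \<and>
        (\<forall>u\<in>{0..\<xi>1}. mono_on {0..\<xi>2} (\<lambda>\<rho>. F (r, u, \<rho>)))) \<and>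
     \<comment> \<open>(3)\<close>
     \<xi>1 powr (p - 1 - \<beta>) * ((p - 1) / (real n - p)) powr (p - 1) *
       (LINT t:{0..l}|lebesgue. t ^ (n - 1) * \<phi> (t, barrier n l p t / \<xi>1)) \<ge> 1 \<and>
     \<comment> \<open>(4)\<close>
     (\<integral>\<^sup>+s\<in>{0<..}. ennreal
        (radial_flux n (\<lambda>t. F (t, \<xi>1, \<xi>2) * barrier n l p t powr (- \<beta>)) s powr (1 / (p - 1)))
        \<partial>lebesgue) \<le> ennreal (\<xi>1 powr (1 - \<beta> / (p - 1))) \<and>
     \<comment> \<open>(5)\<close>
     (\<forall>s>0. radial_flux n (\<lambda>t. F (t, \<xi>1, \<xi>2) * barrier n l p t powr (- \<beta>)) s
        \<le> \<xi>2 powr (p - 1) * \<xi>1 powr (- \<beta>)) \<and>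
     \<comment> \<open>(6)\<close>
     (\<exists>C>0. \<forall>r\<ge>0. F (r, \<xi>1, \<xi>2) * barrier n l p r powr (- \<beta>) < C) \<and>
     \<comment> \<open>(7)\<close>
     (\<integral>\<^sup>+t\<in>{0<..}. ennreal
        (t ^ (n - 1) * (F (t, \<xi>1, \<xi>2) * barrier n l p t powr (- \<beta>))) \<partial>lebesgue) < \<infinity>"

text \<open>Derivative of a function on \<open>[0, \<infinity>)\<close> (one-sided at \<open>0\<close>).\<close>

definition hderiv :: "(real \<Rightarrow> real) \<Rightarrow> real \<Rightarrow> real" where
  "hderiv f r = vector_derivative f (at r within {0..})"

definition C1_half_line :: "(real \<Rightarrow> real) \<Rightarrow> bool" where
  "C1_half_line f \<longleftrightarrow>
     (\<forall>r\<ge>0. f differentiable (at r within {0..})) \<and> continuous_on {0..} (hderiv f)"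

definition reaction ::
    "(real \<times> real \<times> real \<Rightarrow> real) \<Rightarrow> real \<Rightarrow> (real \<Rightarrow> real) \<Rightarrow> real \<Rightarrow> real" where
  "reaction F \<beta> v r = F (r, v r, \<bar>hderiv v r\<bar>) * v r powr (- \<beta>)"

definition radial_solution ::
    "nat \<Rightarrow> real \<Rightarrow> real \<Rightarrow> real \<Rightarrow> real \<Rightarrow>
     (real \<times> real \<times> real \<Rightarrow> real) \<Rightarrow> real \<Rightarrow> (real \<Rightarrow> real) \<Rightarrow> bool" where
  "radial_solution n l \<xi>1 \<xi>2 p F \<beta> v \<longleftrightarrow>
     C1_half_line v \<and>
     (\<forall>r\<ge>0. barrier n l p r / \<xi>1 \<le> v r \<and> v r \<le> \<xi>1 \<and> \<bar>hderiv v r\<bar> \<le> \<xi>2) \<and>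
     (\<integral>\<^sup>+s\<in>{0<..}. ennreal (radial_flux n v s powr (1 / (p - 1))) \<partial>lebesgue) < \<infinity> \<and>
     (\<forall>r\<ge>0.
        set_integrable lebesgue {r<..} (\<lambda>s. radial_flux n (reaction F \<beta> v) s powr (1 / (p - 1))) \<and>
        v r = (LINT s:{r<..}|lebesgue. radial_flux n (reaction F \<beta> v) s powr (1 / (p - 1))))"

end

theory Submission
  imports Defs
begin

text \<open>
  The data enter only through two families of radial functions: \<open>v\<^sub>p'\<close>, which is minus
  the power \<open>1/(p-1)\<close> of \<open>G\<^sub>p\<close>, and \<open>K\<^sub>p\<close>, which equals \<open>G\<^sub>p' + (n-1)/r G\<^sub>p\<close>.  Both are bounded on
  compact subsets of \<open>(0, \<infinity>)\<close> and converge weakly-star there, to \<open>v'\<close> and \<open>K\<close>.  The radial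
  functions on \<open>\<real>\<^sup>n\<close> built from them then converge weakly-star as well: the image of an
  integrable density under the norm is absolutely continuous, so by Radon-Nikodym every test
  function on \<open>\<real>\<^sup>n\<close> induces one on the half line.  In particular \<open>Du\<close> is \<open>v'(|x|) x/|x|\<close>.

  Since \<open>F\<^sub>p \<rightarrow> F\<^sub>1\<close> uniformly and the powers of \<open>v\<^sub>p\<close> converge to \<open>w\<close> to the power \<open>-c\<close>, the
  difference of \<open>K\<^sub>p\<close> and the same power of \<open>w\<close> times \<open>F\<^sub>1(r, u, |v\<^sub>p'|)\<close> tends to zero almost everywhere.
  If \<open>F\<^sub>1\<close> is affine in the gradient, the second term is weakly continuous in \<open>v\<^sub>p' \<le> 0\<close>, which gives (i).
  On the set \<open>E\<close> the assumption on \<open>a\<close> turns the weak convergence of \<open>v\<^sub>p'\<close> into pointwise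
  convergence to \<open>- exp a\<close>, which gives (ii).
\<close>

section \<open>Radial functions and null sets\<close>

text \<open>The obstacle is that v_p' may oscillate: its weak limit does not determine the limit of
  a nonlinear function of it. Cases (i) and (ii) are two situations where this does no harm. In (i)
  the sign of v_p' makes its absolute value linear. In (ii) the power 1/(p-1) magnifies deviations
  of G_p from 1 that are of order p-1, and (1 + a (p-1))^(1/(p-1)) tends to exp a. The bound on K_p
  is uniform although the barrier degenerates as p tends to 1, because \<beta> < p-1 cancels the
  factor 1/(p-1) in the exponent of the barrier. The origin is cut away since (n-1)/r and x/|x| are
  singular there. The limit \<open>w\<close>, and with it the pointwise limits, are given on the
  n-dimensional space, so the weak limits on the half line are carried there and not the other way
  round. Both weak limits come from integration by parts, and weak derivatives are tested with
  smooth functions only; hence the explicit cut-offs on the line.\<close>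

text \<open>By Fubini in \<open>(s, x)\<close>, the set of \<open>x\<close> with \<open>s |x| \<in> N\<close> is null for almost every \<open>s\<close>;
  for \<open>s > 0\<close> it is a dilate of the set in question.\<close>

lemma null_sets_norm_vimage:
  fixes N :: "real set"
  assumes "N \<in> null_sets lebesgue"
  shows "{x :: 'a::euclidean_space. norm x \<in> N} \<in> null_sets lebesgue"
proof -
  \<comment> \<open>A Borel null hull replaces \<open>N\<close>, because the exchange of the two
    quantifiers asks for measurability of a set of pairs in the product of the Borel spaces.\<close>
  obtain N' where N': "N' \<in> null_sets lborel" "N \<subseteq> N'"
    using iffD1[OF null_sets_completion_iff2 assms] by metis
  have [measurable]: "N' \<in> sets borel"
    using N'(1) by (auto simp: null_sets_def)
  have neg: "negligible N'"
    using N'(1) by (simp add: negligible_iff_null_sets null_sets_completionI)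
  have scaled: "AE s in lborel. s * c \<notin> N'" if "c \<noteq> 0" for c :: real
  proof -
    have "negligible ((\<lambda>t. t * (1 / c)) ` N')"
      by (intro negligible_differentiable_image_negligible neg derivative_intros) simp
    moreover have "{s. s * c \<in> N'} \<subseteq> (\<lambda>t. t * (1 / c)) ` N'"
    proof
      fix s assume "s \<in> {s. s * c \<in> N'}"
      then show "s \<in> (\<lambda>t. t * (1 / c)) ` N'"
        using that by (intro image_eqI[where x = "s * c"]) auto
    qed
    ultimately have "{s. s * c \<in> N'} \<in> null_sets lebesgue"
      unfolding negligible_iff_null_sets[symmetric] by (rule negligible_subset)
    then have "AE s in lebesgue. s * c \<notin> N'"
      by (rule AE_I') auto
    then show ?thesis by (simp add: AE_completion_iff)
  qed
  have "AE x in lborel :: 'a measure. AE s in lborel. s * norm x \<notin> N'"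
    using AE_lborel_singleton[of "0::'a"] by eventually_elim (rule scaled, simp)
  moreover have "{y \<in> space (lborel \<Otimes>\<^sub>M lborel). snd y * norm (fst y) \<notin> N'}
      \<in> sets ((lborel :: 'a measure) \<Otimes>\<^sub>M (lborel :: real measure))"
    using measurable_sets[of "\<lambda>y. snd y * norm (fst y)" "(lborel :: 'a measure) \<Otimes>\<^sub>M lborel" borel "- N'"]
    by (simp add: vimage_def Int_def conj_commute)
  ultimately have "AE s in lborel. AE x in lborel :: 'a measure. s * norm x \<notin> N'"
    using lborel_pair.AE_commute[where P = "\<lambda>x s. s * norm x \<notin> N'"] by blast
  \<comment> \<open>All that matters is that (1,2) is a set of positive measure consisting of
    positive scales: some s > 1 must then be good.\<close>
  moreover have "\<not> (AE s in lborel. \<not> (s \<in> {1<..<2::real}))"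
    by (subst AE_iff_measurable[of "{1<..<2}"]) auto
  ultimately obtain s :: real where s: "1 < s" "AE x in lborel :: 'a measure. s * norm x \<notin> N'"
  proof -
    assume *: "\<And>s. 1 < s \<Longrightarrow> AE x in lborel :: 'a measure. s * norm x \<notin> N' \<Longrightarrow> thesis"
    show thesis
    proof (rule ccontr)
      assume "\<not> thesis"
      with * have "\<not> (AE x in lborel :: 'a measure. s * norm x \<notin> N')" if "1 < s" for s
        using that by blast
      with \<open>AE s in lborel. AE x in lborel :: 'a measure. s * norm x \<notin> N'\<close>
      have "AE s in lborel. \<not> (s \<in> {1<..<2::real})"
        by (auto elim!: eventually_mono)
      with \<open>\<not> (AE s in lborel. \<not> (s \<in> {1<..<2::real}))\<close> show False by blast
    qed
  qed
  have "{x :: 'a. s * norm x \<in> N'} \<in> null_sets lborel"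
    using s(2) measurable_sets_borel[of "\<lambda>x :: 'a. s * norm x" borel N']
    by (subst AE_iff_null_sets) (auto simp: vimage_def)
  then have "negligible ((\<lambda>x. s *\<^sub>R x) ` {x :: 'a. s * norm x \<in> N'})"
    by (intro negligible_differentiable_image_negligible derivative_intros)
      (simp_all add: negligible_iff_null_sets null_sets_completionI)
  moreover have "{x :: 'a. norm x \<in> N} \<subseteq> (\<lambda>x. s *\<^sub>R x) ` {x. s * norm x \<in> N'}"
  proof
    fix x :: 'a assume "x \<in> {x. norm x \<in> N}"
    with N'(2) s(1) show "x \<in> (\<lambda>x. s *\<^sub>R x) ` {x. s * norm x \<in> N'}"
      by (intro image_eqI[where x = "x /\<^sub>R s"]) (auto simp: mult.assoc[symmetric])
  qed
  ultimately show ?thesis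
    unfolding negligible_iff_null_sets[symmetric] by (rule negligible_subset)
qed

lemma AE_norm:
  assumes "AE r in lebesgue. P r"
  shows "AE x :: 'a::euclidean_space in lebesgue. P (norm x)"
proof -
  obtain N where N: "N \<in> null_sets lebesgue" "{r. \<not> P r} \<subseteq> N"
    using assms unfolding eventually_ae_filter by auto
  show ?thesis
    by (rule AE_I'[OF null_sets_norm_vimage[OF N(1)]]) (use N(2) in auto)
qed

text \<open>A Lebesgue set is a Borel set together with part of a null set; the first pulls back by
  continuity, the second by \<open>null_sets_norm_vimage\<close>. Borel measurability of the norm
  alone would not allow composition with functions that are merely Lebesgue measurable.\<close>

lemma measurable_norm_lebesgue:
  "(norm :: 'a::euclidean_space \<Rightarrow> real) \<in> lebesgue \<rightarrow>\<^sub>M lebesgue"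
proof (rule measurableI)
  fix A :: "real set" assume "A \<in> sets lebesgue"
  then obtain S N N' where A: "A = S \<union> N" "S \<in> sets lborel" "N' \<in> null_sets lborel" "N \<subseteq> N'"
    by (auto elim: sets_completionE)
  have "N \<in> null_sets lebesgue"
    using A by (blast intro: null_sets_completion_subset null_sets_completionI)
  then have "{x :: 'a. norm x \<in> N} \<in> sets lebesgue"
    by (intro null_setsD2 null_sets_norm_vimage)
  moreover have "{x :: 'a. norm x \<in> S} \<in> sets lebesgue"
    using A(2) by (intro sets_completionI_sets) (auto intro!: measurable_sets_borel)
  ultimately show "norm -` A \<inter> space lebesgue \<in> sets (lebesgue :: 'a measure)"
    using A(1) by (simp add: vimage_def Collect_disj_eq sets.Un)
qed simp

lemma sigma_finite_lebesgue: "sigma_finite_measure (lebesgue :: 'a::euclidean_space measure)"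
proof
  show "\<exists>A. countable A \<and> A \<subseteq> sets lebesgue \<and> \<Union> A = space (lebesgue :: 'a measure)
      \<and> (\<forall>a\<in>A. emeasure lebesgue a \<noteq> \<infinity>)"
  proof (intro exI conjI)
    show "\<Union> (range (\<lambda>k::nat. cball (0::'a) (real k))) = space lebesgue"
      by (auto simp: real_arch_simple)
    show "\<forall>a\<in>range (\<lambda>k::nat. cball (0::'a) (real k)). emeasure lebesgue a \<noteq> \<infinity>"
      using emeasure_lborel_cball_finite[of "0::'a"] by (auto simp: less_top[symmetric])
  qed auto
qed

text \<open>The measure with density \<open>\<psi>\<close>, pushed forward by the norm, vanishes on
  null sets and so has a density itself; in polar coordinates \<open>\<rho>\<close> would be the
  integral of \<open>\<psi>\<close> over the sphere of radius r. The identity asks for no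
  integrability of \<open>f\<close>, since each transformation of integrals in the proof holds with
  both sides 0 otherwise.\<close>

lemma radial_density:
  fixes \<psi> :: "'a::euclidean_space \<Rightarrow> real"
  assumes "integrable lebesgue \<psi>" and nonneg: "\<And>x. 0 \<le> \<psi> x"
  obtains \<rho> where "integrable lebesgue \<rho>"
    and "\<And>f. f \<in> borel_measurable lebesgue \<Longrightarrow>
           (LINT x|lebesgue. f (norm x) * \<psi> x) = (LINT r|lebesgue. f r * \<rho> r)"
proof -
  let ?L = "lebesgue :: real measure"
  have [measurable]: "\<psi> \<in> borel_measurable lebesgue" using assms by auto
  note [measurable] = measurable_norm_lebesgue
  define M where "M = distr (density lebesgue (\<lambda>x. ennreal (\<psi> x))) ?L norm"
  have "absolutely_continuous ?L M"
    unfolding absolutely_continuous_def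
  proof
    fix N assume N: "N \<in> null_sets ?L"
    then have [measurable]: "N \<in> sets ?L" by auto
    have "AE x in lebesgue. norm (x :: 'a) \<notin> N"
      using AE_not_in[OF N] by (rule AE_norm)
    then have "norm -` N \<in> null_sets (density (lebesgue :: 'a measure) (\<lambda>x. ennreal (\<psi> x)))"
      using measurable_sets[OF measurable_norm_lebesgue \<open>N \<in> sets ?L\<close>]
      by (subst null_sets_density_iff) (auto elim!: eventually_mono)
    then show "N \<in> null_sets M"
      by (auto simp: M_def null_sets_def emeasure_distr)
  qed
  moreover have "sets M = sets ?L" by (simp add: M_def)
  ultimately obtain h where h: "h \<in> borel_measurable ?L" "density ?L h = M"
    using sigma_finite_measure.Radon_Nikodym[of ?L M] sigma_finite_lebesgue by blast
  have "emeasure M UNIV < \<infinity>"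
    using assms by (simp add: M_def emeasure_distr emeasure_density integrable_iff_bounded)
  then have "emeasure (density ?L h) UNIV < \<infinity>" by (simp only: h(2))
  \<comment> \<open>Finite total mass makes the density finite almost everywhere, so that it can be
    taken real-valued.\<close>
  then have h_fin: "(\<integral>\<^sup>+r. h r \<partial>?L) < \<infinity>"
    using h(1) by (simp add: emeasure_density)
  then have "AE r in ?L. h r \<noteq> \<infinity>"
    using h(1) by (intro nn_integral_PInf_AE) auto
  then have h_eq: "AE r in ?L. h r = ennreal (enn2real (h r))"
    by eventually_elim (simp add: ennreal_enn2real_if)
  show thesis
  proof (rule that[of "\<lambda>r. enn2real (h r)"])
    show "integrable ?L (\<lambda>r. enn2real (h r))"
    proof (rule integrableI_nonneg)
      have "(\<integral>\<^sup>+r. ennreal (enn2real (h r)) \<partial>?L) = (\<integral>\<^sup>+r. h r \<partial>?L)"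
        using h_eq by (intro nn_integral_cong_AE) auto
      then show "(\<integral>\<^sup>+r. ennreal (enn2real (h r)) \<partial>?L) < \<infinity>" using h_fin by simp
    qed (use h(1) in auto)
    fix f :: "real \<Rightarrow> real" assume [measurable]: "f \<in> borel_measurable ?L"
    have [measurable]: "h \<in> borel_measurable ?L" by (rule h(1))
    have "(LINT x|lebesgue. f (norm x) * \<psi> x)
        = (LINT x|density lebesgue (\<lambda>x. ennreal (\<psi> x)). f (norm x))"
      by (subst integral_density) (auto simp: nonneg mult.commute)
    also have "\<dots> = (LINT r|M. f r)"
      unfolding M_def by (subst integral_distr) auto
    also have "\<dots> = (LINT r|density ?L (\<lambda>r. ennreal (enn2real (h r))). f r)"
      by (simp only: h(2)[symmetric], intro arg_cong2[where f = lebesgue_integral] density_cong refl)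
        (use h_eq in auto)
    also have "\<dots> = (LINT r|?L. f r * enn2real (h r))"
      by (subst integral_density) (auto simp: mult.commute)
    finally show "(LINT x|lebesgue. f (norm x) * \<psi> x) = (LINT r|?L. f r * enn2real (h r))" .
  qed
qed

section \<open>Smooth cut-off functions on the line\<close>

lemma grad_eq:
  assumes "GDERIV f x :> D"
  shows "grad f x = D"
proof -
  have "D' = D" if "GDERIV f x :> D'" for D'
    using assms that has_derivative_unique unfolding gderiv_def
    by (metis vector_eq_ldot)
  then show ?thesis
    unfolding grad_def using assms by (rule some_equality[rotated])
qed

lemma grad_real_eq:
  fixes f :: "real \<Rightarrow> real"
  assumes "(f has_real_derivative D) (at x)"
  shows "grad f x = D"
  using assms
  by (intro grad_eq) (simp add: gderiv_def has_field_derivative_def mult.commute[of _ D])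

lemma Ck_Suc_real:
  fixes f :: "real \<Rightarrow> real"
  assumes "\<And>x. (f has_real_derivative f' x) (at x)"
  shows "Ck (Suc k) f \<longleftrightarrow> Ck k f'"
  using assms real_differentiable_def by (auto simp: grad_real_eq[OF assms])

lemma Ck_Suc_realE:
  fixes f :: "real \<Rightarrow> real"
  assumes "Ck (Suc k) f"
  obtains f' where "\<And>x. (f has_real_derivative f' x) (at x)" "Ck k f'"
proof -
  have "\<exists>D. (f has_real_derivative D) (at x)" for x
    using assms real_differentiable_def by auto
  then obtain f' where "\<And>x. (f has_real_derivative f' x) (at x)" by metis
  with Ck_Suc_real[OF this] assms that show thesis by blast
qed

lemma Ck_add_real:
  fixes f g :: "real \<Rightarrow> real"
  shows "Ck k f \<Longrightarrow> Ck k g \<Longrightarrow> Ck k (\<lambda>x. f x + g x)"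
proof (induction k arbitrary: f g)
  case 0
  then show ?case by (simp add: continuous_on_add continuous_on_mult_left)
next
  case (Suc k)
  obtain f' g' where fg: "\<And>x. (f has_real_derivative f' x) (at x)" "Ck k f'"
    "\<And>x. (g has_real_derivative g' x) (at x)" "Ck k g'"
    using Suc.prems by (elim Ck_Suc_realE) blast
  then have "((\<lambda>x. f x + g x) has_real_derivative f' x + g' x) (at x)" for x
    by (intro derivative_intros)
  from Ck_Suc_real[OF this] Suc.IH[OF fg(2,4)] show ?case by blast
qed

lemma Ck_cmult_real:
  fixes f :: "real \<Rightarrow> real"
  shows "Ck k f \<Longrightarrow> Ck k (\<lambda>x. c * f x)"
proof (induction k arbitrary: f)
  case 0
  then show ?case by (simp add: continuous_on_add continuous_on_mult_left)
next
  case (Suc k)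
  obtain f' where f: "\<And>x. (f has_real_derivative f' x) (at x)" "Ck k f'"
    using Suc.prems by (elim Ck_Suc_realE) blast
  then have "((\<lambda>x. c * f x) has_real_derivative c * f' x) (at x)" for x
    by (intro DERIV_cmult)
  from Ck_Suc_real[OF this] Suc.IH[OF f(2)] show ?case by blast
qed

text \<open>Both the derivatives of \<open>exp (- 1/x)\<close> and those of a product of two rescaled copies of it
  are linear combinations of the functions \<open>flat m\<close> and of their products.\<close>

definition flat :: "nat \<Rightarrow> real \<Rightarrow> real" where
  "flat m x = (if 0 < x then (1 / x) ^ m * exp (- (1 / x)) else 0)"

lemma flat_tendsto_0: "(flat m \<longlongrightarrow> 0) (at 0)"
proof (rule filterlim_split_at)
  show "(flat m \<longlongrightarrow> 0) (at_left 0)"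
    by (rule tendsto_eventually) (auto simp: flat_def eventually_at_filter)
  have "((\<lambda>x::real. (inverse x) ^ m / exp (inverse x)) \<longlongrightarrow> 0) (at_right 0)"
    by (rule filterlim_compose[OF tendsto_power_div_exp_0 filterlim_inverse_at_top_right])
  then show "(flat m \<longlongrightarrow> 0) (at_right 0)"
    by (rule Lim_transform_eventually)
      (auto simp: flat_def eventually_at_filter exp_minus field_simps)
qed

lemma flat_has_derivative:
  "(flat m has_real_derivative flat (m + 2) x - real m * flat (m + 1) x) (at x)"
proof -
  consider "x < 0" | "x = 0" | "0 < x" by linarith
  then show ?thesis
  proof cases
    case 1
    have "((\<lambda>x. 0) has_real_derivative 0) (at x)" by simp
    then have "(flat m has_real_derivative 0) (at x)"
      by (rule has_field_derivative_transform_within_open[of _ _ _ "{..<0}"])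
        (use 1 in \<open>auto simp: flat_def\<close>)
    with 1 show ?thesis by (simp add: flat_def)
  next
    case 2
    \<comment> \<open>Dividing \<open>flat m\<close> by its argument raises the index: the
      difference quotient at 0 is \<open>flat (Suc m)\<close>, whose limit is known.\<close>
    have "((\<lambda>h. (flat m (0 + h) - flat m 0) / h) \<longlongrightarrow> 0) (at 0)"
      by (rule Lim_transform_eventually[OF flat_tendsto_0[of "Suc m"]])
        (auto simp: flat_def eventually_at_filter)
    then have "(flat m has_real_derivative 0) (at 0)" by (simp add: DERIV_def)
    with 2 show ?thesis by (simp add: flat_def)
  next
    case 3
    have inv: "((\<lambda>x. 1 / x) has_real_derivative - ((1 / x) * (1 / x))) (at x)"
      using 3 by (auto intro!: derivative_eq_intros simp: field_simps)
    have "((\<lambda>x. (1 / x) ^ m) has_real_derivative - (real m * (1 / x) ^ (m + 1))) (at x)"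
    proof (cases m)
      case (Suc i)
      from DERIV_power_Suc[OF inv, of i] show ?thesis
        by (simp add: Suc algebra_simps)
    qed simp
    from DERIV_mult[OF this DERIV_chain2[OF DERIV_exp DERIV_minus[OF inv]]]
    have "((\<lambda>x. (1 / x) ^ m * exp (- (1 / x))) has_real_derivative
        flat (m + 2) x - real m * flat (m + 1) x) (at x)"
      using 3 by (simp add: flat_def algebra_simps)
    then show ?thesis
      by (rule has_field_derivative_transform_within_open[of _ _ _ "{0<..}"])
        (use 3 in \<open>auto simp: flat_def\<close>)
  qed
qed

text \<open>A smooth approximation of the indicator of (s,t) from inside: the factor
  \<open>Suc k\<close> steepens both flanks, since exp (-1/(k y)) tends to 1 for every y > 0, while
  the support stays in [s,t].\<close>

definition bump :: "real \<Rightarrow> real \<Rightarrow> nat \<Rightarrow> real \<Rightarrow> real" where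
  "bump s t k x = flat 0 (real (Suc k) * (x - s)) * flat 0 (real (Suc k) * (t - x))"

text \<open>Stated for all pairs of indices at once, since each differentiation raises one of
  them.\<close>

lemma Ck_flat_prod: "Ck k (\<lambda>x. flat m (c * (x - s)) * flat i (c * (t - x)))"
proof (induction k arbitrary: m i)
  case 0
  have flat_cont: "continuous_on UNIV (flat j)" for j
    by (rule DERIV_continuous_on[OF has_field_derivative_at_within[OF flat_has_derivative]])
  have "continuous_on UNIV (\<lambda>x. flat m (c * (x - s)))"
    by (rule continuous_on_compose2[OF flat_cont[of m]]) (simp_all add: continuous_on_mult_left continuous_on_diff)
  moreover have "continuous_on UNIV (\<lambda>x. flat i (c * (t - x)))"
    by (rule continuous_on_compose2[OF flat_cont[of i]]) (simp_all add: continuous_on_mult_left continuous_on_diff)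
  ultimately show ?case unfolding Ck.simps by (rule continuous_on_mult)
next
  case (Suc k)
  let ?p = "\<lambda>m i x. flat m (c * (x - s)) * flat i (c * (t - x))"
  have deriv: "(?p m i has_real_derivative
      (c * ?p (m + 2) i x + (- (c * real m)) * ?p (m + 1) i x)
      + ((- c) * ?p m (i + 2) x + (c * real i) * ?p m (i + 1) x)) (at x)" for x
  proof -
    have "((\<lambda>x. c * (x - s)) has_real_derivative c) (at x)"
      "((\<lambda>x. c * (t - x)) has_real_derivative - c) (at x)"
      by (auto intro!: derivative_eq_intros)
    from DERIV_mult[OF DERIV_chain2[OF flat_has_derivative this(1)]
        DERIV_chain2[OF flat_has_derivative this(2)]]
    show ?thesis by (rule DERIV_cong) (simp add: algebra_simps)
  qed
  have "Ck k (\<lambda>x. (c * ?p (m + 2) i x + (- (c * real m)) * ?p (m + 1) i x)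
      + ((- c) * ?p m (i + 2) x + (c * real i) * ?p m (i + 1) x))"
    by (intro Ck_add_real Ck_cmult_real Suc.IH)
  with Ck_Suc_real[OF deriv] show ?case by (rule iffD2)
qed

lemma bump_eq_0: "x \<le> s \<or> t \<le> x \<Longrightarrow> bump s t k x = 0"
  by (auto simp: bump_def flat_def mult_le_0_iff zero_less_mult_iff)

lemma bump_bounds: "0 \<le> bump s t k x" "bump s t k x \<le> 1"
proof -
  have "0 \<le> flat 0 y \<and> flat 0 y \<le> 1" for y by (simp add: flat_def)
  then show "0 \<le> bump s t k x" "bump s t k x \<le> 1"
    unfolding bump_def by (simp_all add: mult_le_one)
qed

lemma bump_tendsto:
  "(\<lambda>k. bump s t k x) \<longlonglongrightarrow> indicator {s<..<t} x"
proof (cases "s < x \<and> x < t")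
  case True
  have "(\<lambda>k. flat 0 (real (Suc k) * y)) \<longlonglongrightarrow> 1" if "0 < y" for y
  proof -
    have "(\<lambda>k. inverse (real (Suc k))) \<longlonglongrightarrow> 0" by (rule LIMSEQ_inverse_real_of_nat)
    then have "(\<lambda>k. exp (- (inverse (real (Suc k)) * (1 / y)))) \<longlonglongrightarrow> exp (- (0 * (1 / y)))"
      by (intro tendsto_intros)
    moreover have "flat 0 (real (Suc k) * y) = exp (- (inverse (real (Suc k)) * (1 / y)))" for k
      using mult_pos_pos[of "real (Suc k)" y] that
      by (simp add: flat_def divide_simps del: of_nat_Suc)
    ultimately show ?thesis by simp
  qed
  from tendsto_mult[OF this[of "x - s"] this[of "t - x"]] True show ?thesis
    by (simp add: bump_def)
next
  case False
  then show ?thesis by (auto simp: bump_eq_0 indicator_def)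
qed

lemma test_function_bump:
  assumes "{s..t} \<subseteq> \<Omega>"
  shows "test_function \<Omega> (bump s t k)"
proof -
  have "closure {x. bump s t k x \<noteq> 0} \<subseteq> {s..t}"
  proof (rule closure_minimal)
    show "{x. bump s t k x \<noteq> 0} \<subseteq> {s..t}"
    proof
      fix x assume "x \<in> {x. bump s t k x \<noteq> 0}"
      then have "\<not> (x \<le> s \<or> t \<le> x)" using bump_eq_0 by blast
      then show "x \<in> {s..t}" by auto
    qed
  qed simp
  moreover have "Ck i (bump s t k)" for i
    using Ck_flat_prod[of i 0 "real (Suc k)" s 0 t] by (simp add: bump_def[abs_def])
  ultimately show ?thesis
    unfolding test_function_def using assms
    by (meson bounded_closed_interval bounded_subset closed_closure compact_eq_bounded_closed order_trans)
qed

lemma bump_has_derivative: "(bump s t k has_real_derivative grad (bump s t k) x) (at x)"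
  and continuous_on_grad_bump: "continuous_on UNIV (grad (bump s t k))"
proof -
  have "Ck (Suc 0) (bump s t k)"
    using test_function_bump[of s t UNIV k] by (simp add: test_function_def)
  then obtain f' where f': "\<And>x. (bump s t k has_real_derivative f' x) (at x)" "Ck 0 f'"
    by (rule Ck_Suc_realE) blast
  moreover from f'(1) have "grad (bump s t k) = f'"
    by (intro ext grad_real_eq)
  ultimately show "(bump s t k has_real_derivative grad (bump s t k) x) (at x)"
    "continuous_on UNIV (grad (bump s t k))" by simp_all
qed

lemma grad_bump_eq_0:
  assumes "x < s \<or> t < x"
  shows "grad (bump s t k) x = 0"
proof -
  have "((\<lambda>x. 0) has_real_derivative 0) (at x)" by simp
  then have "(bump s t k has_real_derivative 0) (at x)"
    by (rule has_field_derivative_transform_within_open[of _ _ _ "{..<s} \<union> {t<..}"])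
      (use assms in \<open>auto simp: bump_eq_0\<close>)
  then show ?thesis by (rule grad_real_eq)
qed

section \<open>Weak-star convergence of bounded functions\<close>

text \<open>The bound is a parameter, not an existential, so that all members of a sequence can
  share it.\<close>

definition ess_bounded :: "'a measure \<Rightarrow> real \<Rightarrow> ('a \<Rightarrow> real) \<Rightarrow> bool" where
  "ess_bounded M B f \<longleftrightarrow> f \<in> borel_measurable M \<and> (AE x in M. \<bar>f x\<bar> \<le> B)"

lemma ess_bounded_integrable_mult:
  assumes "ess_bounded M B f" "integrable M \<psi>"
  shows "integrable M (\<lambda>x. f x * \<psi> x)"
proof (rule Bochner_Integration.integrable_bound)
  show "integrable M (\<lambda>x. B * \<psi> x)" using assms by simp
  show "(\<lambda>x. f x * \<psi> x) \<in> borel_measurable M"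
    using assms by (auto simp: ess_bounded_def intro: borel_measurable_times)
  have "AE x in M. \<bar>f x\<bar> \<le> B" using assms by (simp add: ess_bounded_def)
  then show "AE x in M. norm (f x * \<psi> x) \<le> norm (B * \<psi> x)"
    by eventually_elim (auto simp: abs_mult intro!: mult_right_mono)
qed

lemma ess_bounded_integrable:
  assumes "ess_bounded M B f" "finite_measure M"
  shows "integrable M f"
  using assms finite_measure.integrable_const_bound[of M f B] by (simp add: ess_bounded_def)

lemma ess_bounded_mult:
  assumes "ess_bounded M B f" "ess_bounded M C g"
  shows "ess_bounded M (B * C) (\<lambda>x. f x * g x)"
  unfolding ess_bounded_def
proof
  show "(\<lambda>x. f x * g x) \<in> borel_measurable M"
    using assms by (auto simp: ess_bounded_def intro: borel_measurable_times)
  have "AE x in M. \<bar>f x\<bar> \<le> B" "AE x in M. \<bar>g x\<bar> \<le> C" using assms by (simp_all add: ess_bounded_def)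
  then show "AE x in M. \<bar>f x * g x\<bar> \<le> B * C"
    by eventually_elim (auto simp: abs_mult intro!: mult_mono order_trans[OF abs_ge_zero])
qed

lemma ess_bounded_diff:
  assumes "ess_bounded M B f" "ess_bounded M C g"
  shows "ess_bounded M (B + C) (\<lambda>x. f x - g x)"
  unfolding ess_bounded_def
proof
  show "(\<lambda>x. f x - g x) \<in> borel_measurable M"
    using assms by (auto simp: ess_bounded_def intro: borel_measurable_diff)
  have "AE x in M. \<bar>f x\<bar> \<le> B" "AE x in M. \<bar>g x\<bar> \<le> C" using assms by (simp_all add: ess_bounded_def)
  then show "AE x in M. \<bar>f x - g x\<bar> \<le> B + C"
    by eventually_elim linarith
qed

lemma abs_integral_ess_bounded_mult_le:
  assumes "ess_bounded M B f" "integrable M \<psi>"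
  shows "\<bar>LINT x|M. f x * \<psi> x\<bar> \<le> B * (LINT x|M. \<bar>\<psi> x\<bar>)"
proof -
  have "\<bar>LINT x|M. f x * \<psi> x\<bar> \<le> (LINT x|M. \<bar>f x * \<psi> x\<bar>)"
    by (rule integral_abs_bound)
  also have "\<dots> \<le> (LINT x|M. B * \<bar>\<psi> x\<bar>)"
  proof (rule integral_mono_AE)
    have "AE x in M. \<bar>f x\<bar> \<le> B" using assms by (simp add: ess_bounded_def)
    then show "AE x in M. \<bar>f x * \<psi> x\<bar> \<le> B * \<bar>\<psi> x\<bar>"
      by eventually_elim (auto simp: abs_mult intro!: mult_right_mono)
  qed (use assms integrable_abs[OF ess_bounded_integrable_mult[OF assms]] in auto)
  finally show ?thesis by simp
qed

text \<open>The three-epsilon argument: the common bound on the \<open>f j\<close> makes the pairing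
  continuous in the L1 norm of the test function, uniformly in \<open>j\<close>. When this is
  applied, \<open>g\<close> may be known to be integrable only, hence the separate assumption on its
  pairings.\<close>

lemma weak_limit_closure:
  assumes f: "\<And>j :: nat. ess_bounded M B (f j)"
    and \<psi>: "\<And>k :: nat. integrable M (\<psi>s k)" "integrable M \<psi>"
    and L1: "(\<lambda>k. LINT x|M. \<bar>\<psi>s k x - \<psi> x\<bar>) \<longlonglongrightarrow> 0"
    and g: "(\<lambda>k. LINT x|M. g x * \<psi>s k x) \<longlonglongrightarrow> (LINT x|M. g x * \<psi> x)"
    and conv: "\<And>k. (\<lambda>j. LINT x|M. f j x * \<psi>s k x) \<longlonglongrightarrow> (LINT x|M. g x * \<psi>s k x)"
  shows "(\<lambda>j. LINT x|M. f j x * \<psi> x) \<longlonglongrightarrow> (LINT x|M. g x * \<psi> x)"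
proof (rule tendstoI)
  fix e :: real assume "0 < e"
  have "(\<lambda>k. B * (LINT x|M. \<bar>\<psi>s k x - \<psi> x\<bar>)) \<longlonglongrightarrow> B * 0"
    by (intro tendsto_intros L1)
  then have "\<forall>\<^sub>F k in sequentially. B * (LINT x|M. \<bar>\<psi>s k x - \<psi> x\<bar>) < e / 3"
    by (rule order_tendstoD(2)) (simp add: \<open>0 < e\<close>)
  moreover have "\<forall>\<^sub>F k in sequentially. dist (LINT x|M. g x * \<psi>s k x) (LINT x|M. g x * \<psi> x) < e / 3"
    using \<open>0 < e\<close> by (intro tendstoD[OF g]) auto
  ultimately have "\<forall>\<^sub>F k in sequentially. B * (LINT x|M. \<bar>\<psi>s k x - \<psi> x\<bar>) < e / 3 \<and>
      dist (LINT x|M. g x * \<psi>s k x) (LINT x|M. g x * \<psi> x) < e / 3"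
    by (rule eventually_conj)
  then obtain k where k: "B * (LINT x|M. \<bar>\<psi>s k x - \<psi> x\<bar>) < e / 3"
    "dist (LINT x|M. g x * \<psi>s k x) (LINT x|M. g x * \<psi> x) < e / 3"
    using eventually_happens'[OF sequentially_bot] by blast
  have "\<forall>\<^sub>F j in sequentially. dist (LINT x|M. f j x * \<psi>s k x) (LINT x|M. g x * \<psi>s k x) < e / 3"
    using \<open>0 < e\<close> by (intro tendstoD[OF conv]) auto
  then show "\<forall>\<^sub>F j in sequentially. dist (LINT x|M. f j x * \<psi> x) (LINT x|M. g x * \<psi> x) < e"
  proof eventually_elim
    case (elim j)
    have int: "integrable M (\<lambda>x. f j x * \<psi>s k x)" "integrable M (\<lambda>x. f j x * \<psi> x)"
      by (rule ess_bounded_integrable_mult[OF f] \<psi>)+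
    have "\<bar>LINT x|M. f j x * (\<psi>s k x - \<psi> x)\<bar> \<le> B * (LINT x|M. \<bar>\<psi>s k x - \<psi> x\<bar>)"
      by (rule abs_integral_ess_bounded_mult_le[OF f]) (rule Bochner_Integration.integrable_diff[OF \<psi>])
    moreover have "(LINT x|M. f j x * (\<psi>s k x - \<psi> x))
        = (LINT x|M. f j x * \<psi>s k x) - (LINT x|M. f j x * \<psi> x)"
      unfolding right_diff_distrib by (rule Bochner_Integration.integral_diff[OF int])
    ultimately show ?case
      using k elim unfolding dist_real_def by linarith
  qed
qed

text \<open>Domination supplies both limits over \<open>k\<close> that
  \<open>weak_limit_closure\<close> asks for. With a constant \<open>h\<close> on a finite measure,
  integrability of \<open>g\<close> is enough; this is how one passes from smooth cut-offs to
  intervals and from finite to countable unions.\<close>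

lemma weak_limit_closure_dominated:
  assumes f: "\<And>j :: nat. ess_bounded M B (f j)"
    and \<psi>: "\<And>k :: nat. \<psi>s k \<in> borel_measurable M" "\<psi> \<in> borel_measurable M"
    and lim: "AE x in M. (\<lambda>k. \<psi>s k x) \<longlonglongrightarrow> \<psi> x"
    and dom: "integrable M h" "\<And>k. AE x in M. \<bar>\<psi>s k x\<bar> \<le> h x"
    and g: "g \<in> borel_measurable M" "integrable M (\<lambda>x. g x * h x)"
    and conv: "\<And>k. (\<lambda>j. LINT x|M. f j x * \<psi>s k x) \<longlonglongrightarrow> (LINT x|M. g x * \<psi>s k x)"
  shows "(\<lambda>j. LINT x|M. f j x * \<psi> x) \<longlonglongrightarrow> (LINT x|M. g x * \<psi> x)"
proof -
  note [measurable] = \<psi> g(1)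
  have all: "AE x in M. \<forall>k. \<bar>\<psi>s k x\<bar> \<le> h x" using dom(2) by (simp add: AE_all_countable)
  from lim this have \<psi>_le: "AE x in M. \<bar>\<psi> x\<bar> \<le> h x"
  proof eventually_elim
    case (elim x)
    then show ?case
      by (intro LIMSEQ_le_const2[OF tendsto_rabs[OF elim(1)]]) blast
  qed
  have int1: "integrable M (\<psi>s k)" for k
    by (rule Bochner_Integration.integrable_bound[OF dom(1)])
      (use dom(2)[of k] in \<open>auto elim: eventually_mono\<close>)
  have int2: "integrable M \<psi>"
    by (rule Bochner_Integration.integrable_bound[OF dom(1)])
      (use \<psi>_le in \<open>auto elim: eventually_mono\<close>)
  show ?thesis
  proof (rule weak_limit_closure[OF f int1 int2])
    have "(\<lambda>k. LINT x|M. \<bar>\<psi>s k x - \<psi> x\<bar>) \<longlonglongrightarrow> (LINT x|M. 0)"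
    proof (rule integral_dominated_convergence[where w = "\<lambda>x. 2 * h x"])
      show "AE x in M. (\<lambda>k. \<bar>\<psi>s k x - \<psi> x\<bar>) \<longlonglongrightarrow> 0"
        using lim by eventually_elim (simp add: LIM_zero tendsto_rabs_zero)
      show "AE x in M. norm \<bar>\<psi>s k x - \<psi> x\<bar> \<le> 2 * h x" for k
        using dom(2)[of k] \<psi>_le by eventually_elim simp
    qed (use dom(1) in auto)
    then show "(\<lambda>k. LINT x|M. \<bar>\<psi>s k x - \<psi> x\<bar>) \<longlonglongrightarrow> 0" by simp
    show "(\<lambda>k. LINT x|M. g x * \<psi>s k x) \<longlonglongrightarrow> (LINT x|M. g x * \<psi> x)"
    proof (rule integral_dominated_convergence[where w = "\<lambda>x. \<bar>g x * h x\<bar>"])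
      show "AE x in M. (\<lambda>k. g x * \<psi>s k x) \<longlonglongrightarrow> g x * \<psi> x"
        using lim by eventually_elim (intro tendsto_intros)
      show "AE x in M. norm (g x * \<psi>s k x) \<le> \<bar>g x * h x\<bar>" for k
        using dom(2)[of k] by eventually_elim (auto simp: abs_mult intro!: mult_left_mono)
      show "integrable M (\<lambda>x. \<bar>g x * h x\<bar>)" using g(2) by (rule integrable_abs)
    qed (use \<psi> g(1) in \<open>simp_all add: borel_measurable_times\<close>)
  qed (rule conv)
qed

text \<open>Test with the set where \<open>g\<close> exceeds \<open>C\<close>: the integral of g - C
  over it is at most 0 in the limit, while the integrand is positive there, so the set is
  null.\<close>

lemma weak_limit_le:
  assumes "finite_measure M"
    and f: "\<And>j :: nat. ess_bounded M B (f j)" and le: "\<And>j. AE x in M. f j x \<le> C"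
    and g: "integrable M g"
    and conv: "\<And>A. A \<in> sets M \<Longrightarrow>
      (\<lambda>j. LINT x|M. f j x * indicator A x) \<longlonglongrightarrow> (LINT x|M. g x * indicator A x)"
  shows "AE x in M. g x \<le> C"
proof -
  interpret finite_measure M by fact
  define A where "A = {x \<in> space M. C < g x}"
  have [measurable]: "g \<in> borel_measurable M" using g by auto
  have A [measurable]: "A \<in> sets M" unfolding A_def by measurable
  have ind: "integrable M (indicator A :: _ \<Rightarrow> real)" by (simp add: emeasure_eq_measure)
  have gA: "integrable M (\<lambda>x. g x * indicator A x)"
    using g A by (rule integrable_real_mult_indicator[rotated])
  have "(LINT x|M. g x * indicator A x) \<le> (LINT x|M. C * indicator A x)"
  proof (rule LIMSEQ_le_const2[OF conv[OF A]], intro exI allI impI)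
    fix j
    show "(LINT x|M. f j x * indicator A x) \<le> (LINT x|M. C * indicator A x)"
      using le[of j] ess_bounded_integrable_mult[OF f ind] ind
      by (intro integral_mono_AE) (auto elim!: eventually_mono intro!: mult_right_mono)
  qed
  then have "(LINT x|M. (g x - C) * indicator A x) \<le> 0"
    using gA ind by (simp add: left_diff_distrib)
  moreover have nonneg: "AE x in M. 0 \<le> (g x - C) * indicator A x"
    by (auto simp: A_def indicator_def)
  ultimately have "(LINT x|M. (g x - C) * indicator A x) = 0"
    using integral_nonneg_AE[OF nonneg] by linarith
  moreover have "integrable M (\<lambda>x. (g x - C) * indicator A x)"
    using gA ind by (simp add: left_diff_distrib)
  ultimately have "AE x in M. (g x - C) * indicator A x = 0"
    using nonneg by (simp add: integral_nonneg_eq_0_iff_AE)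
  then show ?thesis
    using AE_space by eventually_elim (auto simp: A_def indicator_def split: if_splits)
qed

text \<open>Uniform boundedness is part of the notion, for the limit as well; products with bounded
  coefficients and dominated limits then need no appeal to the uniform boundedness
  principle.\<close>

definition weak_star :: "'a measure \<Rightarrow> (nat \<Rightarrow> 'a \<Rightarrow> real) \<Rightarrow> ('a \<Rightarrow> real) \<Rightarrow> bool" where
  "weak_star M f g \<longleftrightarrow> (\<exists>B. ess_bounded M B g \<and> (\<forall>j. ess_bounded M B (f j))) \<and>
     (\<forall>\<psi>. integrable M \<psi> \<longrightarrow> (\<lambda>j. LINT x|M. f j x * \<psi> x) \<longlonglongrightarrow> (LINT x|M. g x * \<psi> x))"

text \<open>The bound comes first: \<open>weak_limit_le\<close>, applied to the sequence and to its
  negative, carries \<open>B\<close> over to \<open>g\<close>. After that the admissible test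
  functions contain the indicators and are closed under sums and dominated limits, hence they are
  all of L1.\<close>

lemma weak_starI_indicator:
  assumes fin: "finite_measure M"
    and f: "\<And>j :: nat. ess_bounded M B (f j)" and g: "integrable M g"
    and conv: "\<And>A. A \<in> sets M \<Longrightarrow>
      (\<lambda>j. LINT x|M. f j x * indicator A x) \<longlonglongrightarrow> (LINT x|M. g x * indicator A x)"
  shows "weak_star M f g"
proof -
  have "AE x in M. g x \<le> B"
  proof (rule weak_limit_le[OF fin f _ g conv])
    show "AE x in M. f j x \<le> B" for j
      using f[of j] by (auto simp: ess_bounded_def elim: eventually_mono)
  qed
  moreover have "AE x in M. - g x \<le> B"
  proof (rule weak_limit_le[OF fin, of B "\<lambda>j x. - f j x"])
    show "ess_bounded M B (\<lambda>x. - f j x)" for j using f[of j] by (simp add: ess_bounded_def)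
    show "AE x in M. - f j x \<le> B" for j
      using f[of j] by (auto simp: ess_bounded_def elim: eventually_mono)
    show "(\<lambda>j. LINT x|M. - f j x * indicator A x) \<longlonglongrightarrow> (LINT x|M. - g x * indicator A x)"
      if "A \<in> sets M" for A using tendsto_minus[OF conv[OF that]] by simp
  qed (use g in simp)
  ultimately have gB: "ess_bounded M B g"
    unfolding ess_bounded_def using g by (auto elim: eventually_elim2)
  have lim: "(\<lambda>j. LINT x|M. f j x * \<psi> x) \<longlonglongrightarrow> (LINT x|M. g x * \<psi> x)" if "integrable M \<psi>" for \<psi>
    using that
  proof (induction \<psi>)
    case (base A c)
    from tendsto_mult_right[OF conv[OF base(1)], of c] show ?case
      by (simp add: mult.assoc[symmetric])
  next
    case (add \<psi>1 \<psi>2)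
    from tendsto_add[OF add.IH] show ?case
      using ess_bounded_integrable_mult[OF f add.hyps(1)] ess_bounded_integrable_mult[OF f add.hyps(2)]
        ess_bounded_integrable_mult[OF gB add.hyps(1)] ess_bounded_integrable_mult[OF gB add.hyps(2)]
      by (simp add: distrib_left)
  next
    case (lim \<psi> \<psi>s)
    show ?case
    \<comment> \<open>The induction principle for integrable functions supplies approximants bounded
      by twice the absolute value of their limit; hence the factor 2.\<close>
    proof (rule weak_limit_closure_dominated[OF f, where h = "\<lambda>x. 2 * \<bar>\<psi> x\<bar>"])
      show "integrable M (\<lambda>x. g x * (2 * \<bar>\<psi> x\<bar>))"
        by (intro ess_bounded_integrable_mult[OF gB]) (use lim in simp)
      show "AE x in M. (\<lambda>k. \<psi>s k x) \<longlonglongrightarrow> \<psi> x" by (rule AE_I2) (rule lim)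
      show "g \<in> borel_measurable M" using g by simp
      show "\<psi>s k \<in> borel_measurable M" "\<psi> \<in> borel_measurable M" for k
        using lim.hyps by auto
      show "integrable M (\<lambda>x. 2 * \<bar>\<psi> x\<bar>)" using lim.hyps by simp
      show "AE x in M. \<bar>\<psi>s k x\<bar> \<le> 2 * \<bar>\<psi> x\<bar>" for k
        using lim.hyps by (intro AE_I2) simp
    qed (rule lim.IH)
  qed
  have "ess_bounded M B g \<and> (\<forall>j. ess_bounded M B (f j))" using f gB by simp
  then have "\<exists>B. ess_bounded M B g \<and> (\<forall>j. ess_bounded M B (f j))" by (rule exI)
  then show ?thesis
    unfolding weak_star_def using lim by simp
qed

text \<open>The coefficient is moved to the test function. It is the same for all \<open>j\<close>;
  this is why the varying coefficients of the equation have to be replaced by their limits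
  beforehand.\<close>

lemma weak_star_mult:
  assumes "weak_star M f g" "ess_bounded M C c"
  shows "weak_star M (\<lambda>j x. c x * f j x) (\<lambda>x. c x * g x)"
  unfolding weak_star_def
proof (intro conjI allI impI)
  obtain B where B: "ess_bounded M B g" "\<And>j. ess_bounded M B (f j)"
    using assms by (auto simp: weak_star_def)
  with assms(2) show "\<exists>B. ess_bounded M B (\<lambda>x. c x * g x) \<and> (\<forall>j. ess_bounded M B (\<lambda>x. c x * f j x))"
    by (intro exI[of _ "C * B"]) (auto intro: ess_bounded_mult)
  fix \<psi> :: "_ \<Rightarrow> real" assume "integrable M \<psi>"
  then have "integrable M (\<lambda>x. c x * \<psi> x)" using assms(2) by (rule ess_bounded_integrable_mult[rotated])
  with assms(1) have "(\<lambda>j. LINT x|M. f j x * (c x * \<psi> x)) \<longlonglongrightarrow> (LINT x|M. g x * (c x * \<psi> x))"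
    by (simp add: weak_star_def)
  then show "(\<lambda>j. LINT x|M. c x * f j x * \<psi> x) \<longlonglongrightarrow> (LINT x|M. c x * g x * \<psi> x)"
    by (simp add: ac_simps)
qed

lemma weak_star_diff:
  assumes "weak_star M f g" "weak_star M f' g'"
  shows "weak_star M (\<lambda>j x. f j x - f' j x) (\<lambda>x. g x - g' x)"
  unfolding weak_star_def
proof (intro conjI allI impI)
  obtain B B' where B: "ess_bounded M B g" "\<And>j. ess_bounded M B (f j)"
    "ess_bounded M B' g'" "\<And>j. ess_bounded M B' (f' j)"
    using assms by (auto simp: weak_star_def)
  then show "\<exists>B. ess_bounded M B (\<lambda>x. g x - g' x) \<and> (\<forall>j. ess_bounded M B (\<lambda>x. f j x - f' j x))"
    by (intro exI[of _ "B + B'"]) (auto intro: ess_bounded_diff)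
  fix \<psi> :: "_ \<Rightarrow> real" assume \<psi>: "integrable M \<psi>"
  with assms have "(\<lambda>j. (LINT x|M. f j x * \<psi> x) - (LINT x|M. f' j x * \<psi> x))
      \<longlonglongrightarrow> (LINT x|M. g x * \<psi> x) - (LINT x|M. g' x * \<psi> x)"
    by (intro tendsto_diff) (auto simp: weak_star_def)
  then show "(\<lambda>j. LINT x|M. (f j x - f' j x) * \<psi> x) \<longlonglongrightarrow> (LINT x|M. (g x - g' x) * \<psi> x)"
    using B[THEN ess_bounded_integrable_mult[OF _ \<psi>]] by (simp add: left_diff_distrib)
qed

text \<open>Dominated convergence identifies the integrals of the pointwise limit over every
  measurable set with those of the weak limit, and an integrable function is determined by
  these.\<close>

lemma weak_star_AE_eq:
  assumes fin: "finite_measure M" and w: "weak_star M f g"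
    and h: "h \<in> borel_measurable M" and lim: "AE x in M. (\<lambda>j. f j x) \<longlonglongrightarrow> h x"
  shows "AE x in M. g x = h x"
proof -
  obtain B where B: "ess_bounded M B g" "\<And>j. ess_bounded M B (f j)"
    using w by (auto simp: weak_star_def)
  have [measurable]: "f j \<in> borel_measurable M" "g \<in> borel_measurable M" for j
    using B by (auto simp: ess_bounded_def)
  have all: "AE x in M. \<forall>j. \<bar>f j x\<bar> \<le> B" using B by (simp add: AE_all_countable ess_bounded_def)
  with lim have "AE x in M. \<bar>h x\<bar> \<le> B"
  proof eventually_elim
    case (elim x)
    then show ?case by (intro LIMSEQ_le_const2[OF tendsto_rabs[OF elim(1)]]) blast
  qed
  then have hB: "ess_bounded M B h" using h by (simp add: ess_bounded_def)
  interpret finite_measure M by fact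
  show ?thesis
  proof (rule density_unique_real)
    show "integrable M g" "integrable M h" using B(1) hB fin by (auto intro: ess_bounded_integrable)
    fix A assume [measurable]: "A \<in> sets M"
    have ind: "integrable M (indicator A :: _ \<Rightarrow> real)" by (simp add: emeasure_eq_measure)
    have "(\<lambda>j. LINT x|M. f j x * indicator A x) \<longlonglongrightarrow> (LINT x|M. h x * indicator A x)"
    proof (rule integral_dominated_convergence[where w = "\<lambda>x. B * indicator A x"])
      show "AE x in M. (\<lambda>j. f j x * indicator A x) \<longlonglongrightarrow> h x * indicator A x"
        using lim by eventually_elim (intro tendsto_intros)
      show "AE x in M. norm (f j x * indicator A x) \<le> B * indicator A x" for j
        using all by eventually_elim (auto simp: indicator_def)
    qed (use h ind in auto)
    moreover have "(\<lambda>j. LINT x|M. f j x * indicator A x) \<longlonglongrightarrow> (LINT x|M. g x * indicator A x)"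
      using w ind by (simp add: weak_star_def)
    ultimately have "(LINT x|M. h x * indicator A x) = (LINT x|M. g x * indicator A x)"
      by (rule LIMSEQ_unique)
    then show "(LINT x:A|M. g x) = (LINT x:A|M. h x)"
      by (simp add: set_lebesgue_integral_def mult.commute)
  qed
qed

section \<open>Weak-star convergence of derivatives\<close>

lemma finite_measure_lebesgue_Icc: "finite_measure (lebesgue_on {a..b::real})"
  by (intro finite_measure_lebesgue_on lmeasurable_interval)

text \<open>Induction over a generated sigma-algebra reaches Borel sets only; this covers the
  remaining Lebesgue sets.\<close>

lemma sets_lebesgue_on_borel_eq_AE:
  assumes "A \<in> sets (lebesgue_on S)" and S: "S \<in> sets lebesgue"
  obtains A' where "A' \<in> sets borel" "AE x in lebesgue_on S. x \<in> A \<longleftrightarrow> x \<in> A'"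
proof -
  have "A \<in> sets lebesgue" using assms by (simp add: sets_restrict_space_iff)
  then obtain C N N' where A: "A = C \<union> N" "C \<in> sets lborel" "N' \<in> null_sets lborel" "N \<subseteq> N'"
    by (rule sets_completionE)
  have "AE x in lebesgue. x \<notin> N'"
    by (rule AE_not_in) (rule null_sets_completionI[OF A(3)])
  then have "AE x in lebesgue_on S. x \<in> A \<longleftrightarrow> x \<in> C"
    using S A(1,4) by (subst AE_restrict_space_iff) (auto elim!: eventually_mono)
  with A(2) that show thesis by simp
qed

text \<open>Open intervals are stable under intersection and generate the Borel sets, so Dynkin's
  induction applies. Complements and finite disjoint unions follow by linearity; countable ones use
  the common bound \<open>B\<close>, since convergence on each piece alone does not give convergence
  on the union.\<close>

lemma weak_starI_Ioo:
  fixes a b :: real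
  assumes f: "\<And>j :: nat. ess_bounded (lebesgue_on {a..b}) B (f j)"
    and g: "integrable (lebesgue_on {a..b}) g"
    and conv: "\<And>s t. a \<le> s \<Longrightarrow> s \<le> t \<Longrightarrow> t \<le> b \<Longrightarrow>
      (\<lambda>j. LINT x|lebesgue_on {a..b}. f j x * indicator {s<..<t} x)
        \<longlonglongrightarrow> (LINT x|lebesgue_on {a..b}. g x * indicator {s<..<t} x)"
  shows "weak_star (lebesgue_on {a..b}) f g"
proof -
  let ?L = "lebesgue_on {a..b}"
  define P where "P A \<longleftrightarrow> (\<lambda>j. LINT x|?L. f j x * indicator A x) \<longlonglongrightarrow> (LINT x|?L. g x * indicator A x)"
    for A
  have fin: "finite_measure ?L" by (rule finite_measure_lebesgue_Icc)
  have meas [measurable]: "(indicator A :: real \<Rightarrow> real) \<in> borel_measurable ?L"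
    if "A \<in> sets borel" for A
    using that by (intro measurable_restrict_space1 measurable_completion) simp
  have ind: "integrable ?L (indicator A :: real \<Rightarrow> real)" if "A \<in> sets borel" for A
    by (rule finite_measure.integrable_const_bound[OF fin, of _ 1])
      (use meas[OF that] in \<open>simp_all add: indicator_def\<close>)
  have f_ind: "integrable ?L (\<lambda>x. f j x * indicator A x)" if "A \<in> sets borel" for A j
    using ess_bounded_integrable_mult[OF f ind[OF that]] .
  have g_meas: "g \<in> borel_measurable ?L" using g by simp
  have g_ind: "integrable ?L (\<lambda>x. g x * indicator A x)" if "A \<in> sets borel" for A
    by (rule Bochner_Integration.integrable_bound[OF g])
      (use borel_measurable_times[OF g_meas meas[OF that]] in \<open>simp_all add: indicator_def\<close>)
  have P_cong: "P A"
    if "P A'" and AE: "AE x in ?L. x \<in> A \<longleftrightarrow> x \<in> A'"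
      and ms: "(indicator A :: real \<Rightarrow> real) \<in> borel_measurable ?L"
        "(indicator A' :: real \<Rightarrow> real) \<in> borel_measurable ?L" for A A'
  proof -
    have "(LINT x|?L. h x * indicator A x) = (LINT x|?L. h x * indicator A' x)"
      if h: "h \<in> borel_measurable ?L" for h :: "real \<Rightarrow> real"
    proof (rule integral_cong_AE)
      show "(\<lambda>x. h x * indicator A x) \<in> borel_measurable ?L"
        "(\<lambda>x. h x * indicator A' x) \<in> borel_measurable ?L"
        using h ms by (simp_all add: borel_measurable_times)
      show "AE x in ?L. h x * indicator A x = h x * indicator A' x"
        using AE by eventually_elim (simp add: indicator_def)
    qed
    with \<open>P A'\<close> f g_meas show ?thesis by (simp add: P_def ess_bounded_def)
  qed
  have P_Ioo: "P {s<..<t}" for s t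
  proof -
    \<comment> \<open>Clamping to [a,b] changes the part of the interval inside [a,b] by at most the
      two end points, so the hypothesis on subintervals suffices.\<close>
    define s' where "s' = max s a"
    define t' where "t' = min t b"
    have "P {s'<..<t'}"
    proof (cases "s' \<le> t'")
      case True
      then show ?thesis unfolding P_def by (intro conv) (auto simp: s'_def t'_def)
    qed (simp add: P_def)
    moreover have "AE x in ?L. x \<in> {s<..<t} \<longleftrightarrow> x \<in> {s'<..<t'}"
    proof -
      have "AE x in lebesgue. x \<noteq> a" "AE x in lebesgue. x \<noteq> b"
        by (simp_all add: AE_completion AE_lborel_singleton)
      then have "AE x in lebesgue. x \<in> {a..b} \<longrightarrow> (x \<in> {s<..<t} \<longleftrightarrow> x \<in> {s'<..<t'})"
        by eventually_elim (auto simp: s'_def t'_def)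
      then show ?thesis by (subst AE_restrict_space_iff) simp_all
    qed
    ultimately show ?thesis by (rule P_cong) (simp_all add: meas)
  qed
  have UNIV_borel: "UNIV \<in> sets (borel :: real measure)" by simp
  have P_UNIV: "P UNIV"
  proof (rule P_cong[OF P_Ioo[of "a - 1" "b + 1"]])
    show "AE x in ?L. x \<in> UNIV \<longleftrightarrow> x \<in> {a - 1<..<b + 1}"
      by (rule AE_I2) auto
  qed (simp_all add: meas)
  have P_borel: "P A" if "A \<in> sets borel" for A
  proof -
    have stable: "Int_stable (range (\<lambda>(s, t). {s<..<t :: real}))"
      by (auto simp: Int_stable_def greaterThanLessThan_eq[symmetric] Int_greaterThanLessThan)
    have borel_eq: "sets borel = sigma_sets UNIV (range (\<lambda>(s, t). {s<..<t :: real}))"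
      by (simp add: borel_eq_box box_real)
    have sub: "range (\<lambda>(s, t). {s<..<t :: real}) \<subseteq> Pow UNIV" by simp
    have "A \<in> sigma_sets UNIV (range (\<lambda>(s, t). {s<..<t :: real}))"
      using that by (simp add: borel_eq)
    with stable sub show ?thesis
    proof (induction rule: sigma_sets_induct_disjoint)
      case (compl A)
      then have A: "A \<in> sets borel" by (simp add: borel_eq)
      have *: "(LINT x|?L. h x * indicator (UNIV - A) x)
          = (LINT x|?L. h x * indicator UNIV x) - (LINT x|?L. h x * indicator A x)"
        if "integrable ?L (\<lambda>x. h x * indicator A x)" "integrable ?L (\<lambda>x. h x * indicator UNIV x)" for h :: "real \<Rightarrow> real"
        by (subst Bochner_Integration.integral_diff[OF that(2,1), symmetric])
          (auto intro!: Bochner_Integration.integral_cong simp: indicator_def)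
      show ?case
        unfolding P_def *[OF f_ind f_ind, OF A UNIV_borel]
          *[OF g_ind g_ind, OF A UNIV_borel]
        using P_UNIV compl(2) unfolding P_def by (rule tendsto_diff)
    next
      case (union A)
      have A: "A i \<in> sets borel" for i
        unfolding borel_eq by (rule subsetD[OF union(2) rangeI])
      \<comment> \<open>Finite partial unions reduce the countable case to
        \<open>weak_limit_closure_dominated\<close>, with the constant 1 as dominating
        function.\<close>
      define D where "D k = (\<Union>i<k. A i)" for k :: nat
      have D: "D k \<in> sets borel" for k
        unfolding D_def by (rule sets.finite_UN[OF finite_lessThan A])
      have "P (D k)" for k
      proof (induction k)
        case (Suc k)
        have "x \<notin> D k" if "x \<in> A k" for x
        proof
          assume "x \<in> D k"
          then obtain i where "i < k" "x \<in> A i" by (auto simp: D_def)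
          with disjoint_family_onD[OF union(1), of i k] that show False by auto
        qed
        moreover have "D (Suc k) = D k \<union> A k" by (simp add: D_def lessThan_Suc Un_commute)
        ultimately have D_Suc: "indicator (D (Suc k)) x = indicator (D k) x + (indicator (A k) x :: real)" for x
          by (simp add: indicator_def)
        have "(LINT x|?L. h x * indicator (D (Suc k)) x)
            = (LINT x|?L. h x * indicator (D k) x) + (LINT x|?L. h x * indicator (A k) x)"
          if "integrable ?L (\<lambda>x. h x * indicator (D k) x)" "integrable ?L (\<lambda>x. h x * indicator (A k) x)" for h :: "real \<Rightarrow> real"
          unfolding D_Suc distrib_left by (rule Bochner_Integration.integral_add[OF that])
        note * = this[OF f_ind f_ind, OF D A] this[OF g_ind g_ind, OF D A]
        show ?case unfolding P_def * using Suc union(3)[of k] unfolding P_def by (rule tendsto_add)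
      qed (simp add: P_def D_def)
      show ?case unfolding P_def
      proof (rule weak_limit_closure_dominated[OF f, where \<psi>s = "\<lambda>k. indicator (D k)" and h = "\<lambda>_. 1"])
        have "(\<lambda>k. indicator (D k) x) \<longlonglongrightarrow> (indicator (\<Union>i. A i) x :: real)" for x
          unfolding D_def by (rule LIMSEQ_indicator_UN)
        then show "AE x in ?L. (\<lambda>k. indicator (D k) x) \<longlonglongrightarrow> (indicator (\<Union>i. A i) x :: real)"
          by (intro AE_I2)
        show "integrable ?L (\<lambda>_. 1 :: real)" by simp
        show "AE x in ?L. \<bar>indicator (D k) x :: real\<bar> \<le> 1" for k
          by (intro AE_I2) (simp add: indicator_def)
        show "integrable ?L (\<lambda>x. g x * 1)" using g by simp
        show "(indicator (\<Union>i. A i) :: real \<Rightarrow> real) \<in> borel_measurable ?L"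
          by (intro meas sets.countable_UN) (simp add: A image_subset_iff)
      qed (use meas[OF D] g_meas \<open>\<And>k. P (D k)\<close> in \<open>simp_all add: P_def\<close>)
    next
      case (basic A)
      then obtain s t where "A = {s<..<t}" by auto
      then show ?case by (simp only: P_Ioo)
    qed (simp add: P_def)
  qed
  show ?thesis
  proof (rule weak_starI_indicator[OF fin f g])
    fix A assume A: "A \<in> sets ?L"
    obtain A' where "A' \<in> sets borel" "AE x in ?L. x \<in> A \<longleftrightarrow> x \<in> A'"
      using A by (rule sets_lebesgue_on_borel_eq_AE) simp
    then have "P A"
      by (intro P_cong[of A' A] P_borel meas borel_measurable_indicator[OF A])
    then show "(\<lambda>j. LINT x|?L. f j x * indicator A x) \<longlonglongrightarrow> (LINT x|?L. g x * indicator A x)"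
      by (simp add: P_def)
  qed
qed

lemma integral_lebesgue_on_eq:
  fixes h :: "'a::euclidean_space \<Rightarrow> real"
  assumes S: "S \<in> sets lebesgue" and 0: "\<And>x. x \<notin> S \<Longrightarrow> h x = 0"
  shows "(LINT x|lebesgue_on S. h x) = (LINT x|lebesgue. h x)"
proof -
  have "(LINT x|lebesgue_on S. h x) = (LINT x|lebesgue. indicator S x *\<^sub>R h x)"
    using S by (intro integral_restrict_space) simp
  also have "\<dots> = (LINT x|lebesgue. h x)"
    by (rule Bochner_Integration.integral_cong) (auto simp: indicator_def 0)
  finally show ?thesis .
qed

lemma integrable_lebesgue_on_Icc:
  fixes h :: "real \<Rightarrow> real"
  assumes "continuous_on {a..b} h"
  shows "integrable (lebesgue_on {a..b}) h"
proof -
  have "set_integrable lborel {a..b} h" using assms by (rule borel_integrable_atLeastAtMost')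
  then have "set_integrable lebesgue {a..b} h"
    by (simp add: set_integrable_def integrable_completion)
  then show ?thesis
    by (simp add: set_integrable_def integrable_restrict_space)
qed

lemma integral_lebesgue_on_FTC:
  fixes h :: "real \<Rightarrow> real"
  assumes "a \<le> b" "\<And>x. x \<in> {a..b} \<Longrightarrow> (h has_real_derivative h' x) (at x within {a..b})"
    and "continuous_on {a..b} h'"
  shows "(LINT x|lebesgue_on {a..b}. h' x) = h b - h a"
proof -
  have "(h' has_integral (h b - h a)) {a..b}"
    using assms by (intro fundamental_theorem_of_calculus)
      (auto simp: has_real_derivative_iff_has_vector_derivative[symmetric])
  moreover have "(LINT x|lebesgue_on {a..b}. h' x) = integral {a..b} h'"
    by (rule lebesgue_integral_eq_integral[OF integrable_lebesgue_on_Icc[OF assms(3)]]) simp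
  ultimately show ?thesis by (simp add: integral_unique)
qed

text \<open>Integration by parts against a smooth cut-off takes the derivative off
  \<open>g j\<close>, so that uniform convergence suffices; the weak derivative of the limit is
  defined by the same formula. The cut-offs then tend to the indicator of (s,t), and the common
  bound on the \<open>g' j\<close> makes this limit uniform in \<open>j\<close>.\<close>

lemma weak_star_weak_grad:
  fixes g :: "nat \<Rightarrow> real \<Rightarrow> real"
  assumes weak: "weak_grad_on \<Omega> G G'" and sub: "{a..b} \<subseteq> \<Omega>" and \<Omega>: "\<Omega> \<in> sets lebesgue"
    and deriv: "\<And>j x. x \<in> {a..b} \<Longrightarrow> (g j has_real_derivative g' j x) (at x)"
    and cont: "\<And>j. continuous_on {a..b} (g' j)"
    and bound: "\<And>j x. x \<in> {a..b} \<Longrightarrow> \<bar>g' j x\<bar> \<le> B"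
    and lim: "uniform_limit {a..b} g G sequentially"
  shows "weak_star (lebesgue_on {a..b}) g' G'"
proof (rule weak_starI_Ioo)
  let ?L = "lebesgue_on {a..b}"
  show g'_bdd: "ess_bounded ?L B (g' j)" for j
    using integrable_lebesgue_on_Icc[OF cont] bound
    by (auto simp: ess_bounded_def intro!: AE_I2)
  have g_cont: "continuous_on {a..b} (g j)" for j
    by (rule DERIV_continuous_on[OF has_field_derivative_at_within[OF deriv]])
  have G_cont: "continuous_on {a..b} G"
    by (rule uniform_limit_theorem[OF _ lim]) (simp_all add: g_cont)
  have "G' absolutely_integrable_on {a..b}"
    using weak sub by (auto simp: weak_grad_on_def L1_loc_def)
  then show G'_int: "integrable ?L G'"
    by (simp add: set_integrable_def integrable_restrict_space)
  fix s t assume st: "a \<le> s" "s \<le> t" "t \<le> b"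
  define \<zeta> where "\<zeta> k = bump s t k" for k
  have \<zeta>_cont: "continuous_on {a..b} (\<zeta> k)" for k
    unfolding \<zeta>_def by (rule DERIV_continuous_on[OF has_field_derivative_at_within[OF bump_has_derivative]])
  have \<zeta>'_cont: "continuous_on {a..b} (grad (\<zeta> k))" for k
    unfolding \<zeta>_def by (rule continuous_on_subset[OF continuous_on_grad_bump]) simp
  have by_parts: "(LINT x|?L. g' j x * \<zeta> k x) = - (LINT x|?L. g j x * grad (\<zeta> k) x)" for j k
  proof -
    have "(LINT x|?L. g' j x * \<zeta> k x + grad (\<zeta> k) x * g j x) = g j b * \<zeta> k b - g j a * \<zeta> k a"
    proof (rule integral_lebesgue_on_FTC)
      fix x assume "x \<in> {a..b}"
      from DERIV_mult[OF deriv[OF this] bump_has_derivative]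
      show "((\<lambda>x. g j x * \<zeta> k x) has_real_derivative g' j x * \<zeta> k x + grad (\<zeta> k) x * g j x) (at x within {a..b})"
        unfolding \<zeta>_def by (rule has_field_derivative_at_within)
    qed (use st cont g_cont \<zeta>_cont \<zeta>'_cont in \<open>auto intro!: continuous_on_add continuous_on_mult\<close>)
    also have "\<dots> = 0" using st by (simp add: \<zeta>_def bump_eq_0)
    also have "(LINT x|?L. g' j x * \<zeta> k x + grad (\<zeta> k) x * g j x)
        = (LINT x|?L. g' j x * \<zeta> k x) + (LINT x|?L. grad (\<zeta> k) x * g j x)"
      by (intro Bochner_Integration.integral_add integrable_lebesgue_on_Icc continuous_on_mult
          cont g_cont \<zeta>_cont \<zeta>'_cont)
    finally show ?thesis by (simp add: mult.commute)
  qed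
  have weak_k: "(LINT x:\<Omega>|lebesgue. G x *\<^sub>R grad (\<zeta> k) x) = - (LINT x:\<Omega>|lebesgue. \<zeta> k x *\<^sub>R G' x)" for k
    using weak test_function_bump[of s t \<Omega>] sub st unfolding weak_grad_on_def \<zeta>_def by force
  have lhs: "(LINT x:\<Omega>|lebesgue. G x *\<^sub>R grad (\<zeta> k) x) = (LINT x|?L. G x * grad (\<zeta> k) x)" for k
  proof -
    have "(LINT x|?L. G x * grad (\<zeta> k) x) = (LINT x|lebesgue. G x * grad (\<zeta> k) x)"
      using st by (intro integral_lebesgue_on_eq) (auto simp: \<zeta>_def grad_bump_eq_0)
    also have "\<dots> = (LINT x:\<Omega>|lebesgue. G x *\<^sub>R grad (\<zeta> k) x)"
      unfolding set_lebesgue_integral_def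
    proof (rule Bochner_Integration.integral_cong)
      fix x show "G x * grad (\<zeta> k) x = indicator \<Omega> x *\<^sub>R G x *\<^sub>R grad (\<zeta> k) x"
        using sub st grad_bump_eq_0[of x s t k] by (cases "x \<in> {a..b}") (auto simp: \<zeta>_def)
    qed simp
    finally show ?thesis ..
  qed
  have rhs: "(LINT x:\<Omega>|lebesgue. \<zeta> k x *\<^sub>R G' x) = (LINT x|?L. G' x * \<zeta> k x)" for k
  proof -
    have "(LINT x|?L. G' x * \<zeta> k x) = (LINT x|lebesgue. G' x * \<zeta> k x)"
      using st by (intro integral_lebesgue_on_eq) (auto simp: \<zeta>_def bump_eq_0)
    also have "\<dots> = (LINT x:\<Omega>|lebesgue. \<zeta> k x *\<^sub>R G' x)"
      unfolding set_lebesgue_integral_def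
    proof (rule Bochner_Integration.integral_cong)
      fix x show "G' x * \<zeta> k x = indicator \<Omega> x *\<^sub>R \<zeta> k x *\<^sub>R G' x"
        using sub st bump_eq_0[of x s t k] by (cases "x \<in> {a..b}") (auto simp: \<zeta>_def)
    qed simp
    finally show ?thesis ..
  qed
  have G_parts: "(LINT x|?L. G' x * \<zeta> k x) = - (LINT x|?L. G x * grad (\<zeta> k) x)" for k
    using weak_k[of k] unfolding lhs rhs by linarith
  have g_lim: "(\<lambda>j. LINT x|?L. g j x * grad (\<zeta> k) x) \<longlonglongrightarrow> (LINT x|?L. G x * grad (\<zeta> k) x)" for k
  proof (rule tendstoI)
    fix e :: real assume "0 < e"
    \<comment> \<open>Below, I + 1 takes the place of \<open>I\<close> as a denominator, since
      \<open>I\<close> is 0 when s = t.\<close>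
    define I where "I = (LINT x|?L. \<bar>grad (\<zeta> k) x\<bar>)"
    have I: "0 \<le> I" unfolding I_def by simp
    have "\<forall>\<^sub>F j in sequentially. \<forall>x\<in>{a..b}. dist (g j x) (G x) < e / (I + 1)"
      using \<open>0 < e\<close> I by (intro uniform_limitD[OF lim]) simp
    then show "\<forall>\<^sub>F j in sequentially. dist (LINT x|?L. g j x * grad (\<zeta> k) x) (LINT x|?L. G x * grad (\<zeta> k) x) < e"
    proof eventually_elim
      case (elim j)
      have bdd: "ess_bounded ?L (e / (I + 1)) (\<lambda>x. g j x - G x)"
        unfolding ess_bounded_def
        using integrable_lebesgue_on_Icc[OF continuous_on_diff[OF g_cont[of j] G_cont]] elim
        by (auto intro!: AE_I2 simp: dist_real_def less_imp_le)
      have "(LINT x|?L. g j x * grad (\<zeta> k) x) - (LINT x|?L. G x * grad (\<zeta> k) x)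
          = (LINT x|?L. g j x * grad (\<zeta> k) x - G x * grad (\<zeta> k) x)"
        by (rule Bochner_Integration.integral_diff[symmetric];
            intro integrable_lebesgue_on_Icc continuous_on_mult g_cont G_cont \<zeta>'_cont)
      also have "\<dots> = (LINT x|?L. (g j x - G x) * grad (\<zeta> k) x)"
        by (simp add: left_diff_distrib)
      finally have "dist (LINT x|?L. g j x * grad (\<zeta> k) x) (LINT x|?L. G x * grad (\<zeta> k) x) \<le> e / (I + 1) * I"
        using abs_integral_ess_bounded_mult_le[OF bdd integrable_lebesgue_on_Icc[OF \<zeta>'_cont[of k]]]
        by (simp add: dist_real_def I_def)
      also have "\<dots> < e" using \<open>0 < e\<close> I by (simp add: field_simps)
      finally show ?case .
    qed
  qed
  show "(\<lambda>j. LINT x|?L. g' j x * indicator {s<..<t} x) \<longlonglongrightarrow> (LINT x|?L. G' x * indicator {s<..<t} x)"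
  proof (rule weak_limit_closure_dominated[OF g'_bdd, where \<psi>s = \<zeta> and h = "\<lambda>_. 1"])
    show "\<zeta> k \<in> borel_measurable ?L" for k
      using integrable_lebesgue_on_Icc[OF \<zeta>_cont] by (rule borel_measurable_integrable)
    show "(indicator {s<..<t} :: real \<Rightarrow> real) \<in> borel_measurable ?L"
      by (intro measurable_restrict_space1 measurable_completion) simp
    show "AE x in ?L. (\<lambda>k. \<zeta> k x) \<longlonglongrightarrow> indicator {s<..<t} x"
      unfolding \<zeta>_def by (intro AE_I2 bump_tendsto)
    show "AE x in ?L. \<bar>\<zeta> k x\<bar> \<le> 1" for k
      using bump_bounds by (intro AE_I2) (simp add: \<zeta>_def)
    show "(\<lambda>j. LINT x|?L. g' j x * \<zeta> k x) \<longlonglongrightarrow> (LINT x|?L. G' x * \<zeta> k x)" for k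
      unfolding by_parts G_parts by (rule tendsto_minus[OF g_lim])
    show "integrable ?L (\<lambda>x. 1 :: real)" by simp
  qed (use G'_int in simp_all)
qed

lemma weak_star_norm:
  fixes f :: "nat \<Rightarrow> real \<Rightarrow> real"
  assumes w: "weak_star (lebesgue_on {a..b}) f g"
  shows "weak_star (lebesgue_on {x :: 'a::euclidean_space. a \<le> norm x \<and> norm x \<le> b})
           (\<lambda>j x. f j (norm x)) (\<lambda>x. g (norm x))"
proof -
  define S where "S = {x :: 'a. a \<le> norm x \<and> norm x \<le> b}"
  let ?L = "lebesgue_on {a..b}"
  have S: "S \<in> sets lebesgue"
    using measurable_sets[OF measurable_norm_lebesgue, of "{a..b}"] by (simp add: S_def vimage_def)
  obtain B where B: "ess_bounded ?L B g" "\<And>j. ess_bounded ?L B (f j)"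
    using w by (auto simp: weak_star_def)
  have bdd: "ess_bounded (lebesgue_on S) B (\<lambda>x. h (norm x))" if h: "ess_bounded ?L B h" for h
    unfolding ess_bounded_def
  proof
    have "norm \<in> lebesgue_on S \<rightarrow>\<^sub>M ?L"
      using measurable_norm_lebesgue
      by (intro measurable_restrict_space2 measurable_restrict_space1) (auto simp: S_def space_restrict_space)
    then show "(\<lambda>x. h (norm x)) \<in> borel_measurable (lebesgue_on S)"
      using h unfolding ess_bounded_def by (auto intro: measurable_compose)
    have "AE r in lebesgue. r \<in> {a..b} \<longrightarrow> \<bar>h r\<bar> \<le> B"
      using h by (simp add: ess_bounded_def AE_restrict_space_iff)
    from AE_norm[OF this] show "AE x in lebesgue_on S. \<bar>h (norm x)\<bar> \<le> B"
      using S by (simp add: AE_restrict_space_iff S_def)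
  qed
  have nonneg: "(\<lambda>j. LINT x|lebesgue_on S. f j (norm x) * \<psi> x) \<longlonglongrightarrow> (LINT x|lebesgue_on S. g (norm x) * \<psi> x)"
    if \<psi>: "integrable (lebesgue_on S) \<psi>" "\<And>x. 0 \<le> \<psi> x" for \<psi>
  proof -
    have "integrable lebesgue (\<lambda>x. indicator S x * \<psi> x)"
      using \<psi>(1) S by (simp add: integrable_restrict_space)
    then obtain \<rho> where \<rho>: "integrable lebesgue \<rho>" "\<And>h. h \<in> borel_measurable lebesgue \<Longrightarrow>
        (LINT x|lebesgue. h (norm x) * (indicator S x * \<psi> x)) = (LINT r|lebesgue. h r * \<rho> r)"
    proof (rule radial_density)
      show "0 \<le> indicator S x * \<psi> x" for x using \<psi>(2) by simp
    qed (rule that)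
    have "integrable ?L \<rho>"
      using \<rho>(1) by (simp add: integrable_restrict_space integrable_real_mult_indicator mult.commute)
    with w have "(\<lambda>j. LINT r|?L. f j r * \<rho> r) \<longlonglongrightarrow> (LINT r|?L. g r * \<rho> r)"
      by (simp add: weak_star_def)
    moreover have "(LINT r|?L. h r * \<rho> r) = (LINT x|lebesgue_on S. h (norm x) * \<psi> x)"
      if h: "h \<in> borel_measurable ?L" for h
    proof -
      \<comment> \<open>Cutting \<open>h\<close> off makes it measurable on the whole line, as
        \<open>radial_density\<close> demands; on the other side \<open>indicator S x\<close>
        already contains the same cut-off.\<close>
      have "(LINT r|?L. h r * \<rho> r) = (LINT r|lebesgue. (indicator {a..b} r * h r) * \<rho> r)"
        by (simp add: integral_restrict_space mult.assoc)
      also have "\<dots> = (LINT x|lebesgue. (indicator {a..b} (norm x) * h (norm x)) * (indicator S x * \<psi> x))"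
        using h by (intro \<rho>(2)[symmetric]) (simp add: borel_measurable_restrict_space_iff)
      also have "\<dots> = (LINT x|lebesgue. indicator S x *\<^sub>R (h (norm x) * \<psi> x))"
        by (rule Bochner_Integration.integral_cong) (auto simp: S_def indicator_def)
      also have "\<dots> = (LINT x|lebesgue_on S. h (norm x) * \<psi> x)"
        using S by (simp add: integral_restrict_space)
      finally show ?thesis .
    qed
    ultimately show ?thesis using B by (simp add: ess_bounded_def)
  qed
  have "(\<lambda>j. LINT x|lebesgue_on S. f j (norm x) * \<psi> x) \<longlonglongrightarrow> (LINT x|lebesgue_on S. g (norm x) * \<psi> x)"
    if \<psi>: "integrable (lebesgue_on S) \<psi>" for \<psi>
  proof -
    \<comment> \<open>\<open>radial_density\<close> concerns nonnegative functions, so the two signs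
      are treated separately.\<close>
    define \<psi>1 where "\<psi>1 x = max 0 (\<psi> x)" for x
    define \<psi>2 where "\<psi>2 x = max 0 (- \<psi> x)" for x
    have int: "integrable (lebesgue_on S) \<psi>1" "integrable (lebesgue_on S) \<psi>2"
      using \<psi> by (simp_all add: \<psi>1_def[abs_def] \<psi>2_def[abs_def])
    have "\<psi> x = \<psi>1 x - \<psi>2 x" for x by (simp add: \<psi>1_def \<psi>2_def)
    then have split: "(LINT x|lebesgue_on S. h (norm x) * \<psi> x)
        = (LINT x|lebesgue_on S. h (norm x) * \<psi>1 x) - (LINT x|lebesgue_on S. h (norm x) * \<psi>2 x)"
      if "ess_bounded ?L B h" for h
      using ess_bounded_integrable_mult[OF bdd[OF that] int(1)]
        ess_bounded_integrable_mult[OF bdd[OF that] int(2)]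
      by (simp add: right_diff_distrib)
    show ?thesis unfolding split[OF B(1)] split[OF B(2)]
      by (intro tendsto_diff nonneg int) (simp_all add: \<psi>1_def \<psi>2_def)
  qed
  moreover have "\<exists>B. ess_bounded (lebesgue_on S) B (\<lambda>x. g (norm x))
      \<and> (\<forall>j. ess_bounded (lebesgue_on S) B (\<lambda>x. f j (norm x)))"
    by (rule exI[of _ B]) (simp add: bdd B)
  ultimately show ?thesis unfolding weak_star_def S_def by simp
qed

section \<open>The radial solutions\<close>

text \<open>Near each of its points a closed set meets a ball in a compact set, where a single
  Hoelder constant is available.\<close>

lemma hoelder_loc_on_imp_continuous_on:
  fixes f :: "'a::heine_borel \<Rightarrow> real"
  assumes f: "hoelder_loc_on \<alpha> S f" and "closed S" "0 < \<alpha>"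
  shows "continuous_on S f"
  unfolding continuous_on_def
proof
  fix x assume "x \<in> S"
  have "compact (S \<inter> cball x 1)" using \<open>closed S\<close> by (rule closed_Int_compact) simp
  then have "\<exists>C. \<forall>y\<in>S \<inter> cball x 1. \<forall>z\<in>S \<inter> cball x 1. \<bar>f y - f z\<bar> \<le> C * dist y z powr \<alpha>"
    using f unfolding hoelder_loc_on_def by simp
  then obtain C where
    C: "\<forall>y\<in>S \<inter> cball x 1. \<forall>z\<in>S \<inter> cball x 1. \<bar>f y - f z\<bar> \<le> C * dist y z powr \<alpha>" ..
  have "((\<lambda>y. C * dist y x powr \<alpha>) \<longlongrightarrow> C * 0 powr \<alpha>) (at x within S)"
  proof (intro tendsto_mult tendsto_const tendsto_powr')
    have "((\<lambda>y. dist y x) \<longlongrightarrow> dist x x) (at x within S)"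
      by (intro tendsto_dist tendsto_ident_at tendsto_const)
    then show "((\<lambda>y. dist y x) \<longlongrightarrow> 0) (at x within S)" by simp
  qed (use \<open>0 < \<alpha>\<close> in auto)
  moreover have "\<forall>\<^sub>F y in at x within S. norm (f y - f x) \<le> C * dist y x powr \<alpha>"
    unfolding eventually_at
  proof (intro exI[of _ 1] conjI ballI impI)
    fix y assume "y \<in> S" "y \<noteq> x \<and> dist y x < 1"
    then show "norm (f y - f x) \<le> C * dist y x powr \<alpha>"
      using bspec[OF bspec[OF C, of y], of x] \<open>x \<in> S\<close> by (simp add: dist_commute)
  qed simp
  moreover have "C * 0 powr \<alpha> = 0" by simp
  ultimately have "((\<lambda>y. f y - f x) \<longlongrightarrow> 0) (at x within S)"
    using Lim_null_comparison[of "\<lambda>y. f y - f x" "\<lambda>y. C * dist y x powr \<alpha>" "at x within S"] by simp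
  then show "(f \<longlongrightarrow> f x) (at x within S)" by (rule LIM_zero_cancel)
qed

lemma grad_radial:
  assumes "x \<noteq> 0" "(v has_real_derivative d) (at (norm x))"
  shows "grad (\<lambda>x. v (norm x)) x = (d / norm x) *\<^sub>R x"
proof (rule grad_eq)
  show "GDERIV (\<lambda>x. v (norm x)) x :> (d / norm x) *\<^sub>R x"
    using GDERIV_DERIV_compose[OF GDERIV_norm[OF assms(1)] assms(2)]
    by (simp add: sgn_div_norm divide_inverse)
qed

text \<open>Trades the Lebesgue integral for the gauge integral, in whose terms the fundamental
  theorem of calculus is available.\<close>

lemma radial_flux_eq_integral:
  assumes "continuous_on {0..} f" "0 \<le> s"
  shows "radial_flux n f s = integral {0..s} (\<lambda>t. t ^ (n - 1) * f t) / s ^ (n - 1)"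
proof -
  have "continuous_on {0..s} (\<lambda>t. t ^ (n - 1) * f t)"
    by (intro continuous_intros continuous_on_subset[OF assms(1)]) auto
  then have "set_integrable lebesgue {0..s} (\<lambda>t. t ^ (n - 1) * f t)"
    using integrable_lebesgue_on_Icc by (simp add: set_integrable_def integrable_restrict_space)
  then show ?thesis
    unfolding radial_flux_def by (simp add: set_lebesgue_integral_eq_integral(2))
qed

text \<open>This is the radial divergence formula: s^(n-1) times the flux is an antiderivative of
  s^(n-1) f. It holds classically because \<open>f\<close> is continuous, so the later integration
  by parts stays elementary.\<close>

lemma radial_flux_has_derivative:
  assumes f: "continuous_on {0..} f" and "0 < s" "2 \<le> n"
  shows "(radial_flux n f has_real_derivative f s - (real n - 1) / s * radial_flux n f s) (at s)"
proof -
  let ?h = "\<lambda>t. t ^ (n - 1) * f t"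
  have "continuous_on {0..s + 1} ?h"
    by (intro continuous_intros continuous_on_subset[OF f]) auto
  then have "((\<lambda>x. integral {0..x} ?h) has_real_derivative ?h s) (at s within {0..s + 1})"
    by (rule integral_has_real_derivative) (use \<open>0 < s\<close> in simp)
  then have I: "((\<lambda>x. integral {0..x} ?h) has_real_derivative ?h s) (at s)"
    using \<open>0 < s\<close> at_within_interior[of s "{0..s + 1}"] by simp
  \<comment> \<open>Removes the truncated subtraction: the exponent n-1 becomes
    \<open>Suc m\<close>, that of its derivative becomes \<open>m\<close>.\<close>
  obtain m where m: "n = Suc (Suc m)" using \<open>2 \<le> n\<close> by (metis Suc_le_D numeral_2_eq_2 Suc_le_mono)
  have "((\<lambda>x. integral {0..x} ?h / x ^ (n - 1)) has_real_derivative
      (?h s * s ^ (n - 1) - integral {0..s} ?h * (real (Suc m) * s ^ m)) / (s ^ (n - 1) * s ^ (n - 1))) (at s)"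
  proof (rule DERIV_divide[OF I])
    show "((\<lambda>x. x ^ (n - 1)) has_real_derivative real (Suc m) * s ^ m) (at s)"
      using DERIV_pow[of "Suc m" s] by (simp add: m)
    show "s ^ (n - 1) \<noteq> 0" using \<open>0 < s\<close> by simp
  qed
  also have "(?h s * s ^ (n - 1) - integral {0..s} ?h * (real (Suc m) * s ^ m)) / (s ^ (n - 1) * s ^ (n - 1))
      = f s - (real n - 1) / s * radial_flux n f s"
    using \<open>0 < s\<close> by (subst radial_flux_eq_integral[OF f]) (simp_all add: m field_simps)
  finally show ?thesis
    by (rule has_field_derivative_transform_within_open[of _ _ _ "{0<..}"])
      (use \<open>0 < s\<close> in \<open>auto simp: radial_flux_eq_integral[OF f]\<close>)
qed

lemma radial_flux_nonneg:
  assumes "0 \<le> s" "\<And>t. 0 \<le> t \<Longrightarrow> 0 \<le> f t"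
  shows "0 \<le> radial_flux n f s"
  unfolding radial_flux_def set_lebesgue_integral_def using assms
  by (intro divide_nonneg_nonneg Bochner_Integration.integral_nonneg) (auto simp: indicator_def)

lemma radial_solution_deriv_at:
  assumes "C1_half_line v" "0 < r"
  shows "(v has_real_derivative hderiv v r) (at r)"
proof -
  have at: "at r within {0..} = at r" using assms(2) by (intro at_within_interior) simp
  have "v differentiable at r within {0..}" using assms by (simp add: C1_half_line_def)
  then show ?thesis
    unfolding vector_derivative_works hderiv_def at has_real_derivative_iff_has_vector_derivative .
qed

lemma barrier_pos: "0 < l \<Longrightarrow> 0 < barrier n l p r"
proof -
  assume "0 < l"
  then have "0 < max l r" by (simp only: less_max_iff_disj simp_thms)
  then show "0 < barrier n l p r" unfolding barrier_def by (metis less_irrefl powr_gt_zero)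
qed

context
  fixes n :: nat and \<alpha> l \<xi>1 \<xi>2 p \<beta> :: real
    and F :: "real \<times> real \<times> real \<Rightarrow> real" and \<phi> :: "real \<times> real \<Rightarrow> real" and v :: "real \<Rightarrow> real"
  assumes n: "2 \<le> n" and params: "0 < \<alpha>" "0 < l" "0 < \<xi>1" and p: "1 < p" "p < 2"
    and adm: "admissible n \<alpha> l \<xi>1 \<xi>2 p F \<phi> \<beta>" and sol: "radial_solution n l \<xi>1 \<xi>2 p F \<beta> v"
begin

lemma solution_bounds:
  assumes "0 \<le> r"
  shows "barrier n l p r / \<xi>1 \<le> v r" "0 < v r" "v r \<le> \<xi>1" "\<bar>hderiv v r\<bar> \<le> \<xi>2"
proof -
  show *: "barrier n l p r / \<xi>1 \<le> v r" "v r \<le> \<xi>1" "\<bar>hderiv v r\<bar> \<le> \<xi>2"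
    using sol assms by (auto simp: radial_solution_def)
  have "0 < barrier n l p r / \<xi>1" using barrier_pos params by simp
  with *(1) show "0 < v r" by linarith
qed

lemma continuous_on_reaction: "continuous_on {0..} (reaction F \<beta> v)"
proof -
  have F: "continuous_on ({0..} \<times> {0..} \<times> {0..}) F"
    by (rule hoelder_loc_on_imp_continuous_on[OF _ _ params(1)])
      (use adm in \<open>auto simp: admissible_def intro: closed_Times\<close>)
  have C1: "C1_half_line v" using sol by (simp add: radial_solution_def)
  have v: "continuous_on {0..} v"
    using C1 unfolding C1_half_line_def continuous_on_eq_continuous_within
    by (auto intro: differentiable_imp_continuous_within)
  have v': "continuous_on {0..} (hderiv v)" using C1 by (simp add: C1_half_line_def)
  have "continuous_on {0..} (\<lambda>r. F (r, v r, \<bar>hderiv v r\<bar>))"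
  proof (rule continuous_on_compose2[OF F])
    show "continuous_on {0..} (\<lambda>r. (r, v r, \<bar>hderiv v r\<bar>))"
      by (intro continuous_on_Pair continuous_on_id v continuous_on_rabs v')
    show "(\<lambda>r. (r, v r, \<bar>hderiv v r\<bar>)) ` {0..} \<subseteq> {0..} \<times> {0..} \<times> {0..}"
    proof (rule image_subsetI)
      fix r :: real assume "r \<in> {0..}"
      then show "(r, v r, \<bar>hderiv v r\<bar>) \<in> {0..} \<times> {0..} \<times> {0..}"
        using solution_bounds(2)[of r] by simp
    qed
  qed
  moreover have "continuous_on {0..} (\<lambda>r. v r powr (- \<beta>))"
  proof (rule continuous_on_powr[OF v continuous_on_const], rule ballI)
    fix r :: real assume "r \<in> {0..}"
    then show "v r \<noteq> 0" using solution_bounds(2)[of r] by simp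
  qed
  ultimately show ?thesis unfolding reaction_def by (rule continuous_on_mult)
qed

lemma reaction_nonneg: "0 \<le> r \<Longrightarrow> 0 \<le> reaction F \<beta> v r"
proof -
  assume "0 \<le> r"
  have "\<forall>r u \<rho>. 0 \<le> r \<and> 0 < u \<and> u \<le> \<xi>1 \<and> 0 \<le> \<rho> \<and> \<rho> \<le> \<xi>2 \<longrightarrow>
      0 \<le> \<phi> (r, u) \<and> \<phi> (r, u) \<le> F (r, u, \<rho>)"
    using adm unfolding admissible_def by (elim conjE) assumption
  from this[THEN spec[of _ r], THEN spec[of _ "v r"], THEN spec[of _ "\<bar>hderiv v r\<bar>"]]
  have "0 \<le> \<phi> (r, v r) \<and> \<phi> (r, v r) \<le> F (r, v r, \<bar>hderiv v r\<bar>)"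
    using \<open>0 \<le> r\<close> solution_bounds[OF \<open>0 \<le> r\<close>] by simp
  then have "0 \<le> F (r, v r, \<bar>hderiv v r\<bar>)" by linarith
  then show ?thesis by (simp add: reaction_def)
qed

lemma flux_nonneg: "0 \<le> r \<Longrightarrow> 0 \<le> radial_flux n (reaction F \<beta> v) r"
  by (rule radial_flux_nonneg[OF _ reaction_nonneg])

text \<open>The integral equation is differentiated after splitting the half line at r + 1: only an
  integral over a compact interval then depends on the variable, and the tail is the constant
  \<open>v b\<close>.\<close>

lemma hderiv_solution:
  assumes "0 < r"
  shows "hderiv v r = - (radial_flux n (reaction F \<beta> v) r powr (1 / (p - 1)))"
proof -
  define g where "g s = radial_flux n (reaction F \<beta> v) s powr (1 / (p - 1))" for s
  \<comment> \<open>Where the flux vanishes, continuity of the power rests on the positive exponent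
    1/(p-1) and on the flux being nonnegative.\<close>
  have g_cont: "continuous_on {0<..} g"
    unfolding g_def
  proof (rule continuous_on_powr')
    show "continuous_on {0<..} (radial_flux n (reaction F \<beta> v))"
      by (rule DERIV_continuous_on[OF has_field_derivative_at_within[OF
            radial_flux_has_derivative[OF continuous_on_reaction _ n]]]) simp
  qed (use p flux_nonneg in \<open>auto intro: continuous_on_const\<close>)
  define b where "b = r + 1"
  have g_int: "set_integrable lebesgue {x<..} g" "v x = (LINT s:{x<..}|lebesgue. g s)" if "0 \<le> x" for x
    using sol that by (auto simp: radial_solution_def g_def[abs_def])
  have v_eq: "v x = integral {x..b} g + v b" if x: "0 < x" "x \<le> b" for x
  proof -
    have "continuous_on {x..b} g" by (rule continuous_on_subset[OF g_cont]) (use x in auto)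
    then have "(g has_integral integral {x..b} g) {x..b}"
      by (intro integrable_integral integrable_continuous_interval)
    moreover have "(g has_integral v b) {b<..}"
      using has_integral_set_lebesgue[OF g_int(1), of b] g_int(2)[of b] x by simp
    moreover have "{x..b} \<inter> {b<..} = {}" by auto
    then have "negligible ({x..b} \<inter> {b<..})" by simp
    ultimately have "(g has_integral integral {x..b} g + v b) ({x..b} \<union> {b<..})"
      by (rule has_integral_Un)
    \<comment> \<open>The integral equation runs over the open half line, the decomposition over the
      closed one; they differ by the single point \<open>x\<close>.\<close>
    also have "{x..b} \<union> {b<..} = insert x {x<..}" using x by auto
    finally have "(g has_integral integral {x..b} g + v b) (insert x {x<..})" .
    moreover have "(g has_integral I) (insert x {x<..}) \<longleftrightarrow> (g has_integral I) {x<..}" for I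
    proof (rule has_integral_spike_set_eq)
      show "negligible {y \<in> insert x {x<..} - {x<..}. g y \<noteq> 0}"
        by (rule negligible_subset[OF negligible_sing[of x]]) auto
    qed simp
    ultimately have "(g has_integral integral {x..b} g + v b) {x<..}" by simp
    moreover have "(g has_integral v x) {x<..}"
      using has_integral_set_lebesgue[OF g_int(1), of x] g_int(2)[of x] x by simp
    ultimately show ?thesis by (rule has_integral_unique[rotated])
  qed
  have "((\<lambda>x. integral {x..b} g) has_real_derivative - g r) (at r within {r/2..b})"
    by (rule integral_has_real_derivative')
      (use assms in \<open>auto simp: b_def intro!: continuous_on_subset[OF g_cont]\<close>)
  then have "((\<lambda>x. integral {x..b} g) has_real_derivative - g r) (at r)"
    using assms at_within_interior[of r "{r/2..b}"] by (simp add: b_def)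
  from DERIV_add[OF this DERIV_const[of "v b"]]
  have "((\<lambda>x. integral {x..b} g + v b) has_real_derivative - g r) (at r)"
    by (rule DERIV_cong) (rule add_0_right)
  then have "(v has_real_derivative - g r) (at r)"
  proof (rule has_field_derivative_transform_within_open)
    show "r \<in> {0<..<b}" using assms by (simp add: b_def)
    show "integral {x..b} g + v b = v x" if "x \<in> {0<..<b}" for x
      by (rule v_eq[symmetric]) (use that in simp_all)
  qed simp
  moreover have "(v has_real_derivative hderiv v r) (at r)"
    using sol assms by (intro radial_solution_deriv_at) (simp_all add: radial_solution_def)
  ultimately show ?thesis unfolding g_def by (rule DERIV_unique[rotated])
qed

text \<open>The lower barrier decays with the exponent (n-p)/(p-1), which blows up as p tends to 1;
  since \<beta> < p-1, raising it to the power -\<beta> leaves an exponent of at most n-p. Hence a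
  bound free of p and \<beta>. The maxima with 1 make the powers monotone in the exponent.\<close>

lemma solution_powr_le:
  assumes "0 \<le> r" "p \<le> real n"
  shows "v r powr (- \<beta>) \<le> max 1 \<xi>1 * max 1 (max l r) powr real n"
proof -
  have \<beta>: "0 \<le> \<beta>" "\<beta> < p - 1" using adm by (auto simp: admissible_def)
  let ?b = "barrier n l p r"
  have "v r powr (- \<beta>) \<le> (?b / \<xi>1) powr (- \<beta>)"
    using solution_bounds[OF assms(1)] \<beta>(1) barrier_pos params by (intro powr_mono2') simp_all
  also have "\<dots> = \<xi>1 powr \<beta> * ?b powr (- \<beta>)"
    using barrier_pos[of l n p r] params by (simp add: powr_divide powr_minus field_simps)
  also have "\<dots> \<le> max 1 \<xi>1 * max 1 (max l r) powr real n"
  proof (intro mult_mono)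
    have "\<xi>1 powr \<beta> \<le> max 1 \<xi>1 powr \<beta>" using \<beta> params by (intro powr_mono2) auto
    also have "\<dots> \<le> max 1 \<xi>1 powr 1" using \<beta> p by (intro powr_mono) auto
    finally show "\<xi>1 powr \<beta> \<le> max 1 \<xi>1" by simp
    have le1: "\<beta> / (p - 1) \<le> 1" using \<beta> p by (simp add: field_simps)
    have "?b powr (- \<beta>) = max l r powr ((real n - p) * (\<beta> / (p - 1)))"
      by (simp add: barrier_def powr_powr)
    also have "\<dots> \<le> max 1 (max l r) powr ((real n - p) * (\<beta> / (p - 1)))"
      using assms \<beta> p params by (intro powr_mono2) auto
    also have "\<dots> \<le> max 1 (max l r) powr real n"
    proof (rule powr_mono)
      have "(real n - p) * (\<beta> / (p - 1)) \<le> (real n - p) * 1"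
        using le1 assms by (intro mult_left_mono) auto
      also have "\<dots> \<le> real n" using p by simp
      finally show "(real n - p) * (\<beta> / (p - 1)) \<le> real n" .
    qed simp
    finally show "?b powr (- \<beta>) \<le> max 1 (max l r) powr real n" .
  qed auto
  finally show ?thesis .
qed

end

text \<open>Take logarithms: with G = 1 + x and e = p - 1, the quotient ln (1 + x) / e differs from
  x/e by at most 2 x^2 / e = 2 |x/e| |x|, which tends to 0 because x/e converges and x tends to
  0.\<close>

lemma powr_tendsto_exp:
  fixes p G :: "nat \<Rightarrow> real"
  assumes p: "\<And>j. 1 < p j" "p \<longlonglongrightarrow> 1"
    and a: "(\<lambda>j. (G j - 1) / (p j - 1)) \<longlonglongrightarrow> a"
  shows "(\<lambda>j. G j powr (1 / (p j - 1))) \<longlonglongrightarrow> exp a"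
proof -
  define x where "x j = G j - 1" for j
  define e where "e j = p j - 1" for j
  have e: "0 < e j" for j using p(1) by (simp add: e_def)
  have "(\<lambda>j. p j - 1) \<longlonglongrightarrow> 1 - 1" by (intro tendsto_intros p(2))
  then have e0: "e \<longlonglongrightarrow> 0" by (simp add: e_def[abs_def])
  have xe: "(\<lambda>j. x j / e j) \<longlonglongrightarrow> a" using a by (simp add: x_def e_def)
  have "(\<lambda>j. x j / e j * e j) \<longlonglongrightarrow> a * 0" by (intro tendsto_mult xe e0)
  moreover have "x j / e j * e j = x j" for j using e[of j] by simp
  ultimately have x0: "x \<longlonglongrightarrow> 0" by simp
  \<comment> \<open>The bound 1/2 is the range of the quadratic estimate for the logarithm; it also
    keeps \<open>G j\<close> positive, so that the power is the exponential of a logarithm.\<close>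
  then have small: "\<forall>\<^sub>F j in sequentially. \<bar>x j\<bar> \<le> 1 / 2"
    using tendstoD[OF x0, of "1/2"] by (auto elim!: eventually_mono)
  have "(\<lambda>j. 2 * (\<bar>x j / e j\<bar> * \<bar>x j\<bar>)) \<longlonglongrightarrow> 2 * (\<bar>a\<bar> * \<bar>0\<bar>)"
    by (intro tendsto_intros xe x0)
  then have "(\<lambda>j. 2 * (\<bar>x j / e j\<bar> * \<bar>x j\<bar>)) \<longlonglongrightarrow> 0" by simp
  then have "(\<lambda>j. ln (1 + x j) / e j - x j / e j) \<longlonglongrightarrow> 0"
  proof (rule Lim_null_comparison[rotated])
    show "\<forall>\<^sub>F j in sequentially. norm (ln (1 + x j) / e j - x j / e j) \<le> 2 * (\<bar>x j / e j\<bar> * \<bar>x j\<bar>)"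
      using small
    proof eventually_elim
      case (elim j)
      have "norm (ln (1 + x j) / e j - x j / e j) = \<bar>ln (1 + x j) - x j\<bar> / e j"
        using e[of j] by (simp add: diff_divide_distrib[symmetric] abs_divide)
      also have "\<dots> \<le> 2 * (x j)\<^sup>2 / e j"
        using abs_ln_one_plus_x_minus_x_bound[OF elim] e[of j] by (intro divide_right_mono) simp_all
      also have "\<dots> = 2 * (\<bar>x j / e j\<bar> * \<bar>x j\<bar>)"
        using e[of j] by (simp add: power2_eq_square abs_divide)
      finally show ?case .
    qed
  qed
  from tendsto_add[OF this xe] have "(\<lambda>j. ln (1 + x j) / e j) \<longlonglongrightarrow> a" by simp
  then have "(\<lambda>j. exp (ln (1 + x j) / e j)) \<longlonglongrightarrow> exp a" by (rule tendsto_exp)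
  moreover have "\<forall>\<^sub>F j in sequentially. exp (ln (1 + x j) / e j) = G j powr (1 / (p j - 1))"
    using small by eventually_elim (auto simp: powr_def x_def e_def)
  ultimately show ?thesis by (rule Lim_transform_eventually)
qed

section \<open>Pointwise limits and annuli\<close>

lemma weak_starI_pointwise:
  assumes f: "\<And>j :: nat. ess_bounded M B (f j)" and g: "g \<in> borel_measurable M"
    and lim: "AE x in M. (\<lambda>j. f j x) \<longlonglongrightarrow> g x"
  shows "weak_star M f g"
proof -
  have all: "AE x in M. \<forall>j. \<bar>f j x\<bar> \<le> B" using f by (simp add: AE_all_countable ess_bounded_def)
  from lim this have "AE x in M. \<bar>g x\<bar> \<le> B"
  proof eventually_elim
    case (elim x)
    then show ?case by (intro LIMSEQ_le_const2[OF tendsto_rabs[OF elim(1)]]) blast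
  qed
  then have gB: "ess_bounded M B g" using g by (simp add: ess_bounded_def)
  have "(\<lambda>j. LINT x|M. f j x * \<psi> x) \<longlonglongrightarrow> (LINT x|M. g x * \<psi> x)" if \<psi>: "integrable M \<psi>" for \<psi>
  proof (rule integral_dominated_convergence[where w = "\<lambda>x. B * \<bar>\<psi> x\<bar>"])
    show "(\<lambda>x. g x * \<psi> x) \<in> borel_measurable M" "(\<lambda>x. f j x * \<psi> x) \<in> borel_measurable M" for j
      using g f[of j] \<psi> by (simp_all add: ess_bounded_def borel_measurable_times)
    show "integrable M (\<lambda>x. B * \<bar>\<psi> x\<bar>)" using \<psi> by simp
    show "AE x in M. (\<lambda>j. f j x * \<psi> x) \<longlonglongrightarrow> g x * \<psi> x"
      using lim by eventually_elim (intro tendsto_intros)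
    show "AE x in M. norm (f j x * \<psi> x) \<le> B * \<bar>\<psi> x\<bar>" for j
      using all by eventually_elim (simp add: abs_mult mult_right_mono)
  qed
  moreover have "\<exists>B. ess_bounded M B g \<and> (\<forall>j. ess_bounded M B (f j))"
    by (rule exI[of _ B]) (simp add: f gB)
  ultimately show ?thesis by (simp add: weak_star_def)
qed

text \<open>Measurability of \<open>h\<close> comes for free: the function formed by
  \<open>lim\<close> is measurable and agrees with \<open>h\<close> almost everywhere. This matters
  where the limit contains the function \<open>a\<close>, of which only a pointwise convergence is
  known.\<close>

lemma weak_star_AE_eq_limit:
  assumes fin: "finite_measure M" and w: "weak_star M f g"
    and lim: "AE x in M. (\<lambda>j. f j x) \<longlonglongrightarrow> h x"
  shows "AE x in M. g x = h x"
proof -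
  have "f j \<in> borel_measurable M" for j using w by (auto simp: weak_star_def ess_bounded_def)
  then have meas: "(\<lambda>x. lim (\<lambda>j. f j x)) \<in> borel_measurable M" by (rule borel_measurable_lim_metric)
  have eq: "AE x in M. lim (\<lambda>j. f j x) = h x"
    using lim by eventually_elim (rule limI)
  have "AE x in M. (\<lambda>j. f j x) \<longlonglongrightarrow> lim (\<lambda>j. f j x)"
    using lim eq by eventually_elim simp
  from weak_star_AE_eq[OF fin w meas this] eq show ?thesis
    by eventually_elim simp
qed

text \<open>Uniform convergence bounds only a tail of the sequence, while \<open>weak_star\<close>
  speaks of all indices; the finitely many others enter through a maximum.\<close>

lemma uniformly_bounded_of_eventually:
  fixes f :: "nat \<Rightarrow> 'a \<Rightarrow> real"
  assumes each: "\<And>j. \<exists>C. \<forall>x\<in>S. \<bar>f j x\<bar> \<le> C"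
    and ev: "\<forall>\<^sub>F j in sequentially. \<forall>x\<in>S. \<bar>f j x\<bar> \<le> D"
  obtains B where "\<And>j x. x \<in> S \<Longrightarrow> \<bar>f j x\<bar> \<le> B"
proof -
  obtain N where N: "\<forall>j\<ge>N. \<forall>x\<in>S. \<bar>f j x\<bar> \<le> D" using ev by (auto simp: eventually_sequentially)
  obtain C where C: "\<And>j. \<forall>x\<in>S. \<bar>f j x\<bar> \<le> C j" using each by metis
  define B where "B = Max (insert D (C ` {..<N}))"
  have "\<bar>f j x\<bar> \<le> B" if "x \<in> S" for j x
  proof (cases "N \<le> j")
    case True
    then have "\<bar>f j x\<bar> \<le> D" using N that by simp
    also have "D \<le> B" unfolding B_def by simp
    finally show ?thesis .
  next
    case False
    then have "C j \<le> B" unfolding B_def by (intro Max_ge) auto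
    then show ?thesis using C[of j] that by force
  qed
  then show thesis by (rule that)
qed

lemma annulus_lmeasurable: "{x :: 'a::euclidean_space. a \<le> norm x \<and> norm x \<le> b} \<in> lmeasurable"
proof -
  have "{x :: 'a. a \<le> norm x \<and> norm x \<le> b} = cball 0 b - ball 0 a" by (auto simp: dist_norm)
  then show ?thesis by (simp only: fmeasurable.Diff lmeasurable_cball lmeasurable_ball)
qed

lemma AE_annuli:
  assumes "\<And>a b. 0 < a \<Longrightarrow> a < b \<Longrightarrow>
    AE x in lebesgue_on {x :: 'a::euclidean_space. a \<le> norm x \<and> norm x \<le> b}. P x"
  shows "AE x :: 'a in lebesgue. P x"
proof -
  \<comment> \<open>With k + 2 the inner radius is below the outer one for every \<open>k\<close>; k
    + 1 would give the degenerate annulus |x| = 1 at k = 0. The annuli exhaust all nonzero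
    points.\<close>
  have "AE x :: 'a in lebesgue. \<forall>k :: nat. 1 / (real k + 2) \<le> norm x \<and> norm x \<le> real k + 2 \<longrightarrow> P x"
    unfolding AE_all_countable
  proof
    fix k :: nat
    have "1 / (real k + 2) < real k + 2"
      by (rule less_trans[of _ 1]) simp_all
    from assms[OF _ this] show "AE x :: 'a in lebesgue. 1 / (real k + 2) \<le> norm x \<and> norm x \<le> real k + 2 \<longrightarrow> P x"
      using annulus_lmeasurable[where 'a = 'a] by (simp add: AE_restrict_space_iff fmeasurableD)
  qed
  moreover have "AE x :: 'a in lebesgue. x \<noteq> 0"
    by (simp add: AE_completion AE_lborel_singleton)
  ultimately show ?thesis
  proof eventually_elim
    case (elim x)
    obtain k :: nat where k: "max (norm x) (1 / norm x) \<le> real k" using real_arch_simple by blast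
    have "1 / (real k + 2) \<le> norm x"
      using k elim(2) by (simp add: field_simps) (smt (verit) norm_ge_zero mult_nonneg_nonneg)
    with elim(1) k show ?case by (intro elim(1)[rule_format, of k]) simp
  qed
qed

lemma AE_intervals:
  assumes "\<And>a b. 0 < a \<Longrightarrow> a < b \<Longrightarrow> AE r in lebesgue_on {a..b::real}. P r"
  shows "AE r in lebesgue. 0 < r \<longrightarrow> P r"
proof -
  \<comment> \<open>In dimension one an annulus has two components; the premise discards the
    negative one.\<close>
  have "AE r in lebesgue. \<bar>r\<bar> = r \<longrightarrow> P r"
  proof (rule AE_annuli)
    fix a b :: real assume "0 < a" "a < b"
    from assms[OF this] have "AE r in lebesgue. r \<in> {a..b} \<longrightarrow> P r"
      by (simp add: AE_restrict_space_iff)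
    then show "AE r in lebesgue_on {r. a \<le> norm r \<and> norm r \<le> b}. \<bar>r\<bar> = r \<longrightarrow> P r"
      using annulus_lmeasurable[where 'a = real]
      by (subst AE_restrict_space_iff) (auto simp: fmeasurableD elim!: eventually_mono)
  qed
  then show ?thesis by eventually_elim simp
qed

lemma borel_measurable_compose_continuous_on:
  fixes h :: "'b::topological_space \<Rightarrow> 'c::topological_space"
  assumes h: "continuous_on D h" and f: "f \<in> borel_measurable M" "\<And>x. x \<in> space M \<Longrightarrow> f x \<in> D"
  shows "(\<lambda>x. h (f x)) \<in> borel_measurable M"
proof (rule measurable_compose[where f = f and g = h])
  show "f \<in> M \<rightarrow>\<^sub>M restrict_space borel D"
    using f by (intro measurable_restrict_space2) auto
  show "h \<in> borel_measurable (restrict_space borel D)"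
    using h by (rule borel_measurable_continuous_on_restrict)
qed

text \<open>The gradients \<open>\<rho> j\<close> do not have to converge. They stay in a compact
  range, on which \<open>F j\<close> tends to \<open>F1\<close> uniformly, and the Hoelder bound
  compares \<open>F1\<close> at \<open>v j\<close> and at \<open>t\<close> with the same third
  argument. The oscillation thus survives only in \<open>F1 (r, t, \<rho> j)\<close>.\<close>

lemma reaction_tendsto:
  fixes F :: "nat \<Rightarrow> real \<times> real \<times> real \<Rightarrow> real"
  assumes F: "locally_uniform_on ({0..} \<times> {0..} \<times> {0..}) F F1 sequentially"
    and F1: "hoelder_loc_on \<alpha> ({0..} \<times> {0..} \<times> {0..}) F1" "0 < \<alpha>"
    and p: "\<And>j. 1 < p j" and \<beta>: "(\<lambda>j. \<beta> j / (p j - 1)) \<longlonglongrightarrow> c"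
    and r: "0 \<le> r" and v: "v \<longlonglongrightarrow> t" "\<And>j. 0 < v j" "\<And>j. v j \<le> \<xi>1"
    and \<omega>: "(\<lambda>j. v j powr (p j - 1)) \<longlonglongrightarrow> \<omega>" "0 < \<omega>"
    and \<rho>: "\<And>j. 0 \<le> \<rho> j" "\<And>j. \<rho> j \<le> \<xi>2"
  shows "(\<lambda>j. F j (r, v j, \<rho> j) * v j powr (- \<beta> j) - \<omega> powr (- c) * F1 (r, t, \<rho> j)) \<longlonglongrightarrow> 0"
proof -
  define T where "T = {r} \<times> {0..\<xi>1} \<times> {0..\<xi>2}"
  have T: "compact T" unfolding T_def by (intro compact_Times) auto
  have T_sub: "T \<subseteq> {0..} \<times> {0..} \<times> {0..}" using r unfolding T_def by (intro Sigma_mono) auto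
  have t: "0 \<le> t" "t \<le> \<xi>1"
    using LIMSEQ_le_const[OF v(1), of 0] LIMSEQ_le_const2[OF v(1), of \<xi>1] v(2,3)
    by (auto intro: less_imp_le)
  have in_T: "(r, v j, \<rho> j) \<in> T" "(r, t, \<rho> j) \<in> T" for j
    using v(2)[of j] v(3)[of j] \<rho>[of j] t by (simp_all add: T_def)
  have unif: "uniform_limit T F F1 sequentially" using F T T_sub by (simp add: locally_uniform_on_def)
  obtain C where C: "\<forall>x\<in>T. \<forall>y\<in>T. \<bar>F1 x - F1 y\<bar> \<le> C * dist x y powr \<alpha>"
    using F1(1) T T_sub unfolding hoelder_loc_on_def by meson
  have "(\<lambda>j. F j (r, v j, \<rho> j) - F1 (r, v j, \<rho> j)) \<longlonglongrightarrow> 0"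
  proof (rule tendstoI)
    fix e :: real assume "0 < e"
    show "\<forall>\<^sub>F j in sequentially. dist (F j (r, v j, \<rho> j) - F1 (r, v j, \<rho> j)) 0 < e"
      using uniform_limitD[OF unif \<open>0 < e\<close>] by eventually_elim (use in_T in \<open>simp add: dist_real_def\<close>)
  qed
  moreover have "(\<lambda>j. F1 (r, v j, \<rho> j) - F1 (r, t, \<rho> j)) \<longlonglongrightarrow> 0"
  proof (rule Lim_null_comparison)
    show "\<forall>\<^sub>F j in sequentially. norm (F1 (r, v j, \<rho> j) - F1 (r, t, \<rho> j)) \<le> C * \<bar>v j - t\<bar> powr \<alpha>"
    proof (rule always_eventually, rule allI)
      fix j
      have "dist (r, v j, \<rho> j) (r, t, \<rho> j) = \<bar>v j - t\<bar>" by (simp add: dist_Pair_Pair dist_real_def)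
      then show "norm (F1 (r, v j, \<rho> j) - F1 (r, t, \<rho> j)) \<le> C * \<bar>v j - t\<bar> powr \<alpha>"
        using bspec[OF bspec[OF C in_T(1)[of j]] in_T(2)[of j]] by simp
    qed
    have "(\<lambda>j. C * \<bar>v j - t\<bar> powr \<alpha>) \<longlonglongrightarrow> C * 0 powr \<alpha>"
      using v(1) F1(2) by (intro tendsto_mult tendsto_const tendsto_powr' tendsto_rabs_zero LIM_zero) auto
    then show "(\<lambda>j. C * \<bar>v j - t\<bar> powr \<alpha>) \<longlonglongrightarrow> 0" by simp
  qed
  ultimately have diff: "(\<lambda>j. F j (r, v j, \<rho> j) - F1 (r, t, \<rho> j)) \<longlonglongrightarrow> 0"
    using tendsto_add by fastforce
  \<comment> \<open>\<open>v j\<close> itself may tend to 0, so its power -\<beta> is written as a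
    power of v^(p-1), whose limit \<open>\<omega>\<close> is positive, with the convergent exponent
    -\<beta>/(p-1).\<close>
  have "(\<lambda>j. (v j powr (p j - 1)) powr (- (\<beta> j / (p j - 1)))) \<longlonglongrightarrow> \<omega> powr (- c)"
    using \<omega> by (intro tendsto_powr tendsto_minus \<beta>) auto
  moreover have "(v j powr (p j - 1)) powr (- (\<beta> j / (p j - 1))) = v j powr (- \<beta> j)" for j
    using p[of j] by (simp add: powr_powr)
  ultimately have s: "(\<lambda>j. v j powr (- \<beta> j)) \<longlonglongrightarrow> \<omega> powr (- c)" by simp
  have "continuous_on T F1"
    by (rule continuous_on_subset[OF hoelder_loc_on_imp_continuous_on[OF F1(1) _ F1(2)] T_sub])
      (intro closed_Times closed_atLeast)
  then have "compact (F1 ` T)" using T by (rule compact_continuous_image)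
  then obtain D where D: "\<forall>y\<in>F1 ` T. norm y \<le> D" using compact_imp_bounded bounded_iff by meson
  have "(\<lambda>j. F1 (r, t, \<rho> j) * (v j powr (- \<beta> j) - \<omega> powr (- c))) \<longlonglongrightarrow> 0"
  proof (rule Lim_null_comparison)
    show "\<forall>\<^sub>F j in sequentially. norm (F1 (r, t, \<rho> j) * (v j powr (- \<beta> j) - \<omega> powr (- c)))
        \<le> D * \<bar>v j powr (- \<beta> j) - \<omega> powr (- c)\<bar>"
      using D in_T(2) by (intro always_eventually allI) (auto simp: abs_mult intro!: mult_right_mono)
    have "(\<lambda>j. D * \<bar>v j powr (- \<beta> j) - \<omega> powr (- c)\<bar>) \<longlonglongrightarrow> D * 0"
      using s by (intro tendsto_mult tendsto_const tendsto_rabs_zero LIM_zero)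
    then show "(\<lambda>j. D * \<bar>v j powr (- \<beta> j) - \<omega> powr (- c)\<bar>) \<longlonglongrightarrow> 0" by simp
  qed
  \<comment> \<open>With \<open>F1\<close> taken at \<open>(r, t, \<rho> j)\<close>, the split is F
    j - F1 times the power of \<open>v j\<close>, plus \<open>F1\<close> times the difference of the
    two powers.\<close>
  from tendsto_add[OF tendsto_mult[OF diff s] this]
  show ?thesis by (simp add: algebra_simps)
qed

section \<open>Functions with bounded weak gradient\<close>

lemma grad_eq_0_outside:
  assumes "closed K" "\<And>y. y \<notin> K \<Longrightarrow> \<zeta> y = 0" "x \<notin> K"
  shows "grad \<zeta> x = 0"
proof (rule grad_eq)
  have "((\<lambda>_. 0) has_derivative (\<lambda>h. h \<bullet> 0)) (at x)" by simp
  then show "GDERIV \<zeta> x :> 0"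
    unfolding gderiv_def
    by (rule has_derivative_transform_within_open[of _ _ _ _ "- K"]) (use assms in auto)
qed

lemma Ck_continuous_on_grad:
  assumes "Ck (Suc 0) \<zeta>"
  shows "continuous_on UNIV \<zeta>" "continuous_on UNIV (grad \<zeta>)"
proof -
  show "continuous_on UNIV \<zeta>"
    using assms by (simp add: differentiable_imp_continuous_within continuous_at_imp_continuous_on)
  show "continuous_on UNIV (grad \<zeta>)"
    using assms by (subst continuous_on_componentwise) simp
qed

lemma integrable_scaleR_compact_support:
  fixes f :: "'a::euclidean_space \<Rightarrow> 'b::euclidean_space" and h :: "'a \<Rightarrow> real"
  assumes f: "L1_loc UNIV f" and h: "continuous_on UNIV h" and K: "compact K" "\<And>x. x \<notin> K \<Longrightarrow> h x = 0"
  shows "integrable lebesgue (\<lambda>x. h x *\<^sub>R f x)"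
proof -
  have fK: "integrable lebesgue (\<lambda>x. indicator K x *\<^sub>R f x)"
    using f K(1) by (simp add: L1_loc_def set_integrable_def)
  have "compact (h ` K)" using K(1) h by (intro compact_continuous_image continuous_on_subset[OF h]) auto
  then obtain D where D: "\<forall>y\<in>h ` K. norm y \<le> D" using compact_imp_bounded bounded_iff by meson
  have "h \<in> borel_measurable lebesgue"
    using borel_measurable_continuous_onI[OF h] by (simp add: measurable_completion)
  then have "(\<lambda>x. h x *\<^sub>R (indicator K x *\<^sub>R f x)) \<in> borel_measurable lebesgue"
    using borel_measurable_integrable[OF fK] by (rule borel_measurable_scaleR)
  moreover have "h x *\<^sub>R (indicator K x *\<^sub>R f x) = h x *\<^sub>R f x" for x
    using K(2)[of x] by (cases "x \<in> K") simp_all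
  ultimately have meas: "(\<lambda>x. h x *\<^sub>R f x) \<in> borel_measurable lebesgue" by (simp only:)
  have int: "integrable lebesgue (\<lambda>x. D *\<^sub>R (indicator K x *\<^sub>R f x))"
    by (rule integrable_scaleR_right) (rule fK)
  have "norm (h x *\<^sub>R f x) \<le> norm (D *\<^sub>R (indicator K x *\<^sub>R f x))" for x
  proof (cases "x \<in> K")
    case True
    then have "\<bar>h x\<bar> \<le> \<bar>D\<bar>" using D by force
    then show ?thesis using True by (simp add: mult_right_mono)
  qed (simp add: K(2))
  then show ?thesis
    by (intro Bochner_Integration.integrable_bound[OF int meas] AE_I2)
qed

text \<open>Integration by parts, component by component, turns the quantity under the supremum into
  the integral of the inner product of \<open>\<psi>\<close> and \<open>Du\<close>, which is at most
  |C| times the measure of \<open>U\<close>.\<close>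

lemma BV_loc_weak_grad:
  fixes u :: "'a::euclidean_space \<Rightarrow> real"
  assumes weak: "weak_grad_on UNIV u Du" and bound: "AE x in lebesgue. norm (Du x) \<le> C"
  shows "BV_loc u"
  unfolding BV_loc_def
proof (intro conjI allI impI)
  have u: "L1_loc UNIV u" and Du: "L1_loc UNIV Du" using weak by (simp_all add: weak_grad_on_def)
  show "L1_loc UNIV u" by (rule u)
  fix U :: "'a set" assume U: "open U \<and> bounded U"
  have U_lm: "U \<in> lmeasurable" using U by (simp add: lmeasurable_open)
  \<comment> \<open>The absolute value spares a proof that \<open>C\<close> is nonnegative.\<close>
  have "variation u U \<le> ennreal (\<bar>C\<bar> * measure lebesgue U)"
    unfolding variation_def
  proof (rule SUP_least)
    fix \<psi> :: "'a \<Rightarrow> 'a"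
    assume "\<psi> \<in> {\<psi>. (\<forall>b\<in>Basis. test_function U (\<lambda>x. \<psi> x \<bullet> b)) \<and> (\<forall>x. norm (\<psi> x) \<le> 1)}"
    then have \<psi>: "(\<forall>b\<in>Basis. test_function U (\<lambda>x. \<psi> x \<bullet> b)) \<and> (\<forall>x. norm (\<psi> x) \<le> 1)"
      by (rule CollectD)
    have test: "test_function U (\<lambda>x. \<psi> x \<bullet> b)" if "b \<in> Basis" for b
      by (rule bspec[OF conjunct1[OF \<psi>] that])
    have \<psi>_le: "norm (\<psi> x) \<le> 1" for x by (rule spec[OF conjunct2[OF \<psi>]])
    define \<zeta> where "\<zeta> b x = \<psi> x \<bullet> b" for b x
    define K where "K b = closure {x. \<zeta> b x \<noteq> 0}" for b
    have K: "compact (K b)" "K b \<subseteq> U" "Ck (Suc 0) (\<zeta> b)" if "b \<in> Basis" for b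
      using test[OF that] unfolding test_function_def K_def \<zeta>_def[abs_def] by simp_all
    have K0: "\<zeta> b x = 0" if "x \<notin> K b" for b x
    proof (rule ccontr)
      assume "\<zeta> b x \<noteq> 0"
      then have "x \<in> K b" unfolding K_def by (intro subsetD[OF closure_subset] CollectI)
      with that show False by (rule notE)
    qed
    have grad0: "grad (\<zeta> b) x = 0" if "x \<notin> K b" for b x
      by (rule grad_eq_0_outside[of "K b"]) (simp add: K_def, rule K0, assumption, rule that)
    have int1: "integrable lebesgue (\<lambda>x. (grad (\<zeta> b) x \<bullet> b) *\<^sub>R u x)" if "b \<in> Basis" for b
      by (rule integrable_scaleR_compact_support[OF u _ K(1)[OF that]])
        (intro continuous_on_inner continuous_on_const Ck_continuous_on_grad(2)[OF K(3)[OF that]],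
          simp add: grad0)
    \<comment> \<open>\<open>weak_grad_on\<close> equates vector integrals, so the whole field must
      be integrable before its component along \<open>b\<close>, the one that enters the divergence,
      can be extracted.\<close>
    have int1v: "integrable lebesgue (\<lambda>x. u x *\<^sub>R grad (\<zeta> b) x)" if "b \<in> Basis" for b
    proof -
      have "integrable lebesgue (\<lambda>x. \<Sum>i\<in>Basis. ((grad (\<zeta> b) x \<bullet> i) *\<^sub>R u x) *\<^sub>R i)"
      proof (intro Bochner_Integration.integrable_sum integrable_scaleR_left)
        fix i :: 'a
        show "integrable lebesgue (\<lambda>x. (grad (\<zeta> b) x \<bullet> i) *\<^sub>R u x)"
          by (rule integrable_scaleR_compact_support[OF u _ K(1)[OF that]])
            (intro continuous_on_inner continuous_on_const Ck_continuous_on_grad(2)[OF K(3)[OF that]],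
              simp add: grad0)
      qed
      moreover have "(\<Sum>i\<in>Basis. ((grad (\<zeta> b) x \<bullet> i) *\<^sub>R u x) *\<^sub>R i) = u x *\<^sub>R grad (\<zeta> b) x" for x
      proof -
        have "(\<Sum>i\<in>Basis. ((grad (\<zeta> b) x \<bullet> i) *\<^sub>R u x) *\<^sub>R i)
            = (\<Sum>i\<in>Basis. u x *\<^sub>R ((grad (\<zeta> b) x \<bullet> i) *\<^sub>R i))"
          by (intro sum.cong) simp_all
        then show ?thesis by (simp only: scaleR_sum_right[symmetric] euclidean_representation)
      qed
      ultimately show ?thesis by (simp only:)
    qed
    have int2: "integrable lebesgue (\<lambda>x. \<zeta> b x *\<^sub>R Du x)" if "b \<in> Basis" for b
      by (rule integrable_scaleR_compact_support[OF Du Ck_continuous_on_grad(1)[OF K(3)[OF that]]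
            K(1)[OF that] K0])
    have parts: "(LINT x|lebesgue. u x *\<^sub>R grad (\<zeta> b) x) = - (LINT x|lebesgue. \<zeta> b x *\<^sub>R Du x)"
      if "b \<in> Basis" for b
    proof -
      have "test_function UNIV (\<zeta> b)"
        using test[OF that] by (simp add: test_function_def \<zeta>_def[abs_def])
      then show ?thesis using weak by (simp add: weak_grad_on_def set_lebesgue_integral_def)
    qed
    have "(LINT x|lebesgue. u x * divg \<psi> x) = (LINT x|lebesgue. (\<Sum>b\<in>Basis. (u x *\<^sub>R grad (\<zeta> b) x) \<bullet> b))"
      by (simp add: divg_def \<zeta>_def[abs_def] sum_distrib_left)
    also have "\<dots> = (\<Sum>b\<in>Basis. (LINT x|lebesgue. (u x *\<^sub>R grad (\<zeta> b) x) \<bullet> b))"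
      by (rule Bochner_Integration.integral_sum) (rule integrable_inner_left, rule int1v)
    also have "\<dots> = (\<Sum>b\<in>Basis. (LINT x|lebesgue. u x *\<^sub>R grad (\<zeta> b) x) \<bullet> b)"
      by (rule sum.cong[OF refl]) (rule integral_inner_left, rule int1v)
    also have "\<dots> = (\<Sum>b\<in>Basis. - ((LINT x|lebesgue. \<zeta> b x *\<^sub>R Du x) \<bullet> b))"
      by (rule sum.cong[OF refl]) (simp only: parts inner_minus_left)
    also have "\<dots> = - (\<Sum>b\<in>Basis. (LINT x|lebesgue. (\<zeta> b x *\<^sub>R Du x) \<bullet> b))"
      by (simp only: sum_negf integral_inner_left[OF int2] cong: sum.cong)
    also have "\<dots> = - (LINT x|lebesgue. (\<Sum>b\<in>Basis. (\<zeta> b x *\<^sub>R Du x) \<bullet> b))"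
      by (subst Bochner_Integration.integral_sum) (simp_all add: integrable_inner_left int2 del: inner_scaleR_left)
    also have "(\<lambda>x. \<Sum>b\<in>Basis. (\<zeta> b x *\<^sub>R Du x) \<bullet> b) = (\<lambda>x. \<psi> x \<bullet> Du x)"
      by (rule ext) (simp add: \<zeta>_def euclidean_inner[symmetric])
    finally have eq: "- (LINT x|lebesgue. u x * divg \<psi> x) = (LINT x|lebesgue. \<psi> x \<bullet> Du x)" by simp
    have "(LINT x|lebesgue. \<psi> x \<bullet> Du x) \<le> (LINT x|lebesgue. \<bar>C\<bar> * indicator U x)"
    proof (rule integral_mono_AE)
      have "integrable lebesgue (\<lambda>x. \<Sum>b\<in>Basis. (\<zeta> b x *\<^sub>R Du x) \<bullet> b)"
        by (intro Bochner_Integration.integrable_sum integrable_inner_left int2)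
      then show "integrable lebesgue (\<lambda>x. \<psi> x \<bullet> Du x)"
        by (simp add: \<zeta>_def euclidean_inner[symmetric])
      show "integrable lebesgue (\<lambda>x. \<bar>C\<bar> * indicator U x)"
        by (rule integrable_mult_right) (use U_lm in \<open>simp only: lmeasurable_iff_integrable\<close>)
      show "AE x in lebesgue. \<psi> x \<bullet> Du x \<le> \<bar>C\<bar> * indicator U x"
        using bound
      proof eventually_elim
        case (elim x)
        show ?case
        proof (cases "x \<in> U")
          case True
          have "\<psi> x \<bullet> Du x \<le> norm (\<psi> x) * norm (Du x)" by (rule norm_cauchy_schwarz)
          also have "\<dots> \<le> 1 * \<bar>C\<bar>" using \<psi>_le elim by (intro mult_mono) auto
          finally show ?thesis using True by simp
        next
          case False
          then have "\<psi> x \<bullet> b = 0" if "b \<in> Basis" for b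
          proof -
            have "x \<notin> K b" using K(2)[OF that] \<open>x \<notin> U\<close> by (rule contra_subsetD)
            then show ?thesis using K0[of x b] by (simp add: \<zeta>_def)
          qed
          then have "\<forall>b\<in>Basis. \<psi> x \<bullet> b = 0" by (rule ballI)
          then have "\<psi> x = 0" by (simp only: euclidean_all_zero_iff)
          then show ?thesis by simp
        qed
      qed
    qed
    then show "ennreal (- (LINT x|lebesgue. u x * divg \<psi> x)) \<le> ennreal (\<bar>C\<bar> * measure lebesgue U)"
      using U_lm eq by (intro ennreal_leI) (simp add: fmeasurable_def)
  qed
  then show "variation u U < \<infinity>" by (rule order.strict_trans1) simp
qed

section \<open>Weak-star limits of the radial solutions\<close>

lemma weak_star_cong:
  assumes w: "weak_star M f g" and f: "\<And>j x. x \<in> space M \<Longrightarrow> f j x = f' j x"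
    and g: "AE x in M. g x = g' x" "g' \<in> borel_measurable M"
  shows "weak_star M f' g'"
proof -
  obtain B where B: "ess_bounded M B g" "\<And>j. ess_bounded M B (f j)"
    using w by (auto simp: weak_star_def)
  have "ess_bounded M B (f' j)" for j
    using B(2)[of j] f[of _ j] by (simp add: ess_bounded_def cong: measurable_cong AE_cong_simp)
  moreover have "ess_bounded M B g'"
    unfolding ess_bounded_def
  proof (rule conjI[OF g(2)])
    have "AE x in M. \<bar>g x\<bar> \<le> B" using B(1) by (simp add: ess_bounded_def)
    with g(1) show "AE x in M. \<bar>g' x\<bar> \<le> B" by eventually_elim simp
  qed
  ultimately have "\<exists>B. ess_bounded M B g' \<and> (\<forall>j. ess_bounded M B (f' j))"
    by (intro exI[of _ B]) simp
  moreover have "(\<lambda>j. LINT x|M. f' j x * \<psi> x) \<longlonglongrightarrow> (LINT x|M. g' x * \<psi> x)" if \<psi>: "integrable M \<psi>" for \<psi>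
  proof -
    have "(LINT x|M. f' j x * \<psi> x) = (LINT x|M. f j x * \<psi> x)" for j
      by (rule Bochner_Integration.integral_cong) (simp_all add: f)
    moreover have "(LINT x|M. g' x * \<psi> x) = (LINT x|M. g x * \<psi> x)"
    proof (rule integral_cong_AE)
      show "(\<lambda>x. g' x * \<psi> x) \<in> borel_measurable M" "(\<lambda>x. g x * \<psi> x) \<in> borel_measurable M"
        using g(2) B(1) \<psi> by (simp_all add: ess_bounded_def borel_measurable_times)
      show "AE x in M. g' x * \<psi> x = g x * \<psi> x" using g(1) by eventually_elim simp
    qed
    ultimately show ?thesis using w \<psi> by (simp add: weak_star_def)
  qed
  ultimately show ?thesis by (simp add: weak_star_def)
qed

text \<open>The gradients of the \<open>us j\<close> have two weak limits: \<open>Du\<close> by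
  hypothesis, and the radial field coming from the half line, where x/|x| acts as a bounded
  coefficient. The two are compared on measurable subsets of the annulus, one component at a
  time.\<close>

lemma AE_eq_radial_weak_star_grad:
  fixes Du :: "'a::euclidean_space \<Rightarrow> 'a" and us :: "nat \<Rightarrow> 'a \<Rightarrow> real"
  assumes a: "0 < a" and us: "\<And>j x. us j x = vs j (norm x)"
    and deriv: "\<And>j r. 0 < r \<Longrightarrow> (vs j has_real_derivative vs' j r) (at r)"
    and w: "weak_star (lebesgue_on {a..b}) vs' v'"
    and Du: "weak_star_Linf_loc (\<lambda>j. grad (us j)) Du"
    and Du_meas: "Du \<in> borel_measurable lebesgue" and Du_le: "AE x in lebesgue. norm (Du x) \<le> C"
  shows "AE x in lebesgue_on {x. a \<le> norm x \<and> norm x \<le> b}. Du x = (v' (norm x) / norm x) *\<^sub>R x"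
proof -
  define S :: "'a set" where "S = {x. a \<le> norm x \<and> norm x \<le> b}"
  have S: "S \<in> lmeasurable" unfolding S_def by (rule annulus_lmeasurable)
  then have S_sets: "S \<in> sets lebesgue" by (rule fmeasurableD)
  have fin: "finite_measure (lebesgue_on S)" using S by (rule finite_measure_lebesgue_on)
  have wS: "weak_star (lebesgue_on S) (\<lambda>j x. vs' j (norm x)) (\<lambda>x. v' (norm x))"
    unfolding S_def by (rule weak_star_norm[OF w])
  have comp: "AE x in lebesgue_on S. Du x \<bullet> i = (x \<bullet> i / norm x) * v' (norm x)" if i: "i \<in> Basis" for i
  proof (rule density_unique_real)
    let ?c = "\<lambda>x. x \<bullet> i / norm x"
    have "ess_bounded (lebesgue_on S) 1 ?c"
      unfolding ess_bounded_def
    proof (intro conjI AE_I2)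
      have "?c \<in> borel_measurable borel" by measurable
      then show "?c \<in> borel_measurable (lebesgue_on S)"
        by (intro measurable_restrict_space1 measurable_completion) simp
      show "\<bar>?c x\<bar> \<le> 1" for x
        using Basis_le_norm[OF i, of x] by (simp add: abs_divide divide_le_eq_1)
    qed
    with wS have cw: "weak_star (lebesgue_on S) (\<lambda>j x. ?c x * vs' j (norm x)) (\<lambda>x. ?c x * v' (norm x))"
      by (rule weak_star_mult)
    then show "integrable (lebesgue_on S) (\<lambda>x. ?c x * v' (norm x))"
      using ess_bounded_integrable[OF _ fin] by (auto simp: weak_star_def)
    have "ess_bounded (lebesgue_on S) C (\<lambda>x. Du x \<bullet> i)"
      unfolding ess_bounded_def
    proof
      show "(\<lambda>x. Du x \<bullet> i) \<in> borel_measurable (lebesgue_on S)"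
        by (rule measurable_restrict_space1) (rule borel_measurable_inner[OF Du_meas borel_measurable_const])
      have "AE x in lebesgue. x \<in> S \<longrightarrow> \<bar>Du x \<bullet> i\<bar> \<le> C"
        using Du_le by eventually_elim (use Basis_le_norm[OF i] order_trans in blast)
      then show "AE x in lebesgue_on S. \<bar>Du x \<bullet> i\<bar> \<le> C"
        using S_sets by (simp add: AE_restrict_space_iff)
    qed
    then show "integrable (lebesgue_on S) (\<lambda>x. Du x \<bullet> i)" by (rule ess_bounded_integrable[OF _ fin])
    fix A assume A: "A \<in> sets (lebesgue_on S)"
    then have A': "A \<in> sets lebesgue" "A \<subseteq> S"
      using S_sets by (simp_all add: sets_restrict_space_iff)
    \<comment> \<open>The given convergence is formulated on bounded open sets, while the annulus is
      closed; hence a larger open ball.\<close>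
    define U where "U = (ball 0 (b + 1) :: 'a set)"
    have AU: "A \<subseteq> U" using A'(2) by (auto simp: S_def U_def)
    have A_lm: "A \<in> lmeasurable" by (rule fmeasurableI2[OF S A'(2,1)])
    have to_S: "(LINT x:U|lebesgue. h x \<bullet> (indicator A x *\<^sub>R i)) = (LINT x|lebesgue_on S. (h x \<bullet> i) * indicator A x)" for h
    proof -
      have "(LINT x|lebesgue_on S. (h x \<bullet> i) * indicator A x) = (LINT x|lebesgue. (h x \<bullet> i) * indicator A x)"
        using A'(2) by (intro integral_lebesgue_on_eq S_sets) (auto simp: indicator_def)
      also have "\<dots> = (LINT x:U|lebesgue. h x \<bullet> (indicator A x *\<^sub>R i))"
        unfolding set_lebesgue_integral_def
        by (rule Bochner_Integration.integral_cong) (use AU in \<open>auto simp: indicator_def\<close>)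
      finally show ?thesis ..
    qed
    have "set_integrable lebesgue U (\<lambda>x. indicator A x *\<^sub>R i)"
    proof -
      have "integrable lebesgue (\<lambda>x. indicator A x *\<^sub>R i)"
        by (rule integrable_scaleR_left) (use A_lm in \<open>simp only: lmeasurable_iff_integrable\<close>)
      moreover have "indicator A x *\<^sub>R i = indicator U x *\<^sub>R indicator A x *\<^sub>R i" for x
        using AU by (auto simp: indicator_def)
      ultimately show ?thesis unfolding set_integrable_def by (simp only:)
    qed
    then have "open U \<and> bounded U \<and> set_integrable lebesgue U (\<lambda>x. indicator A x *\<^sub>R i)"
      by (simp add: U_def)
    from Du[unfolded weak_star_Linf_loc_def, THEN spec[of _ U], THEN spec, THEN mp, OF this]
    have "(\<lambda>j. LINT x:U|lebesgue. grad (us j) x \<bullet> (indicator A x *\<^sub>R i))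
        \<longlonglongrightarrow> (LINT x:U|lebesgue. Du x \<bullet> (indicator A x *\<^sub>R i))" .
    then have lim1: "(\<lambda>j. LINT x|lebesgue_on S. (grad (us j) x \<bullet> i) * indicator A x)
        \<longlonglongrightarrow> (LINT x|lebesgue_on S. (Du x \<bullet> i) * indicator A x)"
      by (simp only: to_S)
    have "grad (us j) x \<bullet> i = ?c x * vs' j (norm x)" if "x \<in> S" for j x
    proof -
      have "x \<noteq> 0" using that a by (auto simp: S_def)
      moreover have "us j = (\<lambda>x. vs j (norm x))" by (rule ext) (rule us)
      ultimately have "grad (us j) x = (vs' j (norm x) / norm x) *\<^sub>R x"
        using grad_radial[OF _ deriv] by simp
      then show ?thesis by simp
    qed
    then have "(LINT x|lebesgue_on S. (grad (us j) x \<bullet> i) * indicator A x)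
        = (LINT x|lebesgue_on S. ?c x * vs' j (norm x) * indicator A x)" for j
      by (intro Bochner_Integration.integral_cong) simp_all
    with lim1 have "(\<lambda>j. LINT x|lebesgue_on S. ?c x * vs' j (norm x) * indicator A x)
        \<longlonglongrightarrow> (LINT x|lebesgue_on S. (Du x \<bullet> i) * indicator A x)" by (simp only:)
    moreover have ind: "integrable (lebesgue_on S) (indicator A :: 'a \<Rightarrow> real)"
      using A fin by (simp add: finite_measure.emeasure_eq_measure integrable_real_indicator)
    have "(\<lambda>j. LINT x|lebesgue_on S. ?c x * vs' j (norm x) * indicator A x)
        \<longlonglongrightarrow> (LINT x|lebesgue_on S. ?c x * v' (norm x) * indicator A x)"
      by (rule cw[unfolded weak_star_def, THEN conjunct2, THEN spec, THEN mp, OF ind])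
    ultimately have "(LINT x|lebesgue_on S. (Du x \<bullet> i) * indicator A x)
        = (LINT x|lebesgue_on S. ?c x * v' (norm x) * indicator A x)" by (rule LIMSEQ_unique)
    then show "(LINT x:A|lebesgue_on S. Du x \<bullet> i) = (LINT x:A|lebesgue_on S. ?c x * v' (norm x))"
      by (simp add: set_lebesgue_integral_def mult.commute)
  qed
  have "AE x in lebesgue_on S. \<forall>i\<in>Basis. Du x \<bullet> i = (x \<bullet> i / norm x) * v' (norm x)"
    by (rule AE_finite_allI[OF finite_Basis comp])
  then show ?thesis
    unfolding S_def[symmetric]
    by eventually_elim (subst euclidean_eq_iff, simp)
qed

context
  fixes n :: nat and \<alpha> l \<xi>1 \<xi>2 :: real and p \<beta> :: "nat \<Rightarrow> real"
    and F :: "nat \<Rightarrow> real \<times> real \<times> real \<Rightarrow> real" and \<phi> :: "nat \<Rightarrow> real \<times> real \<Rightarrow> real"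
    and F1 :: "real \<times> real \<times> real \<Rightarrow> real" and v :: "nat \<Rightarrow> real \<Rightarrow> real"
  assumes n: "2 \<le> n" and params: "0 < \<alpha>" "0 < l" "0 < \<xi>1"
    and p: "\<And>j. 1 < p j" "\<And>j. p j < 2" "\<And>j. p j \<le> real n"
    and adm: "\<And>j. admissible n \<alpha> l \<xi>1 \<xi>2 (p j) (F j) (\<phi> j) (\<beta> j)"
    and sol: "\<And>j. radial_solution n l \<xi>1 \<xi>2 (p j) (F j) (\<beta> j) (v j)"
    and F_lim: "locally_uniform_on ({0..} \<times> {0..} \<times> {0..}) F F1 sequentially"
    and F1: "hoelder_loc_on \<alpha> ({0..} \<times> {0..} \<times> {0..}) F1"
begin

lemmas bounds = solution_bounds[OF n params p(1,2) adm sol]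
lemmas cont_reaction = continuous_on_reaction[OF n params p(1,2) adm sol]

text \<open>For large \<open>j\<close>, \<open>F j\<close> is within 1 of \<open>F1\<close> on a
  compact set, and \<open>solution_powr_le\<close> bounds the singular factor independently of
  \<open>j\<close>. For each remaining index the reaction is continuous on a compact
  interval.\<close>

lemma reaction_uniformly_bounded:
  obtains B where "\<And>j r. r \<in> {0..R} \<Longrightarrow> \<bar>reaction (F j) (\<beta> j) (v j) r\<bar> \<le> B"
proof -
  define T where "T = {0..R} \<times> {0..\<xi>1} \<times> {0..\<xi>2}"
  have T: "compact T" unfolding T_def by (intro compact_Times) auto
  have T_sub: "T \<subseteq> {0..} \<times> {0..} \<times> {0..}" unfolding T_def by (intro Sigma_mono) auto
  have "continuous_on T F1"
    by (rule continuous_on_subset[OF hoelder_loc_on_imp_continuous_on[OF F1 _ params(1)] T_sub])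
      (intro closed_Times closed_atLeast)
  then have "compact (F1 ` T)" using T by (rule compact_continuous_image)
  then obtain D where D: "\<forall>y\<in>F1 ` T. norm y \<le> D" using compact_imp_bounded bounded_iff by meson
  define M where "M = max 1 \<xi>1 * max 1 (max l R) powr real n"
  have ev: "\<forall>\<^sub>F j in sequentially. \<forall>r\<in>{0..R}. \<bar>reaction (F j) (\<beta> j) (v j) r\<bar> \<le> (D + 1) * M"
  proof -
    have "uniform_limit T F F1 sequentially"
      using F_lim T T_sub by (simp add: locally_uniform_on_def)
    from uniform_limitD[OF this zero_less_one] show ?thesis
    proof eventually_elim
      case (elim j)
      show ?case
      proof
        fix r assume r: "r \<in> {0..R}"
        then have r0: "0 \<le> r" by simp
        have in_T: "(r, v j r, \<bar>hderiv (v j) r\<bar>) \<in> T"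
          using r bounds(2-4)[OF r0, of j] by (simp add: T_def)
        have "\<bar>F1 (r, v j r, \<bar>hderiv (v j) r\<bar>)\<bar> \<le> D" using D in_T by auto
        moreover have "\<bar>F j (r, v j r, \<bar>hderiv (v j) r\<bar>) - F1 (r, v j r, \<bar>hderiv (v j) r\<bar>)\<bar> < 1"
          using bspec[OF elim in_T] by (simp add: dist_real_def)
        ultimately have "\<bar>F j (r, v j r, \<bar>hderiv (v j) r\<bar>)\<bar> \<le> D + 1" by linarith
        moreover have "v j r powr (- \<beta> j) \<le> M"
        proof -
          have "v j r powr (- \<beta> j) \<le> max 1 \<xi>1 * max 1 (max l r) powr real n"
            by (rule solution_powr_le[OF n params p(1,2) adm sol r0 p(3)])
          also have "\<dots> \<le> M"
            unfolding M_def using r by (intro mult_left_mono powr_mono2) auto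
          finally show ?thesis .
        qed
        ultimately show "\<bar>reaction (F j) (\<beta> j) (v j) r\<bar> \<le> (D + 1) * M"
          unfolding reaction_def abs_mult by (intro mult_mono) auto
      qed
    qed
  qed
  have each: "\<exists>C. \<forall>r\<in>{0..R}. \<bar>reaction (F j) (\<beta> j) (v j) r\<bar> \<le> C" for j
  proof -
    have "continuous_on {0..R} (reaction (F j) (\<beta> j) (v j))"
      by (rule continuous_on_subset[OF cont_reaction]) auto
    then have "compact (reaction (F j) (\<beta> j) (v j) ` {0..R})"
      by (rule compact_continuous_image) simp
    then obtain C where "\<forall>y\<in>reaction (F j) (\<beta> j) (v j) ` {0..R}. norm y \<le> C"
      using compact_imp_bounded bounded_iff by meson
    then show ?thesis by auto
  qed
  show thesis by (rule uniformly_bounded_of_eventually[OF each ev that])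
qed

lemma solution_deriv: "0 < r \<Longrightarrow> (v j has_real_derivative hderiv (v j) r) (at r)"
  using sol[of j] by (intro radial_solution_deriv_at) (simp_all add: radial_solution_def)

lemma weak_star_hderiv:
  assumes "0 < a" "uniform_limit {a..b} v V sequentially" "weak_grad_on {0<..} V V'"
  shows "weak_star (lebesgue_on {a..b}) (\<lambda>j. hderiv (v j)) V'"
proof (rule weak_star_weak_grad[OF assms(3) _ _ _ _ _ assms(2)])
  show "{a..b} \<subseteq> {0<..}" using assms(1) by auto
  show "{0::real<..} \<in> sets lebesgue" by (rule sets_completionI_sets) simp
  show "(v j has_real_derivative hderiv (v j) r) (at r)" if "r \<in> {a..b}" for j r
    by (rule solution_deriv) (use that assms(1) in simp)
  show "continuous_on {a..b} (hderiv (v j))" for j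
    using sol[of j] assms(1)
    by (auto simp: radial_solution_def C1_half_line_def elim!: continuous_on_subset)
  show "\<bar>hderiv (v j) r\<bar> \<le> \<xi>2" if "r \<in> {a..b}" for j r
    by (rule bounds(4)) (use that assms(1) in simp)
qed

text \<open>In K = G' + (n-1)/r G the derivative converges weakly and the other term uniformly on
  [a,b], as a > 0. The interval (0, b+1) is an open domain of the weak derivative with room around
  [a,b].\<close>

lemma weak_star_reaction:
  assumes ab: "0 < a" "a < b"
    and lim: "uniform_limit {a..b} (\<lambda>j. radial_flux n (reaction (F j) (\<beta> j) (v j))) G sequentially"
    and weak: "weak_grad_on {0<..<b + 1} G G'"
    and K: "K \<in> borel_measurable (lebesgue_on {a..b})"
      "AE r in lebesgue. 0 < r \<longrightarrow> K r = G' r + (real n - 1) / r * G r"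
  shows "weak_star (lebesgue_on {a..b}) (\<lambda>j. reaction (F j) (\<beta> j) (v j)) K"
proof -
  let ?K = "\<lambda>j. reaction (F j) (\<beta> j) (v j)"
  let ?G = "\<lambda>j. radial_flux n (?K j)"
  let ?m = "\<lambda>r. (real n - 1) / r"
  have sub: "{a..b} \<subseteq> {0..}" "{a..b} \<subseteq> {0<..<b + 1}" using ab by auto
  have deriv: "(?G j has_real_derivative ?K j r - ?m r * ?G j r) (at r)" if "r \<in> {a..b}" for j r
    by (rule radial_flux_has_derivative[OF cont_reaction _ n]) (use that ab in simp)
  have G_cont: "continuous_on {a..b} (?G j)" for j
    by (rule DERIV_continuous_on[OF has_field_derivative_at_within[OF deriv]])
  have m_cont: "continuous_on {a..b} ?m" by (intro continuous_intros) (use ab in auto)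
  have G_lim_cont: "continuous_on {a..b} G"
    by (rule uniform_limit_theorem[OF _ lim]) (simp_all add: G_cont)
  have cont_bdd: "\<exists>C. \<forall>r\<in>{a..b}. \<bar>h r\<bar> \<le> C" if "continuous_on {a..b} h" for h :: "real \<Rightarrow> real"
  proof -
    have "compact (h ` {a..b})" using that by (rule compact_continuous_image) simp
    then obtain C where "\<forall>y\<in>h ` {a..b}. norm y \<le> C" using compact_imp_bounded bounded_iff by meson
    then show ?thesis by auto
  qed
  obtain D where D: "\<forall>r\<in>{a..b}. \<bar>G r\<bar> \<le> D" using cont_bdd[OF G_lim_cont] ..
  have ev: "\<forall>\<^sub>F j in sequentially. \<forall>r\<in>{a..b}. \<bar>?G j r\<bar> \<le> D + 1"
    using uniform_limitD[OF lim zero_less_one]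
  proof eventually_elim
    case (elim j)
    show ?case
    proof
      fix r assume r: "r \<in> {a..b}"
      show "\<bar>?G j r\<bar> \<le> D + 1" using bspec[OF elim r] bspec[OF D r] by (simp add: dist_real_def)
    qed
  qed
  obtain D' where D': "\<And>j r. r \<in> {a..b} \<Longrightarrow> \<bar>?G j r\<bar> \<le> D'"
  proof (rule uniformly_bounded_of_eventually[OF cont_bdd[OF G_cont] ev])
  qed (rule that)
  obtain B where B: "\<And>j r. r \<in> {0..b} \<Longrightarrow> \<bar>?K j r\<bar> \<le> B"
  proof (rule reaction_uniformly_bounded[where R = b])
  qed (rule that)
  obtain Mm where Mm: "\<forall>r\<in>{a..b}. \<bar>?m r\<bar> \<le> Mm" using cont_bdd[OF m_cont] ..
  have mG_bdd: "\<bar>?m r * ?G j r\<bar> \<le> Mm * D'" if "r \<in> {a..b}" for j r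
  proof -
    have "\<bar>?m r\<bar> * \<bar>?G j r\<bar> \<le> Mm * D'"
      using order_trans[OF abs_ge_zero bspec[OF Mm that]]
      by (intro mult_mono bspec[OF Mm that] D'[OF that] abs_ge_zero)
    then show ?thesis by (simp only: abs_mult)
  qed
  have X: "weak_star (lebesgue_on {a..b}) (\<lambda>j r. ?K j r - ?m r * ?G j r) G'"
  proof (rule weak_star_weak_grad[OF weak sub(2) _ deriv _ _ lim])
    show "continuous_on {a..b} (\<lambda>r. ?K j r - ?m r * ?G j r)" for j
      by (intro continuous_on_diff continuous_on_mult m_cont G_cont continuous_on_subset[OF cont_reaction sub(1)])
    show "\<bar>?K j r - ?m r * ?G j r\<bar> \<le> B + Mm * D'" if "r \<in> {a..b}" for j r
    proof -
      have "\<bar>?K j r\<bar> \<le> B" using that ab by (intro B) simp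
      with mG_bdd[OF that, of j] show ?thesis by linarith
    qed
  qed simp_all
  \<comment> \<open>The sum is read as a difference from the negated term, so that
    \<open>weak_star_diff\<close> combines both limits.\<close>
  have Y: "weak_star (lebesgue_on {a..b}) (\<lambda>j r. - (?m r * ?G j r)) (\<lambda>r. - (?m r * G r))"
  proof (rule weak_starI_pointwise)
    show "ess_bounded (lebesgue_on {a..b}) (Mm * D') (\<lambda>r. - (?m r * ?G j r))" for j
      unfolding ess_bounded_def
    proof
      show "(\<lambda>r. - (?m r * ?G j r)) \<in> borel_measurable (lebesgue_on {a..b})"
        by (rule borel_measurable_integrable, rule integrable_lebesgue_on_Icc)
          (intro continuous_on_minus continuous_on_mult m_cont G_cont)
      show "AE r in lebesgue_on {a..b}. \<bar>- (?m r * ?G j r)\<bar> \<le> Mm * D'"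
        using mG_bdd by (intro AE_I2) (simp add: abs_minus_cancel)
    qed
    show "(\<lambda>r. - (?m r * G r)) \<in> borel_measurable (lebesgue_on {a..b})"
      by (rule borel_measurable_integrable, rule integrable_lebesgue_on_Icc)
        (intro continuous_on_minus continuous_on_mult m_cont G_lim_cont)
    show "AE r in lebesgue_on {a..b}. (\<lambda>j. - (?m r * ?G j r)) \<longlonglongrightarrow> - (?m r * G r)"
    proof (rule AE_I2)
      fix r assume "r \<in> space (lebesgue_on {a..b})"
      then have "(\<lambda>j. ?G j r) \<longlonglongrightarrow> G r" by (intro tendsto_uniform_limitI[OF lim]) simp
      then show "(\<lambda>j. - (?m r * ?G j r)) \<longlonglongrightarrow> - (?m r * G r)"
        by (intro tendsto_minus tendsto_mult tendsto_const)
    qed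
  qed
  show ?thesis
  proof (rule weak_star_cong[OF weak_star_diff[OF X Y] _ _ K(1)])
    show "AE r in lebesgue_on {a..b}. G' r - - (?m r * G r) = K r"
      using K(2) ab by (subst AE_restrict_space_iff) (auto elim!: eventually_mono)
  qed simp
qed

end

section \<open>The limit equation\<close>

theorem theorem1p2:
  fixes n :: nat
    and \<alpha> l \<xi>1 \<xi>2 c :: real
    and F :: "real \<Rightarrow> real \<times> real \<times> real \<Rightarrow> real"
    and \<phi> :: "real \<Rightarrow> real \<times> real \<Rightarrow> real"
    and \<beta> :: "real \<Rightarrow> real"
    and F1 :: "real \<times> real \<times> real \<Rightarrow> real"
    and p :: "nat \<Rightarrow> real"
    and vs :: "real \<Rightarrow> real \<Rightarrow> real"
    and us :: "real \<Rightarrow> real ^ 'n \<Rightarrow> real"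
    and Gs :: "real \<Rightarrow> real \<Rightarrow> real"
    and u w :: "real ^ 'n \<Rightarrow> real"
    and Du z :: "real ^ 'n \<Rightarrow> real ^ 'n"
    and v v' G G' K :: "real \<Rightarrow> real"
    and C1 Cless :: "real set"
  assumes n: "n = CARD('n)" "2 \<le> n"
    and params: "0 < \<alpha>" "\<alpha> \<le> 1" "0 < l" "0 < \<xi>1" "0 < \<xi>2"
    \<comment> \<open>standing hypotheses\<close>
    and p_range: "\<And>j. 1 < p j \<and> p j < min 2 (sqrt n)"
    and p_lim: "filterlim p (at_right 1) sequentially"
    and adm: "\<And>j. admissible n \<alpha> l \<xi>1 \<xi>2 (p j) (F (p j)) (\<phi> (p j)) (\<beta> (p j))"
    and F_lim: "locally_uniform_on ({0..} \<times> {0..} \<times> {0..}) F F1 (at_right 1)"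
    and F1_hoelder: "hoelder_loc_on \<alpha> ({0..} \<times> {0..} \<times> {0..}) F1"
    and beta_lim: "((\<lambda>q. \<beta> q / (q - 1)) \<longlongrightarrow> c) (at_right 1)" "0 \<le> c" "c \<le> 1"
    \<comment> \<open>the solutions\<close>
    and sol: "\<And>j. radial_solution n l \<xi>1 \<xi>2 (p j) (F (p j)) (\<beta> (p j)) (vs (p j))"
    and us: "\<And>q x. us q x = vs q (norm x)"
    and Gs: "\<And>q r. Gs q r = radial_flux n (reaction (F q) (\<beta> q) (vs q)) r"
    \<comment> \<open>the limit \<open>u\<close>\<close>
    and u_lim: "locally_uniform_on UNIV (\<lambda>j. us (p j)) u sequentially"
    and Du_lim: "weak_star_Linf_loc (\<lambda>j. grad (us (p j))) Du"
    and u_radial: "\<And>x. u x = v (norm x)"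
    and v': "weak_grad_on {0<..} v v'"
    and u_W: "W1inf_on UNIV u Du"
    and u_bounds: "\<And>x. 0 \<le> u x \<and> u x \<le> \<xi>1"
    and Du_bound: "AE x in lebesgue. norm (Du x) \<le> \<xi>2"
    \<comment> \<open>the limit \<open>w\<close>\<close>
    and w_range: "\<And>x. 0 < w x \<and> w x \<le> 1"
    and w_radial: "\<And>x y. norm x = norm y \<Longrightarrow> w x = w y"
    and w_ae: "AE x in lebesgue. (\<lambda>j. us (p j) x powr (p j - 1)) \<longlonglongrightarrow> w x"
    and w_Lq: "\<And>q. 1 \<le> q \<Longrightarrow> tendsto_Lq_loc q (\<lambda>j x. us (p j) x powr (p j - 1)) w"
    and w_bounds: "AE x in lebesgue. max l (norm x) powr (- (real n - 1)) \<le> w x \<and> w x \<le> 1"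
    and w_one: "AE x in lebesgue. 0 < u x \<longrightarrow> w x = 1"
    \<comment> \<open>the limit \<open>G\<close>\<close>
    and G_W: "\<And>R. 0 < R \<Longrightarrow> W1inf_on {0<..<R} G G'"
    and G_lim: "locally_uniform_on {0..} (\<lambda>j. Gs (p j)) G sequentially"
    and G_bounds: "\<And>r. 0 \<le> r \<Longrightarrow> 0 \<le> G r \<and> G r \<le> 1"
    and G_zero: "G 0 = 0"
    \<comment> \<open>the limits \<open>z\<close> and \<open>K\<close>\<close>
    and z_W: "W1inf_loc_vec z"
    and z_eq: "\<And>x. x \<noteq> 0 \<Longrightarrow> z x = - (G (norm x) / norm x) *\<^sub>R x"
    and z_bound: "AE x in lebesgue. norm (z x) \<le> 1"
    and K_Linf: "\<And>R. 0 < R \<Longrightarrow> Linf_on {0<..<R} K"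
    and z_div: "weak_div z (\<lambda>x. - K (norm x))"
    and K_eq: "AE r in lebesgue. 0 < r \<longrightarrow> K r = G' r + (real n - 1) / r * G r"
    \<comment> \<open>relations between the limits\<close>
    and z_pairing: "pairing_measure z (\<lambda>x. - K (norm x)) u (TV_measure u)"
    and z_Du: "AE x in lebesgue. z x \<bullet> Du x = norm (Du x)"
    and G_v': "AE r in lebesgue. 0 < r \<longrightarrow> (1 - G r) * \<bar>v' r\<bar> = 0"
    and C1: "C1 = {r. 0 < r \<and> G r = 1}"
    and Cless: "Cless = {r. 0 < r \<and> G r < 1}"
    and K_Cless: "AE x in lebesgue. norm x \<in> Cless \<longrightarrow>
                    K (norm x) = w x powr (- c) * F1 (norm x, u x, 0)"
    and K_C1: "emeasure lebesgue C1 > 0 \<Longrightarrow>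
                 AE x :: real ^ 'n in lebesgue. norm x \<in> C1 \<longrightarrow> K (norm x) = (real n - 1) / norm x"
    and near_zero: "\<exists>r0 \<delta>. 0 < r0 \<and> 0 < \<delta> \<and> \<delta> < 1 \<and>
          (\<forall>\<^sub>F j in sequentially. \<forall>x. norm x \<le> r0 \<longrightarrow>
             norm (grad (us (p j)) x) \<le> \<delta> powr (1 / (p j - 1))) \<and>
          (\<forall>r\<in>{0..r0}. G r \<le> \<delta>) \<and>
          (AE x in lebesgue. x \<in> ball 0 r0 \<longrightarrow> Du x = 0)"
  shows "one_laplace_eq u (\<lambda>x. K (norm x))
    \<and> \<comment> \<open>(i)\<close>
    ((\<forall>r\<ge>0. \<forall>t\<in>{0..\<xi>1}. \<exists>a b. \<forall>\<rho>\<in>{0..\<xi>2}. F1 (r, t, \<rho>) = a + b * \<rho>) \<longrightarrow>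
       (AE x in lebesgue. K (norm x) = w x powr (- c) * F1 (norm x, u x, norm (Du x))))
    \<and> \<comment> \<open>(ii)\<close>
    (AE r in lebesgue. r \<in> Cless \<longrightarrow> \<bar>v' r\<bar> = 0)
    \<and> (AE x in lebesgue. norm x \<in> Cless \<longrightarrow>
         K (norm x) = w x powr (- c) * F1 (norm x, u x, norm (Du x)))
    \<and> (\<forall>E a. E \<in> sets lebesgue \<and> E \<subseteq> C1 \<and> emeasure lebesgue E > 0 \<and>
         (AE r in lebesgue. r \<in> E \<longrightarrow> (\<lambda>j. (Gs (p j) r - 1) / (p j - 1)) \<longlonglongrightarrow> a r) \<longrightarrow>
         (AE r in lebesgue. r \<in> E \<longrightarrow> \<bar>v' r\<bar> = exp (a r)) \<and>
         (AE x in lebesgue. norm x \<in> E \<longrightarrow>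
            K (norm x) = w x powr (- c) * F1 (norm x, u x, norm (Du x)) \<and>
            w x powr (- c) * F1 (norm x, u x, norm (Du x)) = (real n - 1) / norm x) \<and>
         (AE x in lebesgue. norm x \<in> Cless \<union> E \<longrightarrow>
            K (norm x) = w x powr (- c) * F1 (norm x, u x, norm (Du x))))"
proof -
  let ?D = "{0::real..} \<times> {0::real..} \<times> {0::real..}"

  \<comment> \<open>Passage to the sequence and limits on the half line\<close>
  define R where "R j = reaction (F (p j)) (\<beta> (p j)) (vs (p j))" for j
  define V where "V j = hderiv (vs (p j))" for j
  have p1: "1 < p j" and p2: "p j < 2" and pn: "p j \<le> real n" for j
  proof -
    show "1 < p j" "p j < 2" using p_range[of j] by simp_all
    have "sqrt (real n) \<le> real n"
      using n(2) by (intro real_le_lsqrt) (simp_all add: power2_eq_square)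
    then show "p j \<le> real n" using p_range[of j] by simp
  qed
  have p_tendsto: "p \<longlonglongrightarrow> 1"
    using p_lim by (rule filterlim_mono[OF _ at_within_le_nhds order_refl])
  have F_seq: "locally_uniform_on ?D (\<lambda>j. F (p j)) F1 sequentially"
    unfolding locally_uniform_on_def
  proof (intro allI impI)
    fix T assume "compact T \<and> T \<subseteq> ?D"
    then have "uniform_limit T F F1 (at_right 1)" using F_lim unfolding locally_uniform_on_def by simp
    then show "uniform_limit T (\<lambda>j. F (p j)) F1 sequentially"
      using p_lim by (rule filterlim_compose)
  qed
  have \<beta>_seq: "(\<lambda>j. \<beta> (p j) / (p j - 1)) \<longlonglongrightarrow> c"
    by (rule filterlim_compose[OF beta_lim(1) p_lim])
  note seq = n(2) params(1,3,4) p1 p2 pn adm sol F_seq F1_hoelder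
  have vs_lim: "uniform_limit {0..b} (\<lambda>j. vs (p j)) v sequentially" for b
  proof (rule uniform_limitI)
    fix e :: real assume "0 < e"
    \<comment> \<open>Any unit vector will do: along the ray it spans, uniform convergence on balls
      becomes uniform convergence of the radial profiles.\<close>
    obtain e1 :: "real ^ 'n" where e1: "norm e1 = 1" using vector_choose_size[of 1] by auto
    have "uniform_limit (cball 0 b :: (real ^ 'n) set) (\<lambda>j. us (p j)) u sequentially"
      using u_lim by (simp add: locally_uniform_on_def)
    from uniform_limitD[OF this \<open>0 < e\<close>]
    show "\<forall>\<^sub>F j in sequentially. \<forall>r\<in>{0..b}. dist (vs (p j) r) (v r) < e"
    proof eventually_elim
      case (elim j)
      show ?case
      proof
        fix r assume r: "r \<in> {0..b}"
        then have r_norm: "norm (r *\<^sub>R e1) = r" using e1 by simp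
        have "r *\<^sub>R e1 \<in> cball 0 b" unfolding mem_cball_0 r_norm using r by simp
        from bspec[OF elim this] show "dist (vs (p j) r) (v r) < e"
          by (simp only: us u_radial r_norm)
      qed
    qed
  qed
  have V_deriv: "(vs (p j) has_real_derivative V j r) (at r)" if "0 < r" for j r
    unfolding V_def using that by (rule solution_deriv[OF seq])
  have V_eq: "V j r = - (Gs (p j) r powr (1 / (p j - 1)))" if "0 < r" for j r
    unfolding V_def Gs
    by (rule hderiv_solution[OF n(2) params(1,3,4) p1 p2 adm sol that])
  have V_weak: "weak_star (lebesgue_on {a..b}) V v'" if "0 < a" for a b
    unfolding V_def
  proof (rule weak_star_hderiv[OF seq that _ v'])
    show "uniform_limit {a..b} (\<lambda>j. vs (p j)) v sequentially"
      by (rule uniform_limit_on_subset[OF vs_lim]) (use that in auto)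
  qed
  have R_weak: "weak_star (lebesgue_on {a..b}) R K" if "0 < a" "a < b" for a b
    unfolding R_def
  proof (rule weak_star_reaction[OF seq that])
    have "uniform_limit {a..b} (\<lambda>j. Gs (p j)) G sequentially"
      using G_lim that by (simp add: locally_uniform_on_def)
    then show "uniform_limit {a..b} (\<lambda>j. radial_flux n (reaction (F (p j)) (\<beta> (p j)) (vs (p j)))) G sequentially"
      by (simp only: Gs[abs_def])
    have b: "0 < b + 1" using that by simp
    show "weak_grad_on {0<..<b + 1} G G'" using G_W[OF b] by (simp add: W1inf_on_def)
    have "K \<in> borel_measurable (lebesgue_on {0<..<b + 1})" using K_Linf[OF b] by (simp add: Linf_on_def)
    then show "K \<in> borel_measurable (lebesgue_on {a..b})"
      by (rule measurable_restrict_mono) (use that in auto)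
  qed (rule K_eq)

  \<comment> \<open>Limits on annuli, the gradient of u and the asymptotic form of the
    equation\<close>
  define S :: "real \<Rightarrow> real \<Rightarrow> (real ^ 'n) set" where "S a b = {x. a \<le> norm x \<and> norm x \<le> b}" for a b
  have S_lm: "S a b \<in> lmeasurable" for a b unfolding S_def by (rule annulus_lmeasurable)
  have S_sets: "S a b \<in> sets lebesgue" for a b by (rule fmeasurableD[OF S_lm])
  have S_fin: "finite_measure (lebesgue_on (S a b))" for a b
    by (rule finite_measure_lebesgue_on[OF S_lm])
  have AE_S: "AE x in lebesgue_on (S a b). P x" if "AE x in lebesgue. P x" for P a b
    using that S_sets by (subst AE_restrict_space_iff) (auto elim: eventually_mono)
  have AE_I_S: "AE x in lebesgue. P x"
    if "\<And>a b. 0 < a \<Longrightarrow> a < b \<Longrightarrow> AE x in lebesgue_on (S a b). P x" for P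
    by (rule AE_annuli, fold S_def) (rule that)
  have V_weak_S: "weak_star (lebesgue_on (S a b)) (\<lambda>j x. V j (norm x)) (\<lambda>x. v' (norm x))"
    if "0 < a" for a b unfolding S_def by (rule weak_star_norm[OF V_weak[OF that]])
  have R_weak_S: "weak_star (lebesgue_on (S a b)) (\<lambda>j x. R j (norm x)) (\<lambda>x. K (norm x))"
    if "0 < a" "a < b" for a b unfolding S_def by (rule weak_star_norm[OF R_weak[OF that]])
  have AE_nonzero: "AE x :: real ^ 'n in lebesgue. x \<noteq> 0"
    by (simp add: AE_completion AE_lborel_singleton)
  have u_meas: "u \<in> borel_measurable lebesgue" and Du_meas: "Du \<in> borel_measurable lebesgue"
    using u_W by (simp_all add: W1inf_on_def Linf_on_def lebesgue_on_UNIV_eq)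
  have Du_eq: "AE x in lebesgue. Du x = (v' (norm x) / norm x) *\<^sub>R x"
  proof (rule AE_I_S)
    fix a b :: real assume ab: "0 < a" "a < b"
    show "AE x in lebesgue_on (S a b). Du x = (v' (norm x) / norm x) *\<^sub>R x"
      unfolding S_def
      by (rule AE_eq_radial_weak_star_grad[OF ab(1) us V_deriv V_weak[OF ab(1)] Du_lim Du_meas Du_bound])
  qed
  have norm_Du: "AE x in lebesgue. norm (Du x) = \<bar>v' (norm x)\<bar>"
    using Du_eq AE_nonzero by eventually_elim simp
  \<comment> \<open>An upper bound survives weak limits, and each \<open>V j\<close> is minus a
    power.\<close>
  have v'_nonpos: "AE r in lebesgue. 0 < r \<longrightarrow> v' r \<le> 0"
  proof (rule AE_intervals)
    fix a b :: real assume ab: "0 < a" "a < b"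
    let ?L = "lebesgue_on {a..b}"
    have fin: "finite_measure ?L" by (rule finite_measure_lebesgue_Icc)
    have w: "weak_star ?L V v'" by (rule V_weak[OF ab(1)])
    obtain B where B: "ess_bounded ?L B v'" "\<And>j. ess_bounded ?L B (V j)"
      using w unfolding weak_star_def by auto
    show "AE r in ?L. v' r \<le> 0"
    proof (rule weak_limit_le[OF fin B(2) _ ess_bounded_integrable[OF B(1) fin]])
      show "AE r in ?L. V j r \<le> 0" for j
        by (rule AE_I2) (use ab V_eq in simp)
      fix A assume "A \<in> sets ?L"
      then have ind: "integrable ?L (indicator A :: real \<Rightarrow> real)"
        using fin by (simp add: finite_measure.emeasure_eq_measure integrable_real_indicator)
      show "(\<lambda>j. LINT x|?L. V j x * indicator A x) \<longlonglongrightarrow> (LINT x|?L. v' x * indicator A x)"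
        by (rule w[unfolded weak_star_def, THEN conjunct2, THEN spec, THEN mp, OF ind])
    qed
  qed
  have R_lim: "AE x in lebesgue. (\<lambda>j. R j (norm x) - w x powr (- c) * F1 (norm x, u x, \<bar>V j (norm x)\<bar>)) \<longlonglongrightarrow> 0"
    using w_ae
  proof eventually_elim
    case (elim x)
    have "(\<lambda>j. vs (p j) (norm x)) \<longlonglongrightarrow> u x"
      unfolding u_radial by (rule tendsto_uniform_limitI[OF vs_lim[of "norm x"]]) simp
    then show ?case
      unfolding R_def reaction_def V_def
      by (rule reaction_tendsto[OF F_seq F1_hoelder params(1) p1 \<beta>_seq norm_ge_zero _
            bounds(2)[OF seq norm_ge_zero] bounds(3)[OF seq norm_ge_zero]
            elim[unfolded us] conjunct1[OF w_range] abs_ge_zero bounds(4)[OF seq norm_ge_zero]])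
  qed
  have F1_cont: "continuous_on ?D F1"
    by (rule hoelder_loc_on_imp_continuous_on[OF F1_hoelder _ params(1)]) (intro closed_Times closed_atLeast)
  have u_range: "0 \<le> u x" "u x \<le> \<xi>1" for x using u_bounds[of x] by simp_all

  \<comment> \<open>The 1-Laplace equation\<close>
  have laplace: "one_laplace_eq u (\<lambda>x. K (norm x))"
    unfolding one_laplace_eq_def
  \<comment> \<open>The divergence, the bound and the pairing of \<open>z\<close> are given; what is
    left is local boundedness, and bounded variation of \<open>u\<close>, which its bounded weak
    gradient provides.\<close>
  proof (intro conjI exI[of _ z])
    show "BV_loc u"
      by (rule BV_loc_weak_grad[OF _ Du_bound]) (use u_W in \<open>simp add: W1inf_on_def\<close>)
    show "Linf_loc u"
      unfolding Linf_loc_def Linf_on_def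
    proof (intro allI impI conjI)
      fix T :: "(real ^ 'n) set"
      show "u \<in> borel_measurable (lebesgue_on T)"
        by (rule measurable_restrict_space1[OF u_meas])
      have "AE x in lebesgue_on T. norm (u x) \<le> \<xi>1" by (rule AE_I2) (use u_range in simp)
      then show "\<exists>C. AE x in lebesgue_on T. norm (u x) \<le> C" ..
    qed
    have meas: "f \<in> borel_measurable (lebesgue_on T)"
      if "L1_loc UNIV f" "compact T" for f :: "real ^ 'n \<Rightarrow> 'b::euclidean_space" and T
    proof -
      have "integrable (lebesgue_on T) f"
        using that by (simp add: L1_loc_def set_integrable_def integrable_restrict_space lmeasurable_compact fmeasurableD)
      then show ?thesis by (rule borel_measurable_integrable)
    qed
    show "Linf_loc (\<lambda>x :: real ^ 'n. K (norm x))"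
      unfolding Linf_loc_def Linf_on_def
    proof (intro allI impI conjI)
      fix T :: "(real ^ 'n) set" assume T: "compact T"
      have "(\<lambda>x. - K (norm x)) \<in> borel_measurable (lebesgue_on T)"
        by (rule meas[OF _ T]) (use z_div in \<open>simp add: weak_div_def\<close>)
      then show "(\<lambda>x. K (norm x)) \<in> borel_measurable (lebesgue_on T)" by simp
      obtain B where B: "0 < B" "\<forall>x\<in>T. norm x \<le> B"
        using compact_imp_bounded[OF T] bounded_pos by blast
      then have "0 < B + 1" by simp
      from K_Linf[OF this] obtain C where "AE r in lebesgue_on {0<..<B + 1}. norm (K r) \<le> C"
        unfolding Linf_on_def by blast
      then have "AE r in lebesgue. r \<in> {0<..<B + 1} \<longrightarrow> norm (K r) \<le> C"
        by (simp add: AE_restrict_space_iff)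
      then have "AE x :: real ^ 'n in lebesgue. norm x \<in> {0<..<B + 1} \<longrightarrow> norm (K (norm x)) \<le> C"
        by (rule AE_norm)
      with AE_nonzero have "AE x in lebesgue. x \<in> T \<longrightarrow> norm (K (norm x)) \<le> C"
      proof eventually_elim
        case (elim x)
        show ?case
        proof
          assume "x \<in> T"
          then have "norm x \<le> B" using B(2) by simp
          then show "norm (K (norm x)) \<le> C" using elim by simp
        qed
      qed
      then show "\<exists>C. AE x in lebesgue_on T. norm (K (norm x)) \<le> C"
        using T by (intro exI[of _ C]) (simp add: AE_restrict_space_iff lmeasurable_compact fmeasurableD)
    qed
    show "Linf_loc z"
      unfolding Linf_loc_def Linf_on_def
    proof (intro allI impI conjI)
      fix T :: "(real ^ 'n) set" assume T: "compact T"
      show "z \<in> borel_measurable (lebesgue_on T)"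
        by (rule meas[OF _ T]) (use z_div in \<open>simp add: weak_div_def\<close>)
      have "AE x in lebesgue. x \<in> T \<longrightarrow> norm (z x) \<le> 1" using z_bound by eventually_elim simp
      then have "AE x in lebesgue_on T. norm (z x) \<le> 1"
        using T by (simp add: AE_restrict_space_iff lmeasurable_compact fmeasurableD)
      then show "\<exists>C. AE x in lebesgue_on T. norm (z x) \<le> C" ..
    qed
  qed (rule z_div z_bound z_pairing)+

  \<comment> \<open>Case (i): dependence on the gradient is affine\<close>
  have affine: "AE x in lebesgue. K (norm x) = w x powr (- c) * F1 (norm x, u x, norm (Du x))"
    if aff: "\<forall>r\<ge>0. \<forall>t\<in>{0..\<xi>1}. \<exists>a b. \<forall>\<rho>\<in>{0..\<xi>2}. F1 (r, t, \<rho>) = a + b * \<rho>"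
  proof -
    \<comment> \<open>Intercept and slope are read off at the gradients 0 and \<open>\<xi>2\<close>,
      which makes them compositions with \<open>F1\<close> and hence measurable in x; the
      coefficients provided by the hypothesis are chosen point by point. Multiplying by
      1/\<open>\<xi>2\<close> instead of dividing suits \<open>ess_bounded_mult\<close>.\<close>
    define A where "A x = F1 (norm x, u x, 0)" for x
    define B where "B x = (F1 (norm x, u x, \<xi>2) - F1 (norm x, u x, 0)) * (1 / \<xi>2)" for x
    have F1_eq: "F1 (norm x, u x, \<rho>) = A x + B x * \<rho>" if "\<rho> \<in> {0..\<xi>2}" for x \<rho>
    proof -
      obtain a b where ab: "\<forall>\<rho>\<in>{0..\<xi>2}. F1 (norm x, u x, \<rho>) = a + b * \<rho>"
        using aff u_bounds[of x] norm_ge_zero[of x] by force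
      have "A x = a" using bspec[OF ab, of 0] params(5) by (simp add: A_def)
      moreover have "B x = b"
        using bspec[OF ab, of 0] bspec[OF ab, of \<xi>2] params(5) by (simp add: B_def)
      ultimately show ?thesis using bspec[OF ab that] by simp
    qed
    show ?thesis
    proof (rule AE_I_S)
      fix a b :: real assume ab: "0 < a" "a < b"
      let ?L = "lebesgue_on (S a b)"
      define T where "T = {0..b} \<times> {0..\<xi>1} \<times> {0..\<xi>2}"
      have "compact T" unfolding T_def by (intro compact_Times) auto
      moreover have "T \<subseteq> ?D" unfolding T_def by (intro Sigma_mono) auto
      ultimately have "compact (F1 ` T)"
        by (intro compact_continuous_image continuous_on_subset[OF F1_cont])
      then obtain M where M: "\<forall>y\<in>F1 ` T. norm y \<le> M" using compact_imp_bounded bounded_iff by meson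
      have F1_bdd: "ess_bounded ?L M (\<lambda>x. F1 (norm x, u x, \<rho>))" if "\<rho> \<in> {0..\<xi>2}" for \<rho>
        unfolding ess_bounded_def
      proof (intro conjI AE_I2)
        have "(\<lambda>x. (norm x, u x, \<rho>)) \<in> borel_measurable lebesgue"
          by (intro borel_measurable_Pair u_meas borel_measurable_const
              measurable_completion borel_measurable_norm measurable_ident_sets) simp
        then show "(\<lambda>x. F1 (norm x, u x, \<rho>)) \<in> borel_measurable ?L"
          by (intro measurable_restrict_space1 borel_measurable_compose_continuous_on[OF F1_cont])
            (use that u_range in auto)
        fix x assume "x \<in> space ?L"
        then have "(norm x, u x, \<rho>) \<in> T" using that u_range[of x] by (simp add: T_def S_def)
        then show "\<bar>F1 (norm x, u x, \<rho>)\<bar> \<le> M" using M by auto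
      qed
      have B_bdd: "ess_bounded ?L ((M + M) * \<bar>1 / \<xi>2\<bar>) B"
        unfolding B_def
      proof (rule ess_bounded_mult[OF ess_bounded_diff[OF F1_bdd F1_bdd]])
        show "ess_bounded ?L \<bar>1 / \<xi>2\<bar> (\<lambda>x. 1 / \<xi>2)" by (simp add: ess_bounded_def)
      qed (use params(5) in simp_all)
      \<comment> \<open>On the annulus max l |x| is at most max l b, and \<open>w\<close> is at
        least its power -(n-1); the power -c of \<open>w\<close> is therefore at most
        \<open>W\<close>.\<close>
      define W where "W = max l b powr ((real n - 1) * c)"
      have w_bdd: "ess_bounded ?L W (\<lambda>x. w x powr (- c))"
        unfolding ess_bounded_def
      proof
        have "w \<in> borel_measurable lebesgue" using w_Lq[of 1] by (simp add: tendsto_Lq_loc_def)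
        then show "(\<lambda>x. w x powr (- c)) \<in> borel_measurable ?L"
          by (intro measurable_restrict_space1 powr_real_measurable borel_measurable_const)
        have "AE x in lebesgue. x \<in> S a b \<longrightarrow> \<bar>w x powr (- c)\<bar> \<le> W"
          using w_bounds
        proof eventually_elim
          case (elim x)
          show ?case
          proof
            assume x: "x \<in> S a b"
            have pos: "0 < max l (norm x)" using params(3) by (simp only: less_max_iff_disj simp_thms)
            then have "0 < max l (norm x) powr (- (real n - 1))"
              using powr_gt_zero by (metis less_irrefl)
            then have "w x powr (- c) \<le> (max l (norm x) powr (- (real n - 1))) powr (- c)"
              using elim beta_lim(2) by (intro powr_mono2') simp_all
            also have "\<dots> = max l (norm x) powr ((real n - 1) * c)"
              by (simp only: powr_powr minus_mult_minus)
            also have "\<dots> \<le> W"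
              unfolding W_def using pos x beta_lim(2) n(2)
              by (intro powr_mono2 mult_nonneg_nonneg) (auto simp: S_def)
            finally show "\<bar>w x powr (- c)\<bar> \<le> W" by simp
          qed
        qed
        then show "AE x in ?L. \<bar>w x powr (- c)\<bar> \<le> W"
          using S_sets by (simp add: AE_restrict_space_iff)
      qed
      define c2 where "c2 x = w x powr (- c) * B x" for x
      have "ess_bounded ?L (W * ((M + M) * \<bar>1 / \<xi>2\<bar>)) c2"
        unfolding c2_def by (rule ess_bounded_mult[OF w_bdd B_bdd])
      then have c2_bdd: "ess_bounded ?L (W * ((M + M) * \<bar>1 / \<xi>2\<bar>)) (\<lambda>x. - c2 x)"
        by (simp add: ess_bounded_def)
      \<comment> \<open>Since \<open>V j\<close> is nonpositive, \<open>F1\<close> at |V j| is A - B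
        V j. Hence R j + c2 V j converges pointwise to the power of \<open>w\<close> times A,
        although neither summand need do so, and its weak limit is K + c2 v'. The double minus comes
        from using \<open>weak_star_diff\<close> for a sum.\<close>
      have "AE x in ?L. K (norm x) - - c2 x * v' (norm x) = w x powr (- c) * A x"
      proof (rule weak_star_AE_eq_limit[OF S_fin
            weak_star_diff[OF R_weak_S[OF ab] weak_star_mult[OF V_weak_S[OF ab(1)] c2_bdd]]])
        show "AE x in ?L. (\<lambda>j. R j (norm x) - - c2 x * V j (norm x)) \<longlonglongrightarrow> w x powr (- c) * A x"
          using AE_S[OF R_lim] AE_S[OF AE_nonzero]
        proof eventually_elim
          case (elim x)
          have "R j (norm x) - w x powr (- c) * F1 (norm x, u x, \<bar>V j (norm x)\<bar>)
              = R j (norm x) - - c2 x * V j (norm x) - w x powr (- c) * A x" for j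
          proof -
            have "\<bar>V j (norm x)\<bar> = - V j (norm x)" using V_eq[of "norm x" j] elim(2) by simp
            moreover have "\<bar>V j (norm x)\<bar> \<in> {0..\<xi>2}"
              using bounds(4)[OF seq norm_ge_zero[of x], of j] by (simp add: V_def)
            ultimately show ?thesis by (simp add: F1_eq c2_def algebra_simps)
          qed
          with elim(1) have "(\<lambda>j. R j (norm x) - - c2 x * V j (norm x) - w x powr (- c) * A x) \<longlonglongrightarrow> 0"
            by (simp only:)
          then show ?case by (rule LIM_zero_cancel)
        qed
      qed
      then show "AE x in ?L. K (norm x) = w x powr (- c) * F1 (norm x, u x, norm (Du x))"
        using AE_S[OF norm_Du] AE_S[OF AE_norm[OF v'_nonpos]] AE_S[OF AE_nonzero] AE_S[OF Du_bound]
      proof eventually_elim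
        case (elim x)
        have "norm (Du x) \<in> {0..\<xi>2}" using elim(5) by simp
        moreover have "v' (norm x) = - norm (Du x)" using elim(2-4) by simp
        ultimately show ?case using elim(1) by (simp add: F1_eq c2_def algebra_simps)
      qed
    qed
  qed

  \<comment> \<open>Case (ii): the set where G < 1\<close>
  have v'_Cless: "AE r in lebesgue. r \<in> Cless \<longrightarrow> \<bar>v' r\<bar> = 0"
    using G_v' by eventually_elim (auto simp: Cless)
  \<comment> \<open>The gradient vanishes here, so the third argument 0 in \<open>K_Cless\<close>
    equals \<open>norm (Du x)\<close>.\<close>
  have K_Cless': "AE x in lebesgue. norm x \<in> Cless \<longrightarrow>
      K (norm x) = w x powr (- c) * F1 (norm x, u x, norm (Du x))"
    using K_Cless norm_Du AE_norm[OF v'_Cless] by eventually_elim simp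

  \<comment> \<open>Case (ii): the set E inside the contact set G = 1\<close>
  have on_E: "(AE r in lebesgue. r \<in> E \<longrightarrow> \<bar>v' r\<bar> = exp (a r)) \<and>
      (AE x in lebesgue. norm x \<in> E \<longrightarrow> K (norm x) = w x powr (- c) * F1 (norm x, u x, norm (Du x)) \<and>
         w x powr (- c) * F1 (norm x, u x, norm (Du x)) = (real n - 1) / norm x)"
    if E: "E \<in> sets lebesgue" "E \<subseteq> C1" "emeasure lebesgue E > 0"
      and a: "AE r in lebesgue. r \<in> E \<longrightarrow> (\<lambda>j. (Gs (p j) r - 1) / (p j - 1)) \<longlonglongrightarrow> a r" for E a
  proof
    have V_lim: "AE r in lebesgue. r \<in> E \<longrightarrow> (\<lambda>j. V j r) \<longlonglongrightarrow> - exp (a r)"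
      using a
    proof eventually_elim
      case (elim r)
      show ?case
      proof
        assume r: "r \<in> E"
        then have r0: "0 < r" using E(2) by (auto simp: C1)
        from elim r have "(\<lambda>j. (Gs (p j) r - 1) / (p j - 1)) \<longlonglongrightarrow> a r" ..
        from tendsto_minus[OF powr_tendsto_exp[OF p1 p_tendsto this]]
        show "(\<lambda>j. V j r) \<longlonglongrightarrow> - exp (a r)" by (simp only: V_eq[OF r0])
      qed
    qed
    \<comment> \<open>Weak convergence is known on intervals, pointwise convergence on
      \<open>E\<close> only; the factor \<open>indicator E\<close> makes both available on the whole
      interval.\<close>
    have v'_E: "AE r in lebesgue. 0 < r \<longrightarrow> indicator E r * v' r = indicator E r * - exp (a r)"
    proof (rule AE_intervals)
      fix s t :: real assume st: "0 < s" "s < t"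
      have E_bdd: "ess_bounded (lebesgue_on {s..t}) 1 (indicator E)"
        unfolding ess_bounded_def
        by (intro conjI measurable_restrict_space1 borel_measurable_indicator E(1) AE_I2) (simp add: indicator_def)
      have "AE r in lebesgue_on {s..t}. r \<in> E \<longrightarrow> (\<lambda>j. V j r) \<longlonglongrightarrow> - exp (a r)"
        using V_lim by (subst AE_restrict_space_iff) (auto elim: eventually_mono)
      then have "AE r in lebesgue_on {s..t}. (\<lambda>j. indicator E r * V j r) \<longlonglongrightarrow> indicator E r * - exp (a r)"
        by eventually_elim (auto simp: indicator_def)
      then show "AE r in lebesgue_on {s..t}. indicator E r * v' r = indicator E r * - exp (a r)"
        by (rule weak_star_AE_eq_limit[OF finite_measure_lebesgue_Icc weak_star_mult[OF V_weak[OF st(1)] E_bdd]])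
    qed
    show abs_v': "AE r in lebesgue. r \<in> E \<longrightarrow> \<bar>v' r\<bar> = exp (a r)"
      using v'_E
    proof eventually_elim
      case (elim r)
      show ?case
      proof
        assume r: "r \<in> E"
        then have "0 < r" using E(2) by (auto simp: C1)
        with elim r have "v' r = - exp (a r)" by simp
        then show "\<bar>v' r\<bar> = exp (a r)" by simp
      qed
    qed
    let ?H = "\<lambda>x. w x powr (- c) * F1 (norm x, u x, exp (a (norm x)))"
    have "AE x in lebesgue. indicator E (norm x) * K (norm x) = indicator E (norm x) * ?H x"
    proof (rule AE_I_S)
      fix s t :: real assume st: "0 < s" "s < t"
      have E_bdd: "ess_bounded (lebesgue_on (S s t)) 1 (\<lambda>x. indicator E (norm x))"
        unfolding ess_bounded_def
      proof (intro conjI AE_I2)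
        have "(\<lambda>x :: real ^ 'n. indicator E (norm x) :: real) \<in> borel_measurable lebesgue"
          by (rule measurable_compose[OF measurable_norm_lebesgue borel_measurable_indicator[OF E(1)]])
        then show "(\<lambda>x :: real ^ 'n. indicator E (norm x) :: real) \<in> borel_measurable (lebesgue_on (S s t))"
          by (rule measurable_restrict_space1)
      qed (simp add: indicator_def)
      show "AE x in lebesgue_on (S s t). indicator E (norm x) * K (norm x) = indicator E (norm x) * ?H x"
      proof (rule weak_star_AE_eq_limit[OF S_fin weak_star_mult[OF R_weak_S[OF st] E_bdd]])
        show "AE x in lebesgue_on (S s t). (\<lambda>j. indicator E (norm x) * R j (norm x)) \<longlonglongrightarrow> indicator E (norm x) * ?H x"
          using AE_S[OF R_lim] AE_S[OF AE_norm[OF V_lim]]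
        proof eventually_elim
          case (elim x)
          show ?case
          proof (cases "norm x \<in> E")
            case True
            with elim(2) have "(\<lambda>j. V j (norm x)) \<longlonglongrightarrow> - exp (a (norm x))" by simp
            from tendsto_rabs[OF this] have V: "(\<lambda>j. \<bar>V j (norm x)\<bar>) \<longlonglongrightarrow> exp (a (norm x))" by simp
            \<comment> \<open>On \<open>E\<close> the gradients converge pointwise, so mere
              continuity of \<open>F1\<close> takes the place of the affine structure of case
              (i).\<close>
            have "(\<lambda>j. F1 (norm x, u x, \<bar>V j (norm x)\<bar>)) \<longlonglongrightarrow> F1 (norm x, u x, exp (a (norm x)))"
            proof (rule continuous_on_tendsto_compose[OF F1_cont])
              show "(\<lambda>j. (norm x, u x, \<bar>V j (norm x)\<bar>)) \<longlonglongrightarrow> (norm x, u x, exp (a (norm x)))"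
                by (intro tendsto_Pair tendsto_const V)
            qed (simp_all add: u_range)
            then have "(\<lambda>j. w x powr (- c) * F1 (norm x, u x, \<bar>V j (norm x)\<bar>)) \<longlonglongrightarrow> ?H x"
              by (intro tendsto_mult tendsto_const)
            from tendsto_add[OF elim(1) this] have "(\<lambda>j. R j (norm x)) \<longlonglongrightarrow> ?H x" by simp
            then show ?thesis by (intro tendsto_mult tendsto_const)
          qed simp
        qed
      qed
    qed
    then have K_E: "AE x in lebesgue. norm x \<in> E \<longrightarrow>
        K (norm x) = w x powr (- c) * F1 (norm x, u x, norm (Du x))"
      using norm_Du AE_norm[OF abs_v']
    proof eventually_elim
      case (elim x)
      show ?case
      proof
        assume x: "norm x \<in> E"
        then have "norm (Du x) = exp (a (norm x))" using elim(2,3) by simp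
        then show "K (norm x) = w x powr (- c) * F1 (norm x, u x, norm (Du x))"
          using elim(1) x by simp
      qed
    qed
    \<comment> \<open>A set that is not measurable has \<open>emeasure\<close> 0 by convention, so
      positivity for \<open>E\<close> passes to \<open>C1\<close> only once \<open>C1\<close> is
      known to be measurable. \<open>G\<close> is measurable on bounded intervals, hence the
      countable union.\<close>
    have "C1 \<in> sets lebesgue"
    proof -
      have "{r \<in> space (lebesgue_on {0<..<real k + 1}). G r = 1} \<in> sets (lebesgue_on {0<..<real k + 1})" for k
      proof (rule borel_measurable_eq[OF _ borel_measurable_const])
        show "G \<in> borel_measurable (lebesgue_on {0<..<real k + 1})"
          using G_W[of "real k + 1"] by (simp add: W1inf_on_def Linf_on_def)
      qed
      then have "{r \<in> {0<..<real k + 1}. G r = 1} \<in> sets lebesgue" for k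
        by (simp add: sets_restrict_space_iff)
      then have "(\<Union>k. {r \<in> {0<..<real k + 1}. G r = 1}) \<in> sets lebesgue"
        by (intro sets.countable_UN) (simp add: image_subset_iff)
      also have "(\<Union>k. {r \<in> {0<..<real k + 1}. G r = 1}) = C1"
      proof
        show "C1 \<subseteq> (\<Union>k. {r \<in> {0<..<real k + 1}. G r = 1})"
        proof
          fix r assume "r \<in> C1"
          moreover obtain k :: nat where "r \<le> real k" using real_arch_simple by blast
          ultimately show "r \<in> (\<Union>k. {r \<in> {0<..<real k + 1}. G r = 1})"
            by (intro UN_I[of k]) (simp_all add: C1)
        qed
      qed (auto simp: C1)
      finally show ?thesis .
    qed
    then have "emeasure lebesgue E \<le> emeasure lebesgue C1" by (rule emeasure_mono[OF E(2)])
    with E(3) have "emeasure lebesgue C1 > 0" by (rule less_le_trans)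
    from K_E K_C1[OF this]
    show "AE x in lebesgue. norm x \<in> E \<longrightarrow> K (norm x) = w x powr (- c) * F1 (norm x, u x, norm (Du x)) \<and>
         w x powr (- c) * F1 (norm x, u x, norm (Du x)) = (real n - 1) / norm x"
    proof eventually_elim
      case (elim x)
      show ?case
      proof
        assume "norm x \<in> E"
        then have "norm x \<in> C1" using E(2) by (rule subsetD[rotated])
        with elim \<open>norm x \<in> E\<close>
        show "K (norm x) = w x powr (- c) * F1 (norm x, u x, norm (Du x)) \<and>
          w x powr (- c) * F1 (norm x, u x, norm (Du x)) = (real n - 1) / norm x" by simp
      qed
    qed
  qed

  \<comment> \<open>Collecting the conclusions\<close>
  show ?thesis
  proof (rule conjI[OF laplace], rule conjI[OF impI], erule affine, rule conjI[OF v'_Cless],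
      rule conjI[OF K_Cless'], rule allI, rule allI, rule impI, intro conjI)
    fix E a
    assume "E \<in> sets lebesgue \<and> E \<subseteq> C1 \<and> emeasure lebesgue E > 0 \<and>
      (AE r in lebesgue. r \<in> E \<longrightarrow> (\<lambda>j. (Gs (p j) r - 1) / (p j - 1)) \<longlonglongrightarrow> a r)"
    then have E: "(AE r in lebesgue. r \<in> E \<longrightarrow> \<bar>v' r\<bar> = exp (a r)) \<and>
      (AE x in lebesgue. norm x \<in> E \<longrightarrow> K (norm x) = w x powr (- c) * F1 (norm x, u x, norm (Du x)) \<and>
         w x powr (- c) * F1 (norm x, u x, norm (Du x)) = (real n - 1) / norm x)"
      by (elim conjE) (rule on_E)
    then show "AE r in lebesgue. r \<in> E \<longrightarrow> \<bar>v' r\<bar> = exp (a r)" by (rule conjunct1)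
    from E show K_E: "AE x in lebesgue. norm x \<in> E \<longrightarrow>
        K (norm x) = w x powr (- c) * F1 (norm x, u x, norm (Du x)) \<and>
        w x powr (- c) * F1 (norm x, u x, norm (Du x)) = (real n - 1) / norm x" by (rule conjunct2)
    show "AE x in lebesgue. norm x \<in> Cless \<union> E \<longrightarrow>
        K (norm x) = w x powr (- c) * F1 (norm x, u x, norm (Du x))"
      using K_Cless' K_E
    proof eventually_elim
      case (elim x)
      show ?case
      proof
        assume "norm x \<in> Cless \<union> E"
        then show "K (norm x) = w x powr (- c) * F1 (norm x, u x, norm (Du x))"
        proof
          assume "norm x \<in> Cless"
          with elim(1) show ?thesis by (rule mp)
        next
          assume "norm x \<in> E"
          with elim(2) show ?thesis by simp
        qed
      qed
    qed
  qed
qed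

end
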